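(* Assume that the period lattice $\mathcal{L}_f$ is non-rectangular and that $N$ is odd. Let $m=q_1\cdots q_{r(m)}$ be a product of $r(m)\ge1$ distinct odd primes with $\gcd(m,N)=1$, and put $M=4m$. (i) If $q_i\in\mathcal{S}_0\cup\mathcal{S}_1\cup\mathcal{S}_2$ for all $i$, then $$v_2\left(\frac{L(f,\chi_M,1)}{\Omega_f^{\mathrm{sgn}(\chi_M)}}\right)\ge \mathfrak{w}_m r(m)+\min\left\{-1+\delta_{\mathfrak{v}_m,0},\ -1+\delta_{\mathfrak{v}_m,0}+v_2\left(\frac{L(f,1)}{\Omega_f^+}\right),\ v_2\left(\frac{L(f,\chi_4,1)}{\Omega_f^-}\right)+\delta_{\mathfrak{v}_m,2}\right\},$$ and if $v_2(L(f,\chi_4,1)/\Omega_f^-)=-1$ and $q_i\in\mathcal{S}_0$ for all $i$, equality holds. (ii) If $q_i\in\mathcal{S}_0^+\cup\mathcal{S}_1^+\cup\mathcal{S}_2^+$ for all $i$, then $$v_2\left(\frac{L(f,\chi_M,1)}{\Omega_f^{\mathrm{sgn}(\chi_M)}}\right)\ge \mathfrak{w}_m r(m)+\min\left\{-1+\delta_{\mathfrak{v}_m,0},\ v_2\left(\frac{L(f,\chi_4,1)}{\Omega_f^-}\right)+\delta_{\mathfrak{v}_m,2}\right\},$$ and if $v_2(L(f,\chi_4,1)/\Omega_f^-)=-1$ and $q_i\in\mathcal{S}_0^+$ for all $i$, equality holds.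
   Context: Let $f=\sum_{n\ge1}a_nq^n\in S_2(\Gamma_0(N))^{\mathrm{new}}$ be a normalized Hecke eigenform of weight 2 with all $a_n\in\mathbb{Q}$. Let $E$ be the optimal elliptic curve over $\mathbb{Q}$ attached to $f$, with modular parametrization $\Phi:X_0(N)\to E$ and Néron differential $\omega_E$ of a global minimal model; assume the Manin constant is $1$, i.e. $f(q)\,dq/q=\Phi^*\omega_E$. Then the period lattice $\mathcal{L}_f=\{\int_\gamma f(q)\,dq/q:\gamma\in H_1(X_0(N)(\mathbb{C}),\mathbb{Z})\}$ equals that of $\omega_E$, and there are reals $\Omega_f^{\pm}>0$ with either $\mathcal{L}_f=\Omega_f^+\mathbb{Z}+i\Omega_f^-\mathbb{Z}$ (rectangular) or $\mathcal{L}_f=\Omega_f^+\mathbb{Z}+\frac{\Omega_f^++i\Omega_f^-}{2}\mathbb{Z}$ (non-rectangular). For odd squarefree $d$, $\chi_d$ is the primitive quadratic character of conductor $d$ (product of Legendre symbols), $\chi_4$ is the nontrivial character mod 4, and $\chi_{4d}=\chi_4\chi_d$; $\mathrm{sgn}(\chi)=\chi(-1)$. $L(f,\chi,s)$ is the analytic continuation of $\sum_n\chi(n)a_nn^{-s}$; the central ratios used are algebraic. $v_2$ is a 2-adic valuation on $\overline{\mathbb{Q}}$ with $v_2(2)=1$, $v_2(0)=+\infty$. For an integer $i$, $\mathcal{S}_i^{\pm}$ is the set of odd primes $q\nmid N$ with $\chi_q(-1)=\pm1$ and $v_2(a_q-2)=i$; $\mathcal{S}_i=\mathcal{S}_i^+\cup\mathcal{S}_i^-$.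 $\mathfrak{v}_m=\min_{q\mid m\text{ prime}}v_2(a_q-2)$; $\mathfrak{w}_m=0$ if $\mathfrak{v}_m=0$ and $1$ otherwise. $\delta_{i,j}$ is the Kronecker delta. *)

theory Defs
  imports
    "HOL-Complex_Analysis.Complex_Analysis"
    "HOL-Number_Theory.Number_Theory"
    "HOL-Computational_Algebra.Squarefree"
begin

definition upper_half_plane :: "complex set" where
  "upper_half_plane = {z. Im z > 0}"

definition SL2Z :: "(int ^ 2 ^ 2) set" where
  "SL2Z = {A. det A = 1}"

definition Gamma0 :: "nat \<Rightarrow> (int ^ 2 ^ 2) set" where
  "Gamma0 N = {A \<in> SL2Z. int N dvd A $ 2 $ 1}"

definition moebius_act :: "int ^ 2 ^ 2 \<Rightarrow> complex \<Rightarrow> complex" where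
  "moebius_act A z =
     (of_int (A $ 1 $ 1) * z + of_int (A $ 1 $ 2)) / (of_int (A $ 2 $ 1) * z + of_int (A $ 2 $ 2))"

definition slash2 :: "(complex \<Rightarrow> complex) \<Rightarrow> int ^ 2 ^ 2 \<Rightarrow> complex \<Rightarrow> complex" where
  "slash2 f A z = f (moebius_act A z) / (of_int (A $ 2 $ 1) * z + of_int (A $ 2 $ 2)) ^ 2"

text \<open>The limit \<open>Im z \<longlongrightarrow> \<infinity>\<close>, uniformly in \<open>Re z\<close>.\<close>

definition at_i_infinity :: "complex filter" where
  "at_i_infinity = filtercomap Im at_top"

text \<open>Vanishing at the cusp \<open>A\<infinity>\<close> is vanishing of the constant term of \<open>f|A\<close>, that is,
  decay of \<open>f|A\<close> at \<open>i\<infinity>\<close>.  Values of forms off the upper half plane carry no meaning.\<close>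

definition cusp_form2 :: "nat \<Rightarrow> (complex \<Rightarrow> complex) \<Rightarrow> bool" where
  "cusp_form2 N f \<longleftrightarrow>
     f holomorphic_on upper_half_plane \<and>
     (\<forall>A \<in> Gamma0 N. \<forall>z \<in> upper_half_plane. slash2 f A z = f z) \<and>
     (\<forall>A \<in> SL2Z. (slash2 f A \<longlongrightarrow> 0) at_i_infinity)"

text \<open>The Petersson product, as a sum over \<open>\<Gamma>\<^sub>0(N)\SL\<^sub>2(\<int>)\<close> of integrals over the standard
  fundamental domain of \<open>SL\<^sub>2(\<int>)\<close>.  In weight 2 the factor \<open>y\<^sup>2\<close> cancels against the
  hyperbolic measure \<open>dx dy / y\<^sup>2\<close>.  For cusp forms the summand does not depend on the
  representative of the coset.\<close>

definition fundamental_domain :: "complex set" where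
  "fundamental_domain = {z. Im z > 0 \<and> \<bar>Re z\<bar> \<le> 1 / 2 \<and> norm z \<ge> 1}"

definition Gamma0_cosets :: "nat \<Rightarrow> (int ^ 2 ^ 2) set set" where
  "Gamma0_cosets N = (\<lambda>A. (\<lambda>B. B ** A) ` Gamma0 N) ` SL2Z"

definition petersson :: "nat \<Rightarrow> (complex \<Rightarrow> complex) \<Rightarrow> (complex \<Rightarrow> complex) \<Rightarrow> complex" where
  "petersson N f g =
     (\<Sum>C \<in> Gamma0_cosets N. let A = (SOME A. A \<in> C) in
        set_lebesgue_integral lborel fundamental_domain
          (\<lambda>z. slash2 f A z * cnj (slash2 g A z)))"

text \<open>The old subspace is spanned by the forms \<open>g(dz)\<close> below; being orthogonal to the span
  is the same as being orthogonal to these generators.\<close>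

definition oldform_generators :: "nat \<Rightarrow> (complex \<Rightarrow> complex) set" where
  "oldform_generators N =
     {(\<lambda>z. g (of_nat d * z)) | g d. \<exists>M. M * d dvd N \<and> M < N \<and> cusp_form2 M g}"

definition new_subspace :: "nat \<Rightarrow> (complex \<Rightarrow> complex) set" where
  "new_subspace N =
     {f. cusp_form2 N f \<and> (\<forall>g \<in> oldform_generators N. petersson N f g = 0)}"

definition hecke_op :: "nat \<Rightarrow> nat \<Rightarrow> (complex \<Rightarrow> complex) \<Rightarrow> complex \<Rightarrow> complex" where
  "hecke_op N n f z =
     of_nat n * (\<Sum>d | d dvd n \<and> coprime (n div d) N.
       (\<Sum>b<d. f ((of_nat (n div d) * z + of_nat b) / of_nat d)) / of_nat d ^ 2)"

definition hecke_eigenform :: "nat \<Rightarrow> (complex \<Rightarrow> complex) \<Rightarrow> bool" where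
  "hecke_eigenform N f \<longleftrightarrow>
     (\<exists>z \<in> upper_half_plane. f z \<noteq> 0) \<and>
     (\<forall>n\<ge>1. \<exists>l::complex. \<forall>z \<in> upper_half_plane. hecke_op N n f z = l * f z)"

definition q_param :: "complex \<Rightarrow> complex" where
  "q_param z = exp (2 * of_real pi * \<i> * z)"

definition rational_newform :: "nat \<Rightarrow> (complex \<Rightarrow> complex) \<Rightarrow> (nat \<Rightarrow> rat) \<Rightarrow> bool" where
  "rational_newform N f a \<longleftrightarrow>
     N \<ge> 1 \<and> f \<in> new_subspace N \<and> hecke_eigenform N f \<and> a 0 = 0 \<and> a 1 = 1 \<and>
     (\<forall>z \<in> upper_half_plane. (\<lambda>n. of_rat (a n) * q_param z ^ n) sums f z)"

text \<open>The differential \<open>f(q) dq/q\<close> is \<open>2\<pi>i f(z) dz\<close>.\<close>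

definition form_dq_q :: "(complex \<Rightarrow> complex) \<Rightarrow> complex \<Rightarrow> complex" where
  "form_dq_q f z = 2 * of_real pi * \<i> * f z"

text \<open>A closed path on \<open>X\<^sub>0(N)(\<complex>)\<close>, given by a lift to the upper half plane.  Closed paths
  avoiding the cusps represent all of \<open>H\<^sub>1(X\<^sub>0(N)(\<complex>), \<int>)\<close>, since removing finitely many
  points from a surface induces a surjection on \<open>H\<^sub>1\<close>.\<close>

definition X0_closed_path :: "nat \<Rightarrow> (real \<Rightarrow> complex) \<Rightarrow> bool" where
  "X0_closed_path N p \<longleftrightarrow>
     valid_path p \<and> path_image p \<subseteq> upper_half_plane \<and>
     (\<exists>A \<in> Gamma0 N. pathfinish p = moebius_act A (pathstart p))"

definition period_lattice :: "nat \<Rightarrow> (complex \<Rightarrow> complex) \<Rightarrow> complex set" where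
  "period_lattice N f =
     {(\<Sum>j<k. of_int (c j) * contour_integral (p j) (form_dq_q f)) | (k::nat) (c::nat \<Rightarrow> int) p.
        \<forall>j<k. X0_closed_path N (p j)}"

definition nonrectangular_lattice :: "real \<Rightarrow> real \<Rightarrow> complex set" where
  "nonrectangular_lattice \<Omega>p \<Omega>m =
     {of_int k * of_real \<Omega>p + of_int l * ((of_real \<Omega>p + \<i> * of_real \<Omega>m) / 2) | k l. True}"

text \<open>\<open>y\<^sup>2 + a\<^sub>1xy + a\<^sub>3y = x\<^sup>3 + a\<^sub>2x\<^sup>2 + a\<^sub>4x + a\<^sub>6\<close>\<close>

datatype 'a weierstrass = Weierstrass (wa1: 'a) (wa2: 'a) (wa3: 'a) (wa4: 'a) (wa6: 'a)

definition wdisc :: "'a::comm_ring_1 weierstrass \<Rightarrow> 'a" where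
  "wdisc W =
    (let b2 = wa1 W ^ 2 + 4 * wa2 W;
         b4 = 2 * wa4 W + wa1 W * wa3 W;
         b6 = wa3 W ^ 2 + 4 * wa6 W;
         b8 = wa1 W ^ 2 * wa6 W + 4 * wa2 W * wa6 W - wa1 W * wa3 W * wa4 W
              + wa2 W * wa3 W ^ 2 - wa4 W ^ 2
     in - (b2 ^ 2) * b8 - 8 * b4 ^ 3 - 27 * b6 ^ 2 + 9 * b2 * b4 * b6)"

text \<open>The substitution \<open>x = u\<^sup>2x' + r\<close>, \<open>y = u\<^sup>3y' + su\<^sup>2x' + t\<close> takes \<open>W\<close> to \<open>W'\<close>.\<close>

definition wisomorphic :: "'a::field weierstrass \<Rightarrow> 'a weierstrass \<Rightarrow> bool" where
  "wisomorphic W W' \<longleftrightarrow> (\<exists>u r s t. u \<noteq> 0 \<and>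
     u * wa1 W' = wa1 W + 2 * s \<and>
     u ^ 2 * wa2 W' = wa2 W - s * wa1 W + 3 * r - s ^ 2 \<and>
     u ^ 3 * wa3 W' = wa3 W + r * wa1 W + 2 * t \<and>
     u ^ 4 * wa4 W' = wa4 W - s * wa3 W + 2 * r * wa2 W - (t + r * s) * wa1 W + 3 * r ^ 2 - 2 * s * t \<and>
     u ^ 6 * wa6 W' = wa6 W + r * wa4 W + r ^ 2 * wa2 W + r ^ 3 - t * wa3 W - t ^ 2 - r * t * wa1 W)"

abbreviation over_Q :: "int weierstrass \<Rightarrow> rat weierstrass" where
  "over_Q \<equiv> map_weierstrass of_int"

abbreviation over_C :: "rat weierstrass \<Rightarrow> complex weierstrass" where
  "over_C \<equiv> map_weierstrass of_rat"

text \<open>Divisibility of discriminants expresses minimality at all primes simultaneously.\<close>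

definition global_minimal :: "int weierstrass \<Rightarrow> bool" where
  "global_minimal W \<longleftrightarrow> wdisc W \<noteq> 0 \<and>
     (\<forall>W'. wisomorphic (over_Q W) (over_Q W') \<longrightarrow> wdisc W dvd wdisc W')"

definition on_curve :: "'a::comm_ring_1 weierstrass \<Rightarrow> 'a \<Rightarrow> 'a \<Rightarrow> bool" where
  "on_curve W x y \<longleftrightarrow>
     y ^ 2 + wa1 W * x * y + wa3 W * y = x ^ 3 + wa2 W * x ^ 2 + wa4 W * x + wa6 W"

definition rational_at_infinity :: "(complex \<Rightarrow> complex) \<Rightarrow> bool" where
  "rational_at_infinity h \<longleftrightarrow>
     (\<exists>(k::nat) (c::nat \<Rightarrow> rat).
        \<forall>\<^sub>F z in at_i_infinity. (\<lambda>n. of_rat (c n) * q_param z ^ n) sums (q_param z ^ k * h z))"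

definition meromorphic_at_cusps :: "(complex \<Rightarrow> complex) \<Rightarrow> bool" where
  "meromorphic_at_cusps h \<longleftrightarrow>
     (\<forall>A \<in> SL2Z. \<exists>k::nat. ((\<lambda>z. q_param z ^ k * h (moebius_act A z)) \<longlongrightarrow> 0) at_i_infinity)"

definition modular_function_over_Q :: "nat \<Rightarrow> (complex \<Rightarrow> complex) \<Rightarrow> bool" where
  "modular_function_over_Q N h \<longleftrightarrow>
     h nicely_meromorphic_on upper_half_plane \<and>
     (\<forall>A \<in> Gamma0 N. \<forall>z \<in> upper_half_plane. h (moebius_act A z) = h z) \<and>
     meromorphic_at_cusps h \<and> rational_at_infinity h"

text \<open>A morphism \<open>\<Phi> = (X, Y)\<close> over \<open>\<rat>\<close> from \<open>X\<^sub>0(N)\<close> to the elliptic curve \<open>W\<close>, taking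
  the cusp \<open>\<infinity>\<close> to the origin.  The function field of \<open>X\<^sub>0(N)\<close> over \<open>\<rat>\<close> consists of the
  modular functions whose \<open>q\<close>-expansion at \<open>\<infinity>\<close> is rational.\<close>

definition modular_parametrization ::
    "nat \<Rightarrow> rat weierstrass \<Rightarrow> (complex \<Rightarrow> complex) \<Rightarrow> (complex \<Rightarrow> complex) \<Rightarrow> bool" where
  "modular_parametrization N W X Y \<longleftrightarrow>
     wdisc W \<noteq> 0 \<and>
     modular_function_over_Q N X \<and> modular_function_over_Q N Y \<and>
     (\<forall>z \<in> upper_half_plane. \<not> is_pole X z \<longrightarrow> on_curve (over_C W) (X z) (Y z)) \<and>
     filterlim X at_infinity at_i_infinity"

text \<open>The affine point \<open>(X, Y)\<close>, or \<open>None\<close> for the origin.\<close>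

definition param_point ::
    "(complex \<Rightarrow> complex) \<Rightarrow> (complex \<Rightarrow> complex) \<Rightarrow> complex \<Rightarrow> (complex \<times> complex) option" where
  "param_point X Y z = (if is_pole X z then None else Some (X z, Y z))"

text \<open>\<open>\<Phi>\<^sup>*\<omega> = c f(q) dq/q\<close> for the invariant differential
  \<open>\<omega> = dx / (2y + a\<^sub>1x + a\<^sub>3) = dy / (3x\<^sup>2 + 2a\<^sub>2x + a\<^sub>4 - a\<^sub>1y)\<close>.  The two denominators
  do not vanish simultaneously on a nonsingular curve.\<close>

definition pullback_differential ::
    "rat weierstrass \<Rightarrow> (complex \<Rightarrow> complex) \<Rightarrow> (complex \<Rightarrow> complex) \<Rightarrow> rat \<Rightarrow> (complex \<Rightarrow> complex) \<Rightarrow> bool" where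
  "pullback_differential W X Y c f \<longleftrightarrow>
     (\<forall>z \<in> upper_half_plane. \<not> is_pole X z \<longrightarrow>
        (let V = over_C W; h = of_rat c * form_dq_q f z in
         deriv X z = h * (2 * Y z + wa1 V * X z + wa3 V) \<and>
         deriv Y z = h * (3 * X z ^ 2 + 2 * wa2 V * X z + wa4 V - wa1 V * Y z)))"

definition attached_parametrization ::
    "nat \<Rightarrow> (complex \<Rightarrow> complex) \<Rightarrow> rat weierstrass \<Rightarrow> (complex \<Rightarrow> complex) \<Rightarrow> (complex \<Rightarrow> complex) \<Rightarrow> bool" where
  "attached_parametrization N f W X Y \<longleftrightarrow>
     modular_parametrization N W X Y \<and> (\<exists>c. c \<noteq> 0 \<and> pullback_differential W X Y c f)"

text \<open>The optimal quotient of \<open>J\<^sub>0(N)\<close> attached to \<open>f\<close>, by its universal property: every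
  parametrization \<open>\<Phi>'\<close> of a curve attached to \<open>f\<close> factors through \<open>\<Phi>\<close>, that is, \<open>\<Phi>'\<close> is
  constant on the fibres of \<open>\<Phi>\<close>.\<close>

definition optimal_parametrization ::
    "nat \<Rightarrow> (complex \<Rightarrow> complex) \<Rightarrow> rat weierstrass \<Rightarrow> (complex \<Rightarrow> complex) \<Rightarrow> (complex \<Rightarrow> complex) \<Rightarrow> bool" where
  "optimal_parametrization N f W X Y \<longleftrightarrow>
     attached_parametrization N f W X Y \<and>
     (\<forall>W' X' Y'. attached_parametrization N f W' X' Y' \<longrightarrow>
        (\<forall>z \<in> upper_half_plane. \<forall>w \<in> upper_half_plane.
           param_point X Y z = param_point X Y w \<longrightarrow> param_point X' Y' z = param_point X' Y' w))"

definition chi4 :: "int \<Rightarrow> int" where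
  "chi4 n = (if n mod 4 = 1 then 1 else if n mod 4 = 3 then -1 else 0)"

text \<open>For odd squarefree \<open>d\<close>, \<open>quad_char d\<close> is \<open>\<chi>\<^sub>d\<close> and \<open>quad_char (4 * d)\<close> is
  \<open>\<chi>\<^sub>4\<^sub>d = \<chi>\<^sub>4\<chi>\<^sub>d\<close>; in particular \<open>quad_char 1\<close> is constantly 1 and \<open>quad_char 4\<close> is \<open>\<chi>\<^sub>4\<close>.\<close>

definition quad_char :: "nat \<Rightarrow> int \<Rightarrow> int" where
  "quad_char D n =
     (if 4 dvd D then chi4 n * (\<Prod>p \<in> prime_factors (D div 4). Legendre n (int p))
      else (\<Prod>p \<in> prime_factors D. Legendre n (int p)))"

text \<open>The entire continuation of \<open>\<Sum>\<^sub>n \<chi>(n) a\<^sub>n n\<^sup>-\<^sup>s\<close> from a half plane of convergence.\<close>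

definition twisted_L :: "(nat \<Rightarrow> rat) \<Rightarrow> (int \<Rightarrow> int) \<Rightarrow> complex \<Rightarrow> complex" where
  "twisted_L a psi = (THE F. F holomorphic_on UNIV \<and>
     (\<exists>\<sigma>::real. \<forall>s. Re s > \<sigma> \<longrightarrow>
        (\<lambda>n. of_int (psi (int (Suc n))) * of_rat (a (Suc n)) * of_nat (Suc n) powr (- s)) sums F s))"

definition central_ratio :: "(nat \<Rightarrow> rat) \<Rightarrow> real \<Rightarrow> real \<Rightarrow> nat \<Rightarrow> complex" where
  "central_ratio a \<Omega>p \<Omega>m D =
     twisted_L a (quad_char D) 1 / of_real (if quad_char D (-1) = 1 then \<Omega>p else \<Omega>m)"

text \<open>A valuation on the algebraic numbers inside \<open>\<complex>\<close>, normalized by \<open>v(2) = 1\<close>; values at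
  transcendental numbers carry no meaning.\<close>

definition two_adic_valuation :: "(complex \<Rightarrow> ereal) \<Rightarrow> bool" where
  "two_adic_valuation v \<longleftrightarrow>
     v 0 = \<infinity> \<and> v 2 = 1 \<and>
     (\<forall>x. algebraic x \<longrightarrow> x \<noteq> 0 \<longrightarrow> \<bar>v x\<bar> \<noteq> \<infinity>) \<and>
     (\<forall>x y. algebraic x \<longrightarrow> algebraic y \<longrightarrow> v (x * y) = v x + v y) \<and>
     (\<forall>x y. algebraic x \<longrightarrow> algebraic y \<longrightarrow> v (x + y) \<ge> min (v x) (v y))"

definition S_signed :: "(complex \<Rightarrow> ereal) \<Rightarrow> nat \<Rightarrow> (nat \<Rightarrow> rat) \<Rightarrow> int \<Rightarrow> int \<Rightarrow> nat set" where
  "S_signed v N a \<epsilon> i =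
     {q. prime q \<and> odd q \<and> \<not> q dvd N \<and> quad_char q (-1) = \<epsilon> \<and>
         v (of_rat (a q - 2)) = ereal (of_int i)}"

abbreviation S_plus where "S_plus v N a i \<equiv> S_signed v N a 1 i"

abbreviation S_minus where "S_minus v N a i \<equiv> S_signed v N a (-1) i"

definition S_all :: "(complex \<Rightarrow> ereal) \<Rightarrow> nat \<Rightarrow> (nat \<Rightarrow> rat) \<Rightarrow> int \<Rightarrow> nat set" where
  "S_all v N a i = S_plus v N a i \<union> S_minus v N a i"

definition vmin :: "(complex \<Rightarrow> ereal) \<Rightarrow> (nat \<Rightarrow> rat) \<Rightarrow> nat \<Rightarrow> ereal" where
  "vmin v a m = Min ((\<lambda>q. v (of_rat (a q - 2))) ` prime_factors m)"

definition wmin :: "(complex \<Rightarrow> ereal) \<Rightarrow> (nat \<Rightarrow> rat) \<Rightarrow> nat \<Rightarrow> ereal" where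
  "wmin v a m = (if vmin v a m = 0 then 0 else 1)"

definition kronecker :: "ereal \<Rightarrow> ereal \<Rightarrow> ereal" where
  "kronecker x y = (if x = y then 1 else 0)"

end

theory Submission
  imports Defs "HOL-Real_Asymp.Real_Asymp"
begin

text \<open>
  Write \<open>J(r) = 2\<pi> \<integral>\<^sub>0\<^sup>\<infinity> f(r + iy) dy\<close>.  If \<open>r\<close> has denominator prime to \<open>N\<close>, then \<open>J(r) - J(0)\<close>
  lies in the period lattice, so \<open>J(r) = J(0) + (s(r)\<Omega>\<^sup>+ + i t(r)\<Omega>\<^sup>-)/2\<close> with integers
  \<open>s(r) \<equiv> t(r) mod 2\<close>, the congruence coming from the non-rectangular shape.  A Mellin transform
  gives \<open>L(f,\<chi>,1) = \<tau>(\<chi>)\<^sup>-\<^sup>1 \<Sum>\<^sub>k \<chi>(k) J(k/4d)\<close> for \<open>\<chi> = \<chi>\<^sub>4\<^sub>d\<close>, and \<open>\<tau>(\<chi>)\<^sup>2 = \<plusminus>4d\<close>; hence the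
  normalized value has valuation \<open>v(A(\<chi>)) - 1\<close>, where \<open>A(\<chi>)\<close> is the sum of
  \<open>\<chi>(k) s(k/4d)/2\<close> or of \<open>\<chi>(k) t(k/4d)/2\<close> according to the parity of \<open>\<chi>\<close>.

  The Hecke relation at \<open>q\<close> shows that raising the level by \<open>q\<close> multiplies such a character
  sum by \<open>a\<^sub>q - 2\<chi>(q)\<close>.  If all \<open>a\<^sub>q\<close> are even, sum over all quadratic characters modulo \<open>4m\<close>:
  the total is divisible by \<open>2\<^sup>r\<close> (up to the contribution of \<open>J(0)\<close>), the characters of
  smaller conductor contribute multiples of \<open>2\<^sup>r\<close> by induction, and so does the remaining one.
  If some \<open>a\<^sub>q\<close> is odd, reduction modulo 2 makes all characters of level \<open>4m\<close> and both parities
  agree, so \<open>A(\<chi>\<^sub>4\<^sub>m) \<equiv> A(\<chi>\<^sub>4) \<Prod>a\<^sub>q mod 2\<close>.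
\<close>

section \<open>Characters and character sums\<close>

text \<open>Two halvings have to balance. The values \<open>s/2\<close> and \<open>t/2\<close> are
  only half-integral, but for a character of the right parity the terms \<open>k\<close> and
  \<open>-k\<close> of \<open>A(\<chi>)\<close> agree, so \<open>A(\<chi>)\<close> is an integer,
  and congruences modulo 2 are read off on the half system \<open>k mod 4 = 1\<close>. In the sum
  over all \<open>2 ^ (r + 1)\<close> quadratic characters modulo \<open>4m\<close>,
  half-integrality takes back one factor 2. Of the two characters involving every prime of
  \<open>m\<close>, one has the wrong parity, so its sum vanishes and the other is isolated. The
  character \<open>\<chi>\<^sub>4\<close> is odd while \<open>\<chi>\<^sub>4\<^sub>m\<close> may be
  even, so comparing them sets values of \<open>t\<close> against values of \<open>s\<close>; this
  is the use of their congruence. A constant such as \<open>J(0)\<close> cancels in the sum of a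
  single primitive character, but not in the sum over all characters, which contains the principal
  one; this brings \<open>L(f,1)\<close> into (i). Since \<open>J(0)\<close> is real, it does not
  touch odd characters, and in (ii) \<open>\<chi>\<^sub>4\<^sub>m\<close> is odd. Oddness of
  \<open>N\<close> makes the denominators \<open>4d\<close> prime to \<open>N\<close>, so that the
  period lattice controls \<open>J(k/4d)\<close>.\<close>

lemma Legendre_cong:
  assumes "[x = y] (mod p)"
  shows "Legendre x p = Legendre y p"
proof -
  have "[x = 0] (mod p) \<longleftrightarrow> [y = 0] (mod p)"
    using assms cong_sym cong_trans by blast
  moreover have "QuadRes p x \<longleftrightarrow> QuadRes p y"
    unfolding QuadRes_def using assms cong_sym cong_trans by blast
  ultimately show ?thesis by (simp add: Legendre_def)
qed

lemma Legendre_range: "Legendre x p \<in> {-1, 0, 1}"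
  by (simp add: Legendre_def)

lemma Legendre_eq_0_iff: "Legendre x p = 0 \<longleftrightarrow> p dvd x"
  by (simp add: Legendre_def cong_0_iff)

text \<open>Euler's criterion gives the identity modulo \<open>p\<close>. Both sides lie in {-1, 0,
  1}, so they differ by at most 2, which is less than \<open>p\<close>.\<close>

lemma Legendre_mult:
  fixes p :: nat
  assumes "prime p" "odd p"
  shows "Legendre (x * y) p = Legendre x p * Legendre y p"
proof -
  have p2: "2 < p" using assms using prime_ge_2_nat[of p] by (cases "p = 2") auto
  have "[Legendre (x * y) p = (x * y) ^ ((p - 1) div 2)] (mod p)"
    by (rule euler_criterion[OF assms(1) p2])
  moreover have "[Legendre x p * Legendre y p = x ^ ((p - 1) div 2) * y ^ ((p - 1) div 2)] (mod p)"
    by (intro cong_mult euler_criterion[OF assms(1) p2])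
  ultimately have "[Legendre (x * y) p = Legendre x p * Legendre y p] (mod p)"
    by (metis cong_sym cong_trans power_mult_distrib)
  then have dvd: "int p dvd Legendre (x * y) p - Legendre x p * Legendre y p"
    by (simp add: cong_iff_dvd_diff)
  have "\<bar>Legendre (x * y) p - Legendre x p * Legendre y p\<bar> \<le> 2"
    using Legendre_range[of "x * y" p] Legendre_range[of x p] Legendre_range[of y p] by auto
  then show ?thesis
    using dvd p2 zdvd_imp_le[of "int p" "\<bar>Legendre (x * y) p - Legendre x p * Legendre y p\<bar>"] by auto
qed

lemma Legendre_1:
  fixes p :: nat
  assumes "prime p"
  shows "Legendre 1 p = 1"
proof -
  have "QuadRes p 1" unfolding QuadRes_def by (metis cong_refl power_one)
  moreover have "\<not> [1 = 0] (mod int p)"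
    using assms prime_gt_1_nat[of p] by (auto simp: cong_0_iff)
  ultimately show ?thesis by (simp add: Legendre_def)
qed

lemma chi4_mult: "chi4 (x * y) = chi4 x * chi4 y"
proof -
  have "x mod 4 \<in> {0,1,2,3}" "y mod 4 \<in> {0,1,2,3}" by auto
  then show ?thesis unfolding chi4_def mod_mult_eq[of x 4 y, symmetric] by auto
qed

lemma chi4_cong: "[x = y] (mod 4) \<Longrightarrow> chi4 x = chi4 y"
  by (simp add: chi4_def cong_def)

lemma chi4_range: "chi4 k \<in> {-1, 0, 1}"
  by (simp add: chi4_def)

lemma chi4_minus_1: "chi4 (-1) = -1"
  by (simp add: chi4_def)

lemma odd_chi4: "odd k \<longleftrightarrow> chi4 k \<noteq> 0"
  unfolding chi4_def by presburger

text \<open>The choice \<open>e = False\<close> is the principal character modulo 4, so that every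
  \<open>ind_char e P Q\<close> has level \<open>4 * \<Prod>Q\<close> whatever \<open>e\<close>
  is.\<close>

definition char4 :: "bool \<Rightarrow> int \<Rightarrow> int" where
  "char4 e k = (if e then chi4 k else if odd k then 1 else 0)"

definition principal_at :: "nat \<Rightarrow> int \<Rightarrow> int" where
  "principal_at p k = (if int p dvd k then 0 else 1)"

text \<open>The imprimitive character modulo \<open>4\<Prod>Q\<close> induced by \<open>\<chi>\<^sub>P\<close> or \<open>\<chi>\<^sub>4\<chi>\<^sub>P\<close>.\<close>

definition ind_char :: "bool \<Rightarrow> nat set \<Rightarrow> nat set \<Rightarrow> int \<Rightarrow> int" where
  "ind_char e P Q k = char4 e k * (\<Prod>p\<in>P. Legendre k (int p)) * (\<Prod>p\<in>Q - P. principal_at p k)"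

lemma char4_mult: "char4 e (x * y) = char4 e x * char4 e y"
  by (simp add: char4_def chi4_mult)

lemma char4_cong:
  assumes "[x = y] (mod 4)" shows "char4 e x = char4 e y"
proof -
  have "even x \<longleftrightarrow> even y"
    using assms unfolding cong_def by presburger
  then show ?thesis using assms chi4_cong by (simp add: char4_def)
qed

lemma principal_at_mult: "prime p \<Longrightarrow> principal_at p (x * y) = principal_at p x * principal_at p y"
  by (simp add: principal_at_def prime_dvd_mult_iff)

lemma principal_at_cong: "[x = y] (mod int p) \<Longrightarrow> principal_at p x = principal_at p y"
  by (simp add: principal_at_def cong_dvd_iff)

lemma ind_char_mult:
  assumes "\<And>p. p \<in> Q \<Longrightarrow> prime p \<and> odd p" "P \<subseteq> Q"
  shows "ind_char e P Q (x * y) = ind_char e P Q x * ind_char e P Q y"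
proof -
  have "(\<Prod>p\<in>P. Legendre (x * y) (int p)) = (\<Prod>p\<in>P. Legendre x (int p) * Legendre y (int p))"
    using assms by (intro prod.cong refl Legendre_mult) auto
  moreover have "(\<Prod>p\<in>Q-P. principal_at p (x * y)) = (\<Prod>p\<in>Q-P. principal_at p x * principal_at p y)"
    using assms by (intro prod.cong refl principal_at_mult) auto
  ultimately show ?thesis
    by (simp add: ind_char_def char4_mult prod.distrib)
qed

lemma ind_char_cong:
  assumes "[x = y] (mod int (4 * \<Prod>Q))" "finite Q" "P \<subseteq> Q"
  shows "ind_char e P Q x = ind_char e P Q y"
proof -
  have p: "[x = y] (mod int p)" if "p \<in> Q" for p
    by (rule cong_dvd_modulus[OF assms(1)])
      (use that assms(2) in \<open>auto intro!: dvd_mult simp: dvd_prod_eqI of_nat_dvd_iff simp del: of_nat_mult of_nat_prod\<close>)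
  have 4: "[x = y] (mod 4)"
    by (rule cong_dvd_modulus[OF assms(1)]) simp
  have "(\<Prod>p\<in>P. Legendre x (int p)) = (\<Prod>p\<in>P. Legendre y (int p))"
    using assms p by (intro prod.cong refl Legendre_cong) auto
  moreover have "(\<Prod>p\<in>Q-P. principal_at p x) = (\<Prod>p\<in>Q-P. principal_at p y)"
    using assms p by (intro prod.cong refl principal_at_cong) auto
  ultimately show ?thesis
    using char4_cong[OF 4] by (simp add: ind_char_def)
qed

lemma ind_char_insert:
  assumes "finite Q" "q \<notin> Q" "P \<subseteq> Q"
  shows "ind_char e P (insert q Q) k = (if int q dvd k then 0 else ind_char e P Q k)"
proof -
  have "insert q Q - P = insert q (Q - P)" using assms by auto
  then show ?thesis using assms by (simp add: ind_char_def principal_at_def)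
qed

text \<open>The zero set depends on \<open>Q\<close> alone, not on \<open>e\<close> or
  \<open>P\<close>. With values in {-1, 0, 1} this makes all characters of one level congruent
  modulo 2.\<close>

lemma ind_char_eq_0_iff:
  assumes "finite Q" "P \<subseteq> Q"
  shows "ind_char e P Q k = 0 \<longleftrightarrow> even k \<or> (\<exists>p\<in>Q. int p dvd k)"
proof -
  have "finite P" using assms finite_subset by blast
  moreover have "char4 e k = 0 \<longleftrightarrow> even k" using odd_chi4 by (auto simp: char4_def)
  ultimately show ?thesis using assms
    by (auto simp: ind_char_def Legendre_eq_0_iff principal_at_def)
qed

lemma prod_range:
  fixes h :: "'a \<Rightarrow> int"
  assumes "\<And>x. x \<in> A \<Longrightarrow> h x \<in> {-1, 0, 1}"
  shows "prod h A \<in> {-1, 0, 1}"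
  using assms
proof (induction A rule: infinite_finite_induct)
  case (insert x A)
  then have "h x \<in> {-1, 0, 1}" "prod h A \<in> {-1, 0, 1}" by auto
  then show ?case using insert(1,2) by auto
qed auto

lemma ind_char_range: "ind_char e P Q k \<in> {-1, 0, 1}"
proof -
  have "(\<Prod>p\<in>P. Legendre k (int p)) \<in> {-1,0,1}"
    by (rule prod_range) (rule Legendre_range)
  moreover have "(\<Prod>p\<in>Q-P. principal_at p k) \<in> {-1,0,1}"
    by (rule prod_range) (simp add: principal_at_def)
  moreover have "char4 e k \<in> {-1,0,1}" by (simp add: char4_def chi4_def)
  ultimately show ?thesis unfolding ind_char_def by auto
qed

lemma ind_char_minus_1:
  assumes "\<And>p. p \<in> Q \<Longrightarrow> prime p"
  shows "ind_char e P Q (-1) = (if e then -1 else 1) * (\<Prod>p\<in>P. Legendre (-1) (int p))"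
proof -
  have "(\<Prod>p\<in>Q-P. principal_at p (-1)) = 1"
    using assms by (intro prod.neutral) (fastforce simp: principal_at_def dest: prime_gt_1_nat)
  then show ?thesis by (simp add: ind_char_def char4_def chi4_minus_1)
qed

text \<open>The double sum is the expansion of a product of \<open>card Q + 1\<close> factors, each
  of the form character plus principal character and hence 0 or 2. So \<open>u = 1\<close> exactly
  if \<open>k\<close> is 1 modulo 4 and a nonzero square modulo every prime of
  \<open>Q\<close>.\<close>

lemma sum_ind_char:
  assumes "finite Q"
  shows "\<exists>u\<in>{0,1}. (\<Sum>e\<in>UNIV. \<Sum>P\<in>Pow Q. ind_char e P Q k) = 2 ^ (card Q + 1) * u"
proof -
  have "(\<Sum>e\<in>UNIV. \<Sum>P\<in>Pow Q. ind_char e P Q k) =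
     (char4 True k + char4 False k) * (\<Prod>p\<in>Q. Legendre k (int p) + principal_at p k)"
    unfolding prod_add[OF assms] ind_char_def distrib_right sum_distrib_left UNIV_bool
    by (simp add: char4_def mult.assoc sum.distrib)
  moreover have "\<exists>u\<in>{0,1}. (\<Prod>p\<in>Q. Legendre k (int p) + principal_at p k) = 2 ^ card Q * u"
    using assms
  proof (induction Q)
    case (insert q Q)
    then obtain u where "u \<in> {0,1}" "(\<Prod>p\<in>Q. Legendre k (int p) + principal_at p k) = 2 ^ card Q * u"
      by blast
    moreover have "Legendre k (int q) + principal_at q k \<in> {0,2}"
      using Legendre_range[of k q] Legendre_eq_0_iff[of k q] by (auto simp: principal_at_def)
    ultimately show ?case using insert by auto
  qed auto
  moreover have "char4 True k + char4 False k \<in> {0,2}"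
    using odd_chi4[of k] chi4_range[of k] by (auto simp: char4_def)
  ultimately show ?thesis by auto
qed

section \<open>Sums of a periodic function on the rationals against a character\<close>

definition char_sum :: "(int \<Rightarrow> int) \<Rightarrow> nat \<Rightarrow> (rat \<Rightarrow> rat) \<Rightarrow> rat" where
  "char_sum ch M g = (\<Sum>k\<in>{0..<int M}. of_int (ch k) * g (of_int k / of_nat M))"

text \<open>A map that is injective modulo \<open>M\<close> permutes the residues, and
  \<open>F\<close> sees only residues. Used for multiplication by a unit and for negation.\<close>

lemma sum_residues_cong:
  fixes F :: "int \<Rightarrow> 'a::comm_monoid_add"
  assumes "M > 0" and F: "\<And>x y. [x = y] (mod M) \<Longrightarrow> F x = F y"
    and "inj_on (\<lambda>k. h k mod M) {0..<M}"
  shows "(\<Sum>k\<in>{0..<M}. F (h k)) = (\<Sum>k\<in>{0..<M}. F k)"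
proof -
  have "(\<lambda>k. h k mod M) ` {0..<M} = {0..<M}"
    by (rule endo_inj_surj) (use assms in auto)
  then have "bij_betw (\<lambda>k. h k mod M) {0..<M} {0..<M}"
    using assms by (simp add: bij_betw_def)
  then have "(\<Sum>k\<in>{0..<M}. F (h k mod M)) = (\<Sum>k\<in>{0..<M}. F k)"
    by (rule sum.reindex_bij_betw)
  moreover have "F (h k mod M) = F (h k)" for k by (rule F) simp
  ultimately show ?thesis by simp
qed

lemma inj_on_mult_mod:
  fixes M q :: int
  assumes "coprime q M"
  shows "inj_on (\<lambda>k. (q * k) mod M) {0..<M}"
proof (rule inj_onI)
  fix x y assume xy: "x \<in> {0..<M}" "y \<in> {0..<M}" "(q * x) mod M = (q * y) mod M"
  then have "[x = y] (mod M)" using assms cong_mult_lcancel[of q M x y] by (simp add: cong_def)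
  then show "x = y" using xy by (simp add: cong_def)
qed

lemma inj_on_minus_mod: "inj_on (\<lambda>k. (- k) mod M) {0..<M::int}"
  using inj_on_mult_mod[of "-1" M] by simp

lemma periodic_int:
  fixes g :: "rat \<Rightarrow> 'a"
  assumes "\<And>x. g (x + 1) = g x"
  shows "g (x + of_int k) = g x"
proof (induction k rule: int_induct[where k = 0])
  case (step1 i) then show ?case using assms[of "x + of_int i"] by (simp add: add.assoc)
next
  case (step2 i) then show ?case using assms[of "x + of_int (i - 1)"] by (simp add: algebra_simps)
qed auto

lemma periodic_frac_cong:
  fixes g :: "rat \<Rightarrow> 'a"
  assumes "\<And>x. g (x + 1) = g x" "M > 0" "[x = y] (mod int M)"
  shows "g (of_int x / of_nat M) = g (of_int y / of_nat M)"
proof -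
  obtain k where "x = y + int M * k" using assms(3)
    by (metis cong_iff_lin cong_sym)
  then have "(of_int x / of_nat M :: rat) = of_int y / of_nat M + of_int k"
    using assms(2) by (simp add: field_simps)
  then show ?thesis using periodic_int[of g, OF assms(1)] by simp
qed

text \<open>The distribution relation behind the Euler factor: removing the terms divisible by \<open>q\<close>
  from the full sum modulo \<open>Mq\<close> costs a second \<open>\<chi>(q)\<close>.\<close>

lemma char_sum_extend_prime:
  fixes q M :: nat
  assumes "q > 0" "M > 0" "coprime q M"
    and mult: "\<And>x y. ch (x * y) = ch x * ch y"
    and per: "\<And>x y. [x = y] (mod int M) \<Longrightarrow> ch x = ch y"
    and sq: "ch (int q) * ch (int q) = 1"
    and g1: "\<And>x. g (x + 1) = g x"
    and hecke: "\<And>k. aq * g (of_int k / of_nat M) =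
       g (of_nat q * of_int k / of_nat M) + (\<Sum>b<q. g ((of_int k / of_nat M + of_nat b) / of_nat q))"
  shows "char_sum (\<lambda>k. if int q dvd k then 0 else ch k) (M * q) g =
     (aq - 2 * of_int (ch (int q))) * char_sum ch M g"
proof -
  define F where "F k = of_int (ch k) * g (of_int k / of_nat (M * q))" for k
  define S where "S = char_sum ch M g"
  \<comment> \<open>Every residue modulo \<open>M * q\<close> is \<open>j + M * b\<close> with
    unique \<open>j < M\<close> and \<open>b < q\<close>; the character sees only
    \<open>j\<close>.\<close>
  have full: "(\<Sum>k\<in>{0..<int (M*q)}. F k) = (\<Sum>j\<in>{0..<int M}. \<Sum>b<q. F (j + int M * int b))"
  proof -
    have "(\<Sum>j\<in>{0..<int M}. \<Sum>b<q. F (j + int M * int b)) =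
      (\<Sum>(j,b)\<in>{0..<int M} \<times> {..<q}. F (j + int M * int b))"
      by (simp add: sum.cartesian_product)
    also have "\<dots> = (\<Sum>k\<in>{0..<int (M*q)}. F k)"
    proof (rule sum.reindex_bij_witness[where i = "\<lambda>k. (k mod int M, nat (k div int M))"
          and j = "\<lambda>(j,b). j + int M * int b"], goal_cases)
      case (2 a)
      then show ?case
      proof clarsimp
        fix j b assume *: "0 \<le> j" "j < int M" "b < q"
        have "int M * (int b + 1) \<le> int M * int q" using * by (intro mult_left_mono) auto
        then show "j + int M * int b < int M * int q" using * by (simp add: algebra_simps)
      qed
    next
      case (4 k)
      have "k div int M < int q"
      proof (rule ccontr)
        assume "\<not> k div int M < int q"
        then have "int M * int q \<le> int M * (k div int M)" by (intro mult_left_mono) auto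
        moreover have "int M * (k div int M) \<le> k"
          using mult_div_mod_eq[of "int M" k] assms(2) by (metis add_increasing2 order_refl pos_mod_sign of_nat_0_less_iff)
        ultimately show False using 4 by simp
      qed
      then show ?case using assms(1,2) 4 by (auto simp: nat_less_iff pos_imp_zdiv_nonneg_iff)
    qed (use assms(2) in \<open>auto simp: pos_imp_zdiv_nonneg_iff\<close>)
    finally show ?thesis by simp
  qed
  \<comment> \<open>The fractions \<open>(j + M * b) / (M * q)\<close> are exactly the arguments of
    the \<open>q\<close> terms of the Hecke relation at \<open>j / M\<close>.\<close>
  have inner: "(\<Sum>b<q. F (j + int M * int b)) =
     of_int (ch j) * (aq * g (of_int j / of_nat M) - g (of_nat q * of_int j / of_nat M))" for j
  proof -
    have "F (j + int M * int b) = of_int (ch j) * g ((of_int j / of_nat M + of_nat b) / of_nat q)" for b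
    proof -
      have "ch (j + int M * int b) = ch j" by (rule per) (simp add: cong_def)
      moreover have "(of_int (j + int M * int b) / of_nat (M * q) :: rat) = (of_int j / of_nat M + of_nat b) / of_nat q"
        using assms(1,2) by (simp add: field_simps)
      ultimately show ?thesis by (simp add: F_def)
    qed
    then show ?thesis using hecke[of j] by (simp add: sum_distrib_left[symmetric])
  qed
  \<comment> \<open>Substituting \<open>q * j\<close> for \<open>j\<close> permutes the residues and
    brings out \<open>ch q\<close>, which is its own inverse by \<open>sq\<close>.\<close>
  have chq: "(\<Sum>j\<in>{0..<int M}. of_int (ch j) * g (of_nat q * of_int j / of_nat M)) = of_int (ch (int q)) * S"
  proof -
    define G where "G k = of_int (ch k) * g (of_int k / of_nat M)" for k
    have "(\<Sum>j\<in>{0..<int M}. G (int q * j)) = (\<Sum>j\<in>{0..<int M}. G j)"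
    proof (rule sum_residues_cong)
      show "G x = G y" if "[x = y] (mod int M)" for x y
        using per[OF that] periodic_frac_cong[of g, OF g1 assms(2) that] by (simp add: G_def)
      show "inj_on (\<lambda>k. int q * k mod int M) {0..<int M}"
        using assms(3) by (intro inj_on_mult_mod) simp
    qed (use assms(2) in auto)
    then have "S = (\<Sum>j\<in>{0..<int M}. G (int q * j))"
      unfolding S_def char_sum_def G_def by simp
    also have "\<dots> = of_int (ch (int q)) * (\<Sum>j\<in>{0..<int M}. of_int (ch j) * g (of_nat q * of_int j / of_nat M))"
      by (simp add: G_def mult sum_distrib_left mult.assoc)
    finally have "of_int (ch (int q)) * S = of_int (ch (int q) * ch (int q)) * (\<Sum>j\<in>{0..<int M}. of_int (ch j) * g (of_nat q * of_int j / of_nat M))"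
      by simp
    then show ?thesis unfolding sq by simp
  qed
  \<comment> \<open>For \<open>k = q * j\<close> the fraction reduces to \<open>j / M\<close>, so
    these terms repeat the sum at level \<open>M\<close> with a factor \<open>ch q\<close>.\<close>
  have dvd: "(\<Sum>k\<in>{k\<in>{0..<int (M*q)}. int q dvd k}. F k) = of_int (ch (int q)) * S"
  proof -
    have "(\<Sum>k\<in>{k\<in>{0..<int (M*q)}. int q dvd k}. F k) = (\<Sum>j\<in>{0..<int M}. F (int q * j))"
      by (rule sum.reindex_bij_witness[where i = "\<lambda>j. int q * j" and j = "\<lambda>k. k div int q"])
        (use assms(1) in \<open>auto simp: pos_imp_zdiv_nonneg_iff elim!: dvdE\<close>)
    also have "\<dots> = (\<Sum>j\<in>{0..<int M}. of_int (ch (int q)) * (of_int (ch j) * g (of_int j / of_nat M)))"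
      using assms(1) by (intro sum.cong refl) (simp add: F_def mult)
    finally show ?thesis by (simp add: S_def char_sum_def sum_distrib_left)
  qed
  have "char_sum (\<lambda>k. if int q dvd k then 0 else ch k) (M * q) g =
      (\<Sum>k\<in>{0..<int (M*q)}. F k - (if int q dvd k then F k else 0))"
    unfolding char_sum_def F_def by (intro sum.cong) auto
  also have "\<dots> = (\<Sum>k\<in>{0..<int (M*q)}. F k) - (\<Sum>k\<in>{k\<in>{0..<int (M*q)}. int q dvd k}. F k)"
    by (simp add: sum_subtractf flip: sum.inter_filter)
  also have "\<dots> = (aq * S - of_int (ch (int q)) * S) - of_int (ch (int q)) * S"
    unfolding full inner dvd
    by (simp add: right_diff_distrib sum_subtractf chq S_def char_sum_def sum_distrib_left mult.left_commute)
  finally show ?thesis by (simp add: S_def algebra_simps)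
qed

text \<open>A 2-adic valuation of the algebraic numbers restricted to the rationals, where every
  argument is algebraic and the laws hold unconditionally.\<close>

locale rat_valuation =
  fixes w :: "rat \<Rightarrow> ereal"
  assumes w0: "w 0 = \<infinity>" and w2: "w 2 = 1"
    and w_fin: "x \<noteq> 0 \<Longrightarrow> \<bar>w x\<bar> \<noteq> \<infinity>"
    and w_mult: "w (x * y) = w x + w y"
    and w_add: "w (x + y) \<ge> min (w x) (w y)"
begin

lemma w_1: "w 1 = 0"
proof -
  have "w 1 = w 1 + w 1" using w_mult[of 1 1] by simp
  then show ?thesis using w_fin[of 1] by (cases "w 1") (auto simp: zero_ereal_def)
qed

lemma w_minus_1: "w (-1) = 0"
proof -
  have "w (-1) + w (-1) = 0" using w_mult[of "-1" "-1"] w_1 by simp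
  then show ?thesis using w_fin[of "-1"] by (cases "w (-1)") (auto simp: zero_ereal_def)
qed

lemma w_minus: "w (- x) = w x"
  using w_mult[of "-1" x] w_minus_1 by simp

lemma w_add_ge: "t \<le> w x \<Longrightarrow> t \<le> w y \<Longrightarrow> t \<le> w (x + y)"
  using w_add[of x y] by (metis min.bounded_iff order_trans)

lemma w_diff_ge: "t \<le> w x \<Longrightarrow> t \<le> w y \<Longrightarrow> t \<le> w (x - y)"
  using w_add_ge[of t x "- y"] w_minus[of y] by simp

lemma w_mult_ge: "s \<le> w x \<Longrightarrow> t \<le> w y \<Longrightarrow> s + t \<le> w (x * y)"
  unfolding w_mult by (rule add_mono)

lemma w_sum_ge: "(\<And>x. x \<in> A \<Longrightarrow> t \<le> w (h x)) \<Longrightarrow> t \<le> w (sum h A)"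
  by (induction A rule: infinite_finite_induct) (auto simp: w0 intro: w_add_ge)

lemma w_of_nat: "w (of_nat n) \<ge> 0"
  by (induction n) (auto simp: w0 w_1 intro: w_add_ge)

lemma w_of_int: "w (of_int n) \<ge> 0"
  by (cases n rule: int_cases2) (simp_all add: w_of_nat w_minus)

lemma w_even: "even n \<Longrightarrow> w (of_int n) \<ge> 1"
  using w_of_int add_increasing2[of "w _" 1 1] by (auto elim!: evenE simp: w_mult w2)

text \<open>If \<open>x + y\<close> had positive valuation, so would
  \<open>x = (x + y) - y\<close>.\<close>

lemma w_unit_add:
  assumes "w x = 0" "w y \<ge> 1"
  shows "w (x + y) = 0"
proof (rule antisym)
  show "0 \<le> w (x + y)"
    using assms by (intro w_add_ge) (auto intro: order_trans[of _ 1])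
  show "w (x + y) \<le> 0"
  proof (rule ccontr)
    assume "\<not> w (x + y) \<le> 0"
    moreover have "0 < w y" using assms(2) by (rule less_le_trans[rotated]) simp
    ultimately have "min (w (x + y)) (w (- y)) > 0" by (simp add: w_minus not_le)
    also have "\<dots> \<le> w x" using w_add[of "x + y" "- y"] by simp
    finally show False using assms(1) by simp
  qed
qed

lemma w_odd: 
  assumes "odd n" shows "w (of_int n) = 0"
proof -
  obtain k where "n = 1 + 2 * k" using assms by (metis oddE add.commute)
  then show ?thesis using w_unit_add[of 1 "of_int (2 * k)"] w_even[of "2 * k"] w_1 by simp
qed

lemma w_power2: "w (2 ^ n) = ereal (real n)"
  by (induction n) (auto simp: w_1 w_mult w2 zero_ereal_def one_ereal_def)

lemma w_prod_ge: "finite A \<Longrightarrow> (\<And>x. x \<in> A \<Longrightarrow> 1 \<le> w (h x)) \<Longrightarrow> ereal (real (card A)) \<le> w (prod h A)"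
proof (induction A rule: finite_induct)
  case (insert x A)
  then have "1 + ereal (real (card A)) \<le> w (h x * prod h A)" by (intro w_mult_ge) auto
  then show ?case using insert by (simp add: one_ereal_def add.commute)
qed (simp add: w_1 zero_ereal_def)

lemma w_prod_nonneg: "finite A \<Longrightarrow> (\<And>x. x \<in> A \<Longrightarrow> 0 \<le> w (h x)) \<Longrightarrow> 0 \<le> w (prod h A)"
  by (induction A rule: finite_induct) (auto simp: w_1 w_mult)

lemma w_prod_0: "finite A \<Longrightarrow> (\<And>x. x \<in> A \<Longrightarrow> w (h x) = 0) \<Longrightarrow> w (prod h A) = 0"
  by (induction A rule: finite_induct) (auto simp: w_1 w_mult)

end

lemma sum_residues_minus:
  fixes F :: "int \<Rightarrow> 'a::comm_monoid_add"
  assumes "M > 0" "\<And>x y. [x = y] (mod M) \<Longrightarrow> F x = F y"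
  shows "(\<Sum>k\<in>{0..<M}. F (- k)) = (\<Sum>k\<in>{0..<M}. F k)"
  using sum_residues_cong[of M F uminus] assms inj_on_minus_mod by blast

text \<open>Substituting \<open>-k\<close> for \<open>k\<close> permutes the residues and multiplies
  each term by \<open>ch (-1) * e = -1\<close>, so the sum is its own negative.\<close>

lemma char_sum_wrong_parity:
  assumes "M > 0" and mult: "\<And>x y. ch (x * y) = ch x * ch y"
    and per: "\<And>x y. [x = y] (mod int M) \<Longrightarrow> ch x = ch y"
    and g1: "\<And>x. g (x + 1) = g x" and ge: "\<And>x. g (- x) = of_int e * g x"
    and "ch (-1) * e = -1"
  shows "char_sum ch M g = 0"
proof -
  define F where "F k = of_int (ch k) * g (of_int k / of_nat M)" for k
  have "(\<Sum>k\<in>{0..<int M}. F (- k)) = (\<Sum>k\<in>{0..<int M}. F k)"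
  proof (rule sum_residues_minus)
    show "F x = F y" if "[x = y] (mod int M)" for x y
      using per[OF that] periodic_frac_cong[of g, OF g1 assms(1) that] by (simp add: F_def)
  qed (use assms(1) in simp)
  moreover have "F (- k) = - F k" for k
  proof -
    have "F (- k) = of_int (ch (-1) * e) * F k"
      using mult[of "-1" k] ge[of "of_int k / of_nat M"] by (simp add: F_def)
    then show ?thesis using assms(6) by simp
  qed
  ultimately have "char_sum ch M g = - char_sum ch M g"
    by (simp add: char_sum_def F_def sum_negf)
  then show ?thesis by simp
qed

text \<open>Rational-valued functions with the formal properties of the real and imaginary parts of
  \<open>r \<mapsto> \<integral>\<^sub>r\<^sup>i\<^sup>\<infinity> f(z) dz\<close>, divided by the respective period.\<close>

locale hecke_function = rat_valuation w for w :: "rat \<Rightarrow> ereal" +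
  fixes N :: nat and a :: "nat \<Rightarrow> rat" and e :: int and g :: "rat \<Rightarrow> rat"
  assumes N_odd: "odd N" and e_sign: "e \<in> {-1, 1}"
    and g1: "g (x + 1) = g x"
    and ge: "g (- x) = of_int e * g x"
    and hecke: "prime q \<Longrightarrow> \<not> q dvd N \<Longrightarrow> M > 0 \<Longrightarrow> coprime M N \<Longrightarrow>
       a q * g (of_int k / of_nat M) =
       g (of_nat q * of_int k / of_nat M) + (\<Sum>b<q. g ((of_int k / of_nat M + of_nat b) / of_nat q))"
begin

definition good_primes :: "nat set" where
  "good_primes = {q. prime q \<and> odd q \<and> \<not> q dvd N}"

text \<open>Oddness of \<open>N\<close> enters through the factor 4: the Hecke relation is available
  only at fractions with denominator prime to \<open>N\<close>.\<close>

lemma coprime_level: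
  assumes "finite Q" "Q \<subseteq> good_primes"
  shows "coprime (4 * \<Prod>Q) N" "4 * \<Prod>Q > 0"
proof -
  have "coprime (\<Prod>Q) N"
    using assms by (intro prod_coprime_left) (auto simp: good_primes_def prime_imp_coprime)
  moreover have "coprime (2 ^ 2) N"
    using N_odd by (simp only: coprime_power_left_iff) simp
  ultimately show "coprime (4 * \<Prod>Q) N" by simp
  show "4 * \<Prod>Q > 0" using assms by (auto simp: good_primes_def prod_pos prime_gt_0_nat subset_iff)
qed

text \<open>The primes of \<open>R\<close> are added one at a time, each contributing the Euler
  factor of \<open>char_sum_extend_prime\<close>. Of the character values \<open>s q\<close> only
  the fact that they are signs matters later.\<close>

lemma ind_char_sum_extend:
  assumes "finite P" "P \<subseteq> good_primes" "finite R" "R \<subseteq> good_primes" "P \<inter> R = {}"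
  shows "\<exists>s::nat \<Rightarrow> int. (\<forall>q\<in>R. s q \<in> {-1, 1}) \<and>
    char_sum (ind_char e' P (P \<union> R)) (4 * \<Prod>(P \<union> R)) g =
    (\<Prod>q\<in>R. a q - 2 * of_int (s q)) * char_sum (ind_char e' P P) (4 * \<Prod>P) g"
  using assms(3,4,5)
proof (induction R rule: finite_induct)
  case (insert q R)
  define Q where "Q = P \<union> R"
  have fin: "finite Q" and Q: "Q \<subseteq> good_primes" "P \<subseteq> Q" and q: "q \<notin> Q" "prime q" "odd q" "\<not> q dvd N"
    using insert assms by (auto simp: Q_def good_primes_def)
  from insert obtain s where s: "\<forall>q\<in>R. s q \<in> {-1, 1}"
    "char_sum (ind_char e' P Q) (4 * \<Prod>Q) g =
     (\<Prod>q\<in>R. a q - 2 * of_int (s q)) * char_sum (ind_char e' P P) (4 * \<Prod>P) g"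
    by (auto simp: Q_def)
  have pr: "\<And>p. p \<in> Q \<Longrightarrow> prime p \<and> odd p" using Q by (auto simp: good_primes_def)
  have "coprime q (\<Prod>Q)"
    using q pr by (intro prod_coprime_right) (metis primes_coprime)
  then have cop: "coprime q (4 * \<Prod>Q)"
    using q(3) coprime_power_right_iff[of q 2 2] by simp
  define t where "t = ind_char e' P Q (int q)"
  have "t \<noteq> 0"
    unfolding t_def ind_char_eq_0_iff[OF fin Q(2)] using q pr
    by (auto simp: dest: primes_dvd_imp_eq)
  then have t: "t \<in> {-1, 1}" using ind_char_range[of e' P Q "int q"] by (auto simp: t_def)
  have "char_sum (\<lambda>k. if int q dvd k then 0 else ind_char e' P Q k) ((4 * \<Prod>Q) * q) g =
     (a q - 2 * of_int t) * char_sum (ind_char e' P Q) (4 * \<Prod>Q) g"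
    unfolding t_def
  proof (rule char_sum_extend_prime)
    show "ind_char e' P Q (x * y) = ind_char e' P Q x * ind_char e' P Q y" for x y
      using ind_char_mult[OF pr Q(2)] by blast
    show "ind_char e' P Q x = ind_char e' P Q y" if "[x = y] (mod int (4 * \<Prod>Q))" for x y
      by (rule ind_char_cong[OF that fin Q(2)])
    show "ind_char e' P Q (int q) * ind_char e' P Q (int q) = 1" using t by (auto simp: t_def)
    show "a q * g (of_int k / of_nat (4 * \<Prod>Q)) = g (of_nat q * of_int k / of_nat (4 * \<Prod>Q)) +
        (\<Sum>b<q. g ((of_int k / of_nat (4 * \<Prod>Q) + of_nat b) / of_nat q))" for k
      using hecke[OF q(2,4) coprime_level(2,1)[OF fin Q(1)]] .
  qed (use cop coprime_level[OF fin Q(1)] prime_gt_0_nat[OF q(2)] g1 in auto)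
  moreover have "P \<union> insert q R = insert q Q" by (auto simp: Q_def)
  moreover have "ind_char e' P (insert q Q) = (\<lambda>k. if int q dvd k then 0 else ind_char e' P Q k)"
    using ind_char_insert[OF fin q(1) Q(2)] by auto
  moreover have "(4 * \<Prod>Q) * q = 4 * \<Prod>(insert q Q)" using fin q(1) by (simp add: algebra_simps)
  ultimately have "char_sum (ind_char e' P (P \<union> insert q R)) (4 * \<Prod>(P \<union> insert q R)) g =
     (a q - 2 * of_int t) * ((\<Prod>q\<in>R. a q - 2 * of_int (s q)) * char_sum (ind_char e' P P) (4 * \<Prod>P) g)"
    using s(2) by simp
  moreover have "(\<Prod>p\<in>R. a p - 2 * of_int ((s(q := t)) p)) = (\<Prod>p\<in>R. a p - 2 * of_int (s p))"
    using insert(2) by (intro prod.cong) auto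
  ultimately have "char_sum (ind_char e' P (P \<union> insert q R)) (4 * \<Prod>(P \<union> insert q R)) g =
     (\<Prod>p\<in>insert q R. a p - 2 * of_int ((s(q := t)) p)) * char_sum (ind_char e' P P) (4 * \<Prod>P) g"
    using insert(1,2) by (simp del: fun_upd_apply) simp
  moreover have "\<forall>p\<in>insert q R. (s(q := t)) p \<in> {-1, 1}" using s(1) t by auto
  ultimately show ?case by blast
qed auto

lemma ind_char_sum_wrong_parity:
  assumes "finite Q" "Q \<subseteq> good_primes" "P \<subseteq> Q" "ind_char e' P Q (-1) * e = -1"
  shows "char_sum (ind_char e' P Q) (4 * \<Prod>Q) g = 0"
proof (rule char_sum_wrong_parity[where e = e])
  have pr: "\<And>p. p \<in> Q \<Longrightarrow> prime p \<and> odd p" using assms by (auto simp: good_primes_def)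
  show "ind_char e' P Q (x * y) = ind_char e' P Q x * ind_char e' P Q y" for x y
    using ind_char_mult[OF pr assms(3)] by blast
  show "ind_char e' P Q x = ind_char e' P Q y" if "[x = y] (mod int (4 * \<Prod>Q))" for x y
    by (rule ind_char_cong[OF that assms(1,3)])
qed (fact coprime_level(2)[OF assms(1,2)] g1 ge assms(4))+

text \<open>The sum over all quadratic characters modulo \<open>4\<Prod>Q\<close> picks out one coset of the squares,
  which gives the power of 2; one of the two characters with \<open>P = Q\<close> has the wrong parity.\<close>

lemma w_char_sum_ge:
  assumes half: "\<And>k M. M > 0 \<Longrightarrow> coprime M N \<Longrightarrow> \<exists>z::int. g (of_int k / of_nat M) = c + of_int z / 2"
    and "finite Q" "Q \<subseteq> good_primes" "\<And>q. q \<in> Q \<Longrightarrow> w (a q - 2) \<ge> 1"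
  shows "w (char_sum (ind_char e' Q Q) (4 * \<Prod>Q) g) \<ge> ereal (real (card Q)) + min 0 (w c)"
  using assms(2-)
proof (induction Q arbitrary: e' rule: finite_psubset_induct)
  case (psubset Q)
  define M where "M = 4 * \<Prod>Q"
  define T where "T e' P = char_sum (ind_char e' P Q) M g" for e' P
  define t where "t = ereal (real (card Q)) + min 0 (w c)"
  have M: "M > 0" "coprime M N" using coprime_level psubset by (auto simp: M_def)
  \<comment> \<open>A character with proper \<open>P\<close> is induced from level
    \<open>4 * \<Prod>P\<close>. The induction hypothesis gives \<open>card P\<close> factors of 2,
    and the Euler factors at \<open>Q - P\<close>, all even because \<open>a q\<close> is, give the
    remaining ones.\<close>
  have proper: "w (T e' P) \<ge> t" if "P \<in> Pow Q - {Q}" for e' P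
  proof -
    have P: "P \<subset> Q" "P \<subseteq> good_primes" using that psubset(3) by auto
    then have "finite P" using psubset(1) finite_subset by blast
    note P = P(1) this P(2)
    have R: "P \<union> (Q - P) = Q" "finite (Q - P)" "Q - P \<subseteq> good_primes" "P \<inter> (Q - P) = {}"
      using P psubset(1,3) by auto
    obtain s where s: "\<forall>q\<in>Q-P. s q \<in> {-1, 1::int}"
      "T e' P = (\<Prod>q\<in>Q-P. a q - 2 * of_int (s q)) * char_sum (ind_char e' P P) (4 * \<Prod>P) g"
      using ind_char_sum_extend[OF P(2,3) R(2,3,4), of e', unfolded R(1)] unfolding T_def M_def by blast
    have "1 \<le> w (a q - 2 * of_int (s q))" if "q \<in> Q - P" for q
    proof -
      have "a q - 2 * of_int (s q) = (a q - 2) + of_int (2 * (1 - s q))" by simp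
      moreover have "1 \<le> w (a q - 2)" "1 \<le> w (of_int (2 * (1 - s q)))"
        using psubset(4)[of q] that w_even[of "2 * (1 - s q)"] by simp_all
      ultimately show ?thesis by (metis w_add_ge)
    qed
    then have "ereal (real (card (Q - P))) \<le> w (\<Prod>q\<in>Q-P. a q - 2 * of_int (s q))"
      using psubset(1) by (intro w_prod_ge) auto
    moreover have "ereal (real (card P)) + min 0 (w c) \<le> w (char_sum (ind_char e' P P) (4 * \<Prod>P) g)"
      using P psubset by (intro psubset(2)) auto
    ultimately have "ereal (real (card (Q - P))) + (ereal (real (card P)) + min 0 (w c)) \<le> w (T e' P)"
      unfolding s(2) by (rule w_mult_ge)
    moreover have "real (card (Q - P)) + real (card P) = real (card Q)"
      using card_Diff_subset[of P Q] card_mono[of Q P] P psubset(1) by auto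
    ultimately show ?thesis unfolding t_def by (simp flip: add.assoc)
  qed
  have total: "w (\<Sum>e'\<in>UNIV. \<Sum>P\<in>Pow Q. T e' P) \<ge> t"
  proof -
    have "(\<Sum>e'\<in>UNIV. \<Sum>P\<in>Pow Q. T e' P) =
      (\<Sum>k\<in>{0..<int M}. of_int (\<Sum>e'\<in>UNIV. \<Sum>P\<in>Pow Q. ind_char e' P Q k) * g (of_int k / of_nat M))"
      unfolding T_def char_sum_def UNIV_bool
      by (simp add: sum.swap[of _ "{0..<int M}"] sum_distrib_right distrib_right sum.distrib)
    moreover have "w (of_int (\<Sum>e'\<in>UNIV. \<Sum>P\<in>Pow Q. ind_char e' P Q k) * g (of_int k / of_nat M)) \<ge> t" for k
    proof -
      obtain u :: int where u: "(\<Sum>e'\<in>UNIV. \<Sum>P\<in>Pow Q. ind_char e' P Q k) = 2 ^ (card Q + 1) * u"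
        using sum_ind_char[OF psubset(1)] by blast
      obtain z where z: "g (of_int k / of_nat M) = c + of_int z / 2" using half[OF M] by blast
      \<comment> \<open>One of the \<open>card Q + 1\<close> factors of 2 clears the denominator of
        \<open>c + z / 2\<close>.\<close>
      have "of_int (\<Sum>e'\<in>UNIV. \<Sum>P\<in>Pow Q. ind_char e' P Q k) * g (of_int k / of_nat M) =
         2 ^ card Q * (of_int u * (2 * c + of_int z))"
        unfolding u z by (simp add: field_simps)
      moreover have "0 \<le> w 2" using w2 by simp
      then have "min 0 (w c) \<le> w (2 * c)"
        unfolding w_mult using add_increasing[of "w 2" "w c" "w c"] by (auto simp: min.coboundedI2)
      then have 1: "min 0 (w c) \<le> w (2 * c + of_int z)"
        by (rule w_add_ge) (rule min.coboundedI1[OF w_of_int])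
      have 2: "0 + min 0 (w c) \<le> w (of_int u * (2 * c + of_int z))"
        by (rule w_mult_ge[OF w_of_int 1])
      have "ereal (real (card Q)) + (0 + min 0 (w c)) \<le> w (2 ^ card Q * (of_int u * (2 * c + of_int z)))"
        by (rule w_mult_ge[OF _ 2]) (simp add: w_power2)
      ultimately show ?thesis by (simp add: t_def)
    qed
    ultimately show ?thesis by (simp add: w_sum_ge)
  qed
  have "(\<Sum>e'\<in>UNIV. \<Sum>P\<in>Pow Q. T e' P) = (T True Q + T False Q) + (\<Sum>e'\<in>UNIV. \<Sum>P\<in>Pow Q - {Q}. T e' P)"
    using psubset(1) by (simp add: UNIV_bool sum.remove[of "Pow Q" Q])
  then have "T True Q + T False Q = (\<Sum>e'\<in>UNIV. \<Sum>P\<in>Pow Q. T e' P) - (\<Sum>e'\<in>UNIV. \<Sum>P\<in>Pow Q - {Q}. T e' P)"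
    by simp
  moreover have "w (\<Sum>e'\<in>UNIV. \<Sum>P\<in>Pow Q - {Q}. T e' P) \<ge> t"
    using proper by (intro w_sum_ge) blast
  ultimately have sum: "w (T True Q + T False Q) \<ge> t"
    using total by (simp add: w_diff_ge)
  have pr: "\<And>p. p \<in> Q \<Longrightarrow> prime p" using psubset by (auto simp: good_primes_def)
  have "(\<Prod>p\<in>Q. Legendre (-1) (int p)) \<in> {-1, 0, 1}" by (intro prod_range Legendre_range)
  moreover have "(\<Prod>p\<in>Q. Legendre (-1) (int p)) \<noteq> 0"
    using psubset(1) pr by (fastforce simp: Legendre_eq_0_iff dest: prime_gt_1_nat)
  ultimately have "ind_char True Q Q (-1) * e = -1 \<or> ind_char False Q Q (-1) * e = -1"
    using e_sign pr by (auto simp: ind_char_minus_1)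
  then have "T True Q = 0 \<or> T False Q = 0"
    using ind_char_sum_wrong_parity psubset by (auto simp: T_def M_def)
  \<comment> \<open>For the vanishing sum the bound holds because \<open>w 0 = \<infinity>\<close>;
    the other sum is the whole of \<open>T True Q + T False Q\<close>.\<close>
  then have "w (T e' Q) \<ge> t"
    using sum by (cases e') (auto simp: w0)
  then show ?case by (simp add: T_def M_def t_def)
qed

end

text \<open>As 4 divides \<open>M\<close>, the reflection \<open>k \<mapsto> M - k\<close> exchanges
  the classes 1 and 3 modulo 4, and the even \<open>k\<close> contribute nothing.\<close>

lemma sum_half_system:
  fixes F :: "int \<Rightarrow> 'a::comm_ring_1"
  assumes "M > 0" "4 dvd M" "\<And>k. even k \<Longrightarrow> F k = 0" "\<And>k. F (M - k) = F k"
  shows "(\<Sum>k\<in>{0..<M}. F k) = 2 * (\<Sum>k\<in>{k\<in>{0..<M}. k mod 4 = 1}. F k)"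
proof -
  let ?S = "\<lambda>r. {k\<in>{0..<M}. k mod 4 = r}"
  have 3: "(\<Sum>k\<in>?S 3. F k) = (\<Sum>k\<in>?S 1. F k)"
  proof (rule sum.reindex_bij_witness[where i = "\<lambda>k. M - k" and j = "\<lambda>k. M - k"])
    fix k
    have "M mod 4 = 0" using assms(2) by simp
    then have 1: "(M - k) mod 4 = 1" if "k mod 4 = 3" using that by presburger
    have 3: "(M - k) mod 4 = 3" if "k mod 4 = 1" using \<open>M mod 4 = 0\<close> that by presburger
    show "M - k \<in> ?S 1" if "k \<in> ?S 3"
      using that 1 by (cases "k = 0") simp_all
    show "M - k \<in> ?S 3" if "k \<in> ?S 1"
      using that 3 by (cases "k = 0") simp_all
  qed (simp_all add: assms(4))
  have "(\<Sum>k\<in>{0..<M}. F k) = (\<Sum>k\<in>?S 1 \<union> ?S 3. F k)"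
  proof (rule sum.mono_neutral_right)
    show "\<forall>k\<in>{0..<M} - (?S 1 \<union> ?S 3). F k = 0"
    proof
      fix k assume "k \<in> {0..<M} - (?S 1 \<union> ?S 3)"
      then have "k mod 4 \<noteq> 1" "k mod 4 \<noteq> 3" by auto
      then have "even k" by presburger
      then show "F k = 0" by (rule assms(3))
    qed
  qed auto
  also have "\<dots> = (\<Sum>k\<in>?S 1. F k) + (\<Sum>k\<in>?S 3. F k)"
    by (rule sum.union_disjoint[OF finite_Collect_conjI finite_Collect_conjI]) auto
  finally show ?thesis unfolding 3 by simp
qed

text \<open>Pairing \<open>k\<close> with \<open>-k\<close> yields a factor 2 that cancels the
  denominator of the half-integral values, so the sum is an integer.\<close>

lemma char_sum_half:
  fixes z :: "rat \<Rightarrow> int"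
  assumes Q: "finite Q" "\<And>p. p \<in> Q \<Longrightarrow> prime p \<and> odd p" "P \<subseteq> Q"
    and z1: "\<And>x. z (x + 1) = z x" and ze: "\<And>x. z (- x) = e * z x"
    and par: "ind_char e' P Q (-1) * e = 1"
  shows "char_sum (ind_char e' P Q) (4 * \<Prod>Q) (\<lambda>x. of_int (z x) / 2) =
     of_int (\<Sum>k\<in>{k\<in>{0..<int (4 * \<Prod>Q)}. k mod 4 = 1}.
        ind_char e' P Q k * z (of_int k / of_nat (4 * \<Prod>Q)))"
proof -
  define M where "M = 4 * \<Prod>Q"
  define F where "F k = ind_char e' P Q k * z (of_int k / of_nat M)" for k
  have M: "M > 0" using Q by (auto simp: M_def prod_pos prime_gt_0_nat)
  have "(\<Sum>k\<in>{0..<int M}. F k) = 2 * (\<Sum>k\<in>{k\<in>{0..<int M}. k mod 4 = 1}. F k)"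
  proof (rule sum_half_system)
    show "F k = 0" if "even k" for k
      using that ind_char_eq_0_iff[OF Q(1,3)] by (simp add: F_def)
    show "F (int M - k) = F k" for k
    proof -
      have c: "[int M - k = - k] (mod int M)" by (simp add: cong_iff_dvd_diff)
      have "F (int M - k) = ind_char e' P Q (- k) * z (- (of_int k / of_nat M))"
        using ind_char_cong[OF c[unfolded M_def] Q(1,3)] periodic_frac_cong[of z, OF z1 M c]
        by (simp add: F_def M_def)
      also have "\<dots> = (ind_char e' P Q (-1) * e) * F k"
        using ind_char_mult[OF Q(2,3), of e' "-1" k] ze by (simp add: F_def)
      finally show ?thesis using par by simp
    qed
  qed (use M in \<open>simp_all add: M_def del: of_nat_prod\<close>)
  moreover have "char_sum (ind_char e' P Q) M (\<lambda>x. of_int (z x) / 2) = of_int (\<Sum>k\<in>{0..<int M}. F k) / 2"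
    by (simp add: char_sum_def F_def sum_divide_distrib)
  ultimately show ?thesis by (simp add: M_def F_def)
qed

text \<open>On the half system the two integer sums agree term by term modulo 2: both characters
  vanish at the same \<open>k\<close> and are odd elsewhere. The halving comes first, since
  otherwise only a congruence modulo 1 would remain. The two characters may have opposite parities,
  each matched by its own function.\<close>

lemma char_sum_parity:
  fixes z1 z2 :: "rat \<Rightarrow> int"
  assumes Q: "finite Q" "\<And>p. p \<in> Q \<Longrightarrow> prime p \<and> odd p" "P1 \<subseteq> Q" "P2 \<subseteq> Q"
    and z1: "\<And>x. z1 (x + 1) = z1 x" "\<And>x. z1 (- x) = e1 * z1 x" "ind_char e' P1 Q (-1) * e1 = 1"
    and z2: "\<And>x. z2 (x + 1) = z2 x" "\<And>x. z2 (- x) = e2 * z2 x" "ind_char e'' P2 Q (-1) * e2 = 1"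
    and cong: "\<And>k. even (z1 (of_int k / of_nat (4 * \<Prod>Q)) - z2 (of_int k / of_nat (4 * \<Prod>Q)))"
  shows "\<exists>n. char_sum (ind_char e' P1 Q) (4 * \<Prod>Q) (\<lambda>x. of_int (z1 x) / 2) =
     char_sum (ind_char e'' P2 Q) (4 * \<Prod>Q) (\<lambda>x. of_int (z2 x) / 2) + of_int (2 * n)"
proof -
  let ?M = "4 * \<Prod>Q"
  let ?S = "{k\<in>{0..<int ?M}. k mod 4 = 1}"
  define A where "A = (\<Sum>k\<in>?S. ind_char e' P1 Q k * z1 (of_int k / of_nat ?M))"
  define B where "B = (\<Sum>k\<in>?S. ind_char e'' P2 Q k * z2 (of_int k / of_nat ?M))"
  have "even (ind_char e' P1 Q k * z1 (of_int k / of_nat ?M) - ind_char e'' P2 Q k * z2 (of_int k / of_nat ?M))" for k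
  proof -
    have "ind_char e' P1 Q k = 0 \<longleftrightarrow> ind_char e'' P2 Q k = 0"
      using ind_char_eq_0_iff Q by metis
    then have "even (ind_char e' P1 Q k) \<longleftrightarrow> even (ind_char e'' P2 Q k)"
      using ind_char_range[of e' P1 Q k] ind_char_range[of e'' P2 Q k] by auto
    then show ?thesis using cong[of k] by auto
  qed
  then have "even (A - B)" unfolding A_def B_def sum_subtractf[symmetric] by (intro dvd_sum) blast
  then obtain n where "A = B + 2 * n" by (metis dvd_def diff_eq_eq add.commute)
  moreover have "char_sum (ind_char e' P1 Q) ?M (\<lambda>x. of_int (z1 x) / 2) = of_int A"
    unfolding A_def by (rule char_sum_half[OF Q(1,2,3) z1])
  moreover have "char_sum (ind_char e'' P2 Q) ?M (\<lambda>x. of_int (z2 x) / 2) = of_int B"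
    unfolding B_def by (rule char_sum_half[OF Q(1,2,4) z2])
  ultimately show ?thesis by auto
qed

section \<open>The modular group and forms of weight 2\<close>

abbreviation "uhp \<equiv> upper_half_plane"

lemma uhp_iff: "z \<in> uhp \<longleftrightarrow> Im z > 0"
  by (simp add: upper_half_plane_def)

lemma open_uhp: "open uhp"
  unfolding upper_half_plane_def by (rule open_halfspace_Im_gt)

lemma convex_uhp: "convex uhp"
  unfolding upper_half_plane_def by (rule convex_halfspace_Im_gt)

text \<open>The infix notation of \<^const>\<open>vec_nth\<close> is ambiguous with that of \<^const>\<open>fps_nth\<close>.\<close>

abbreviation ent :: "int ^ 2 ^ 2 \<Rightarrow> 2 \<Rightarrow> 2 \<Rightarrow> int" where
  "ent A i j \<equiv> vec_nth (vec_nth A i) j"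

definition mat2 :: "int \<Rightarrow> int \<Rightarrow> int \<Rightarrow> int \<Rightarrow> int ^ 2 ^ 2" where
  "mat2 a b c d = vector [vector [a, b], vector [c, d]]"

lemma mat2_nth [simp]:
  "ent (mat2 a b c d) 1 1 = a" "ent (mat2 a b c d) 1 2 = b"
  "ent (mat2 a b c d) 2 1 = c" "ent (mat2 a b c d) 2 2 = d"
  by (simp_all add: mat2_def)

lemma det_2x2: "det (A :: int ^ 2 ^ 2) = ent A 1 1 * ent A 2 2 - ent A 1 2 * ent A 2 1"
  by (simp add: det_2)

lemma mat2_mult_nth:
  fixes A B :: "int ^ 2 ^ 2"
  shows "ent (A ** B) i j = ent A i 1 * ent B 1 j + ent A i 2 * ent B 2 j"
  by (simp add: matrix_matrix_mult_def sum_2)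

lemma SL2Z_det: "A \<in> SL2Z \<Longrightarrow> ent A 1 1 * ent A 2 2 - ent A 1 2 * ent A 2 1 = 1"
  by (simp add: SL2Z_def det_2x2)

lemma SL2Z_mult: "A \<in> SL2Z \<Longrightarrow> B \<in> SL2Z \<Longrightarrow> A ** B \<in> SL2Z"
  by (simp add: SL2Z_def det_mul)

definition mat2_inv :: "int ^ 2 ^ 2 \<Rightarrow> int ^ 2 ^ 2" where
  "mat2_inv A = mat2 (ent A 2 2) (- ent A 1 2) (- ent A 2 1) (ent A 1 1)"

lemma mat2_inv_SL2Z: "A \<in> SL2Z \<Longrightarrow> mat2_inv A \<in> SL2Z"
  by (simp add: SL2Z_def det_2x2 mat2_inv_def algebra_simps)

lemma mat2_eqI:
  fixes A B :: "int ^ 2 ^ 2"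
  assumes "ent A 1 1 = ent B 1 1" "ent A 1 2 = ent B 1 2" "ent A 2 1 = ent B 2 1" "ent A 2 2 = ent B 2 2"
  shows "A = B"
  using assms by (simp add: vec_eq_iff forall_2)

lemma mat2_inv_left: "A \<in> SL2Z \<Longrightarrow> mat2_inv A ** A = mat 1"
  by (rule mat2_eqI; use SL2Z_det[of A] in \<open>simp add: mat2_mult_nth mat2_inv_def mat_def algebra_simps\<close>)

definition autfactor :: "int ^ 2 ^ 2 \<Rightarrow> complex \<Rightarrow> complex" where
  "autfactor A z = of_int (ent A 2 1) * z + of_int (ent A 2 2)"

lemma slash2_autfactor: "slash2 f A z = f (moebius_act A z) / autfactor A z ^ 2"
  by (simp add: slash2_def autfactor_def)

lemma autfactor_nonzero:
  assumes "A \<in> SL2Z" "z \<in> uhp" shows "autfactor A z \<noteq> 0"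
proof
  assume "autfactor A z = 0"
  then have "Im (autfactor A z) = 0" "Re (autfactor A z) = 0" by auto
  then have "of_int (ent A 2 1) * Im z = 0" "of_int (ent A 2 1) * Re z + of_int (ent A 2 2) = 0"
    by (auto simp: autfactor_def)
  then have "ent A 2 1 = 0" "ent A 2 2 = 0" using assms by (auto simp: uhp_iff)
  then show False using SL2Z_det[OF assms(1)] by simp
qed

lemma Im_moebius:
  assumes "A \<in> SL2Z" "z \<in> uhp"
  shows "Im (moebius_act A z) = Im z / norm (autfactor A z) ^ 2"
proof -
  have d: "real_of_int (ent A 1 1) * of_int (ent A 2 2) - of_int (ent A 1 2) * of_int (ent A 2 1) = 1"
    using SL2Z_det[OF assms(1)] by (metis of_int_1 of_int_diff of_int_mult)
  define p q r s x y where
    "p = real_of_int (ent A 1 1)" "q = real_of_int (ent A 1 2)" "r = real_of_int (ent A 2 1)"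
    "s = real_of_int (ent A 2 2)" "x = Re z" "y = Im z"
  note defs = this
  have "Im (moebius_act A z) = (p * y * (r * x + s) - (p * x + q) * (r * y)) / ((r * x + s)^2 + (r * y)^2)"
    by (simp add: moebius_act_def Im_divide defs)
  also have "p * y * (r * x + s) - (p * x + q) * (r * y) = (p * s - q * r) * y"
    by (simp add: algebra_simps)
  also have "p * s - q * r = 1" using d by (simp add: defs)
  also have "(r * x + s)^2 + (r * y)^2 = norm (autfactor A z) ^ 2"
    by (simp add: autfactor_def cmod_power2 defs)
  finally show ?thesis by (simp add: defs)
qed

lemma moebius_uhp: "A \<in> SL2Z \<Longrightarrow> z \<in> uhp \<Longrightarrow> moebius_act A z \<in> uhp"
  using Im_moebius[of A z] autfactor_nonzero[of A z] by (simp add: uhp_iff)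

lemma autfactor_mult:
  assumes "B \<in> SL2Z" "z \<in> uhp"
  shows "autfactor (A ** B) z = autfactor A (moebius_act B z) * autfactor B z"
  using autfactor_nonzero[OF assms]
  by (simp add: autfactor_def moebius_act_def mat2_mult_nth field_simps)

lemma moebius_mult:
  assumes "A \<in> SL2Z" "B \<in> SL2Z" "z \<in> uhp"
  shows "moebius_act (A ** B) z = moebius_act A (moebius_act B z)"
proof -
  have nz: "autfactor B z \<noteq> 0" using autfactor_nonzero assms by blast
  define u where "u = of_int (ent B 1 1) * z + of_int (ent B 1 2)"
  define j where "j = autfactor B z"
  define J where "J = autfactor A (moebius_act B z)"
  have u: "moebius_act B z = u / j" by (simp add: moebius_act_def u_def j_def autfactor_def)
  have "moebius_act (A ** B) z =
     (of_int (ent A 1 1) * u + of_int (ent A 1 2) * j) / autfactor (A ** B) z"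
    by (simp add: moebius_act_def autfactor_def u_def j_def mat2_mult_nth algebra_simps)
  also have "\<dots> = (of_int (ent A 1 1) * u + of_int (ent A 1 2) * j) / (J * j)"
    by (simp add: autfactor_mult[OF assms(2,3)] J_def j_def)
  also have "\<dots> = (of_int (ent A 1 1) * (u / j) + of_int (ent A 1 2)) / J"
    using nz by (simp add: j_def[symmetric] add_divide_distrib)
  also have "\<dots> = moebius_act A (moebius_act B z)"
    unfolding u[symmetric] by (simp add: J_def autfactor_def moebius_act_def[of A])
  finally show ?thesis .
qed

lemma moebius_id: "moebius_act (mat 1) z = z"
  by (simp add: moebius_act_def mat_def)

lemma slash2_mult:
  assumes "A \<in> SL2Z" "B \<in> SL2Z" "z \<in> uhp"
  shows "slash2 f (A ** B) z = slash2 (slash2 f A) B z"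
  using assms by (simp add: slash2_autfactor autfactor_mult moebius_mult power_mult_distrib)

lemma moebius_has_field_derivative:
  assumes "A \<in> SL2Z" "z \<in> uhp"
  shows "(moebius_act A has_field_derivative 1 / autfactor A z ^ 2) (at z)"
proof -
  have nz: "of_int (ent A 2 1) * z + of_int (ent A 2 2) \<noteq> 0"
    using autfactor_nonzero[OF assms] by (simp add: autfactor_def)
  have d: "of_int (ent A 1 1) * of_int (ent A 2 2) - of_int (ent A 1 2) * of_int (ent A 2 1) = (1 :: complex)"
    using SL2Z_det[OF assms(1)] by (metis of_int_1 of_int_diff of_int_mult)
  have "((\<lambda>z. (of_int (ent A 1 1) * z + of_int (ent A 1 2)) / (of_int (ent A 2 1) * z + of_int (ent A 2 2)))
     has_field_derivative (of_int (ent A 1 1) * (of_int (ent A 2 1) * z + of_int (ent A 2 2)) -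
       (of_int (ent A 1 1) * z + of_int (ent A 1 2)) * of_int (ent A 2 1)) /
       ((of_int (ent A 2 1) * z + of_int (ent A 2 2)) * (of_int (ent A 2 1) * z + of_int (ent A 2 2)))) (at z)"
    using nz by (auto intro!: derivative_eq_intros)
  moreover have "of_int (ent A 1 1) * (of_int (ent A 2 1) * z + of_int (ent A 2 2)) -
       (of_int (ent A 1 1) * z + of_int (ent A 1 2)) * of_int (ent A 2 1) = (1 :: complex)"
    using d by (simp add: algebra_simps)
  ultimately show ?thesis
    by (simp add: moebius_act_def[abs_def] autfactor_def power2_eq_square)
qed

lemma at_i_infinity_D:
  assumes "(g \<longlongrightarrow> 0) at_i_infinity" "e > 0"
  shows "\<exists>Y. \<forall>z. Im z \<ge> Y \<longrightarrow> norm (g z) < e"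
proof -
  have "\<forall>\<^sub>F z in filtercomap Im at_top. norm (g z) < e"
    using assms tendstoD[of g 0 at_i_infinity e] by (simp add: at_i_infinity_def)
  then show ?thesis
    by (auto simp: eventually_filtercomap_at_top_linorder)
qed

text \<open>A periodic function on the half plane factors through \<open>t = exp(2\<pi>iz/h)\<close>; the resulting
  function on the punctured disc has a removable singularity with value 0.\<close>

lemma periodic_decay:
  fixes h \<rho> :: real
  assumes hol: "g holomorphic_on uhp" and h: "h > 0"
    and per: "\<And>z. z \<in> uhp \<Longrightarrow> g (z + of_real h) = g z"
    and lim: "(g \<longlongrightarrow> 0) at_i_infinity" and \<rho>: "\<rho> > 0"
  shows "\<exists>C\<ge>0. \<forall>z. Im z \<ge> \<rho> \<longrightarrow> norm (g z) \<le> C * exp (- (2 * pi / h) * Im z)"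
proof -
  \<comment> \<open>\<open>k * Ln t\<close> inverts \<open>t = exp (2 * pi * \<i> * z / h)\<close>
    up to a multiple of the period \<open>h\<close>.\<close>
  define k where "k = of_real h / (2 * of_real pi * \<i>)"
  have k: "k \<noteq> 0" using h by (simp add: k_def)
  define G where "G t = (if t = 0 then 0 else g (k * Ln t))" for t
  have Imk: "Im (k * w) = - h / (2 * pi) * Re w" for w
    by (simp add: k_def Im_divide field_simps power2_eq_square)
  have per_int: "g (z + of_real h * of_int n) = g z" if "z \<in> uhp" for z n
    using that
  proof (induction n rule: int_induct[where k = 0])
    case (step1 i)
    have "z + of_real h * of_int i \<in> uhp" using that by (simp add: uhp_iff)
    from per[OF this] show ?case using step1 by (simp add: algebra_simps)
  next
    case (step2 i)
    have "z + of_real h * of_int (i - 1) \<in> uhp" using that by (simp add: uhp_iff)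
    from per[OF this] show ?case using step2 by (simp add: algebra_simps)
  qed auto
  have in_uhp: "k * w \<in> uhp" if "norm (exp w) < 1" for w
  proof -
    have "Re w < 0" using that by simp
    then have "0 < h / (2 * pi) * (- Re w)" using h by (intro mult_pos_pos) auto
    then show ?thesis unfolding uhp_iff Imk by simp
  qed
  have G_exp: "G (exp w) = g (k * w)" if "norm (exp w) < 1" for w
  proof -
    have "exp (Ln (exp w)) = exp w" by (rule exp_Ln) simp
    then obtain n :: int where n: "Ln (exp w) = w + of_int (2 * n) * of_real pi * \<i>"
      using exp_eq[of "Ln (exp w)" w] by auto
    have "k * Ln (exp w) = k * w + of_real h * of_int n"
      unfolding n by (simp add: k_def algebra_simps)
    then show ?thesis using per_int[OF in_uhp[OF that], of n] by (simp add: G_def)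
  qed
  have Ghol: "G holomorphic_on ball 0 1 - {0}"
  proof -
    have "G field_differentiable at t0" if "t0 \<in> ball 0 1 - {0}" for t0
    proof -
      \<comment> \<open>A branch of the logarithm that is holomorphic near \<open>t0\<close> even on
        the cut of \<open>Ln\<close>; by periodicity of \<open>g\<close>, the function
        \<open>G\<close> does not depend on the branch.\<close>
      define L where "L t = Ln (t / t0) + Ln t0" for t
      have t0: "t0 \<noteq> 0" "norm t0 < 1" using that by auto
      define U where "U = (ball 0 1 - {0}) \<inter> ball t0 (norm t0)"
      have U: "open U" "t0 \<in> U" using t0 by (auto simp: U_def)
      have expL: "exp (L t) = t" if "t \<in> U" for t
        using that t0 by (simp add: L_def exp_add U_def)
      have "g field_differentiable at (k * L t0)"
      proof -
        have "k * L t0 \<in> uhp" using in_uhp[of "L t0"] expL[OF U(2)] t0 by simp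
        then show ?thesis using hol open_uhp holomorphic_on_imp_differentiable_at by blast
      qed
      moreover have "(\<lambda>t. k * L t) field_differentiable at t0"
        unfolding L_def using t0
        by (intro field_differentiable_mult field_differentiable_const field_differentiable_add
            field_differentiable_compose[where g = Ln and f = "\<lambda>t. t / t0", unfolded o_def]
            field_differentiable_divide field_differentiable_ident field_differentiable_at_Ln) auto
      ultimately have "(g \<circ> (\<lambda>t. k * L t)) field_differentiable at t0"
        by (intro field_differentiable_compose)
      then obtain D where "((g \<circ> (\<lambda>t. k * L t)) has_field_derivative D) (at t0)"
        by (auto simp: field_differentiable_def)
      then have "(G has_field_derivative D) (at t0)"
      proof (rule has_field_derivative_transform_within_open[OF _ U])
        show "(g \<circ> (\<lambda>t. k * L t)) t = G t" if "t \<in> U" for t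
          using G_exp[of "L t"] expL[OF that] that by (simp add: U_def)
      qed
      then show ?thesis by (auto simp: field_differentiable_def)
    qed
    then show ?thesis
      by (simp add: holomorphic_on_def field_differentiable_at_within)
  qed
  have Glim: "(G \<longlongrightarrow> G 0) (at 0 within ball 0 1)"
  proof (rule tendstoI)
    fix e :: real assume "e > 0"
    then obtain Y where Y: "\<And>z. Im z \<ge> Y \<Longrightarrow> norm (g z) < e"
      using at_i_infinity_D[OF lim] by blast
    have "dist (G t) (G 0) < e" if "t \<noteq> 0" "norm t < exp (- 2 * pi * Y / h)" for t
    proof -
      have "ln (norm t) < - 2 * pi * Y / h" using that by (metis exp_less_cancel_iff exp_ln zero_less_norm_iff)
      moreover have "Im (k * Ln t) = - h / (2 * pi) * ln (norm t)"
        using that unfolding Imk by simp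
      ultimately have "Im (k * Ln t) \<ge> Y" using h by (simp only:) (simp add: field_simps)
      then show ?thesis using Y that by (simp add: G_def)
    qed
    then show "\<forall>\<^sub>F t in at 0 within ball 0 1. dist (G t) (G 0) < e"
      unfolding eventually_at by (intro exI[of _ "exp (- 2 * pi * Y / h)"]) auto
  qed
  have Gh: "G holomorphic_on ball 0 1"
    by (rule no_isolated_singularity'[OF _ Ghol]) (use Glim in auto)
  \<comment> \<open>The half plane \<open>Im z \<ge> \<rho>\<close> corresponds to the closed disc
    of radius \<open>R < 1\<close>, where the derivative of \<open>G\<close> is bounded; with
    \<open>G 0 = 0\<close> this gives a bound linear in the norm of \<open>t\<close>.\<close>
  define R where "R = exp (- (2 * pi / h) * \<rho>)"
  have R: "0 < R" "R < 1" using h \<rho> by (auto simp: R_def)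
  have cb: "cball 0 R \<subseteq> ball (0::complex) 1" using R by auto
  have "deriv G holomorphic_on ball 0 1" using Gh by (intro holomorphic_deriv) auto
  then have "continuous_on (cball 0 R) (deriv G)"
    using cb holomorphic_on_imp_continuous_on continuous_on_subset by blast
  then have "bounded (deriv G ` cball 0 R)" by (intro compact_imp_bounded compact_continuous_image) auto
  then obtain C where C: "C > 0" "\<And>t. t \<in> cball 0 R \<Longrightarrow> norm (deriv G t) \<le> C"
    by (auto simp: bounded_pos)
  have Gb: "norm (G t) \<le> C * norm t" if "t \<in> cball 0 R" for t
  proof -
    have "norm (G t - G 0) \<le> C * norm (t - 0)"
    proof (rule field_differentiable_bound[where S = "cball 0 R" and f' = "deriv G"])
      show "(G has_field_derivative deriv G z) (at z within cball 0 R)" if "z \<in> cball 0 R" for z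
        using that cb Gh holomorphic_derivI[of G "ball 0 1" z] has_field_derivative_at_within by blast
    qed (use that R C in auto)
    then show ?thesis by (simp add: G_def)
  qed
  show ?thesis
  proof (intro exI[of _ C] conjI allI impI)
    fix z assume z: "\<rho> \<le> Im z"
    have n: "norm (exp (z / k)) = exp (- (2 * pi / h) * Im z)"
      using h by (simp add: k_def Re_divide field_simps power2_eq_square)
    also have "\<dots> \<le> R" unfolding R_def using z h by (simp add: divide_right_mono)
    finally have "norm (exp (z / k)) \<le> R" .
    then have "norm (G (exp (z / k))) \<le> C * norm (exp (z / k))" by (intro Gb) auto
    moreover have "G (exp (z / k)) = g z" using G_exp[of "z / k", OF le_less_trans[OF \<open>norm (exp (z / k)) \<le> R\<close> R(2)]] k by simp
    ultimately show "norm (g z) \<le> C * exp (- (2 * pi / h) * Im z)" using n by simp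
  qed (use C in auto)
qed

lemma Gamma0_mat2_inv:
  assumes "A \<in> SL2Z" "B \<in> SL2Z"
    and "[ent A 2 1 * ent B 2 2 = ent A 2 2 * ent B 2 1] (mod int N)"
  shows "A ** mat2_inv B \<in> Gamma0 N"
proof -
  have "ent (A ** mat2_inv B) 2 1 = ent A 2 1 * ent B 2 2 - ent A 2 2 * ent B 2 1"
    by (simp add: mat2_mult_nth mat2_inv_def)
  then show ?thesis
    using assms SL2Z_mult[OF assms(1) mat2_inv_SL2Z[OF assms(2)]]
    by (simp add: Gamma0_def cong_iff_dvd_diff)
qed

lemma Gamma0_SL2Z: "A \<in> Gamma0 N \<Longrightarrow> A \<in> SL2Z"
  by (simp add: Gamma0_def)

lemma mat2_SL2Z: "a * d - b * c = 1 \<Longrightarrow> mat2 a b c d \<in> SL2Z"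
  by (simp add: SL2Z_def det_2x2)

lemma complete_SL2Z_row:
  assumes "coprime (c::int) d"
  shows "\<exists>A \<in> SL2Z. ent A 2 1 = c \<and> ent A 2 2 = d"
proof -
  obtain u v where "u * c + v * d = gcd c d" using bezout_int by blast
  then have "mat2 v (- u) c d \<in> SL2Z" using assms by (intro mat2_SL2Z) simp
  then show ?thesis by (intro bexI[of _ "mat2 v (- u) c d"]) simp_all
qed

lemma mat2_inv_inv: "mat2_inv (mat2_inv A) = A"
  by (rule mat2_eqI) (simp_all add: mat2_inv_def)

lemma slash2_mat2_inv:
  assumes "A \<in> SL2Z" "z \<in> uhp"
  shows "slash2 f (mat2_inv A) (moebius_act A z) = f z * autfactor A z ^ 2"
proof -
  have "autfactor (mat2_inv A ** A) z = 1"
    using mat2_inv_left[OF assms(1)] by (simp add: autfactor_def mat_def)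
  then have 1: "autfactor (mat2_inv A) (moebius_act A z) * autfactor A z = 1"
    using autfactor_mult[OF assms] by simp
  have "moebius_act (mat2_inv A) (moebius_act A z) = z"
    using assms by (simp add: moebius_mult[symmetric] mat2_inv_SL2Z mat2_inv_left moebius_id)
  moreover have "autfactor A z = 1 / autfactor (mat2_inv A) (moebius_act A z)"
    using 1 by (metis mult_zero_left nonzero_eq_divide_eq zero_neq_one mult.commute)
  ultimately show ?thesis by (simp add: slash2_autfactor power_divide)
qed

lemma exp_minus_le_power:
  fixes x :: real assumes "x > 0" shows "exp (- x) \<le> fact n / x ^ n"
proof -
  have "x ^ n / fact n \<le> exp x"
    using sum_le_suminf[OF sums_summable[OF exp_converges[of x]], of "{n}"] sums_unique[OF exp_converges[of x]] assms
    by (simp add: divide_inverse mult.commute)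
  then show ?thesis using assms by (simp add: exp_minus field_simps)
qed

section \<open>Behaviour of the newform at the cusps\<close>

locale newform =
  fixes N :: nat and f :: "complex \<Rightarrow> complex" and a :: "nat \<Rightarrow> rat"
  assumes newform: "rational_newform N f a"
begin

lemma N_pos: "N > 0"
  using newform by (simp add: rational_newform_def)

lemma cusp_form: "cusp_form2 N f"
  using newform by (simp add: rational_newform_def new_subspace_def)

lemma hol: "f holomorphic_on uhp"
  using cusp_form by (simp add: cusp_form2_def)

lemma slash2_Gamma0: "A \<in> Gamma0 N \<Longrightarrow> z \<in> uhp \<Longrightarrow> slash2 f A z = f z"
  using cusp_form by (simp add: cusp_form2_def)

lemma slash2_lim: "A \<in> SL2Z \<Longrightarrow> (slash2 f A \<longlongrightarrow> 0) at_i_infinity"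
  using cusp_form by (simp add: cusp_form2_def)

lemma a_0: "a 0 = 0" and a_1: "a 1 = 1"
  using newform by (simp_all add: rational_newform_def)

lemma q_expansion: "z \<in> uhp \<Longrightarrow> (\<lambda>n. of_rat (a n) * q_param z ^ n) sums f z"
  using newform by (simp add: rational_newform_def)

lemma slash2_holomorphic:
  assumes "A \<in> SL2Z" shows "slash2 f A holomorphic_on uhp"
proof -
  have m: "moebius_act A holomorphic_on uhp"
    using moebius_has_field_derivative[OF assms] open_uhp
    by (auto simp: holomorphic_on_open)
  have "(f \<circ> moebius_act A) holomorphic_on uhp"
    by (rule holomorphic_on_compose_gen[OF m hol]) (use moebius_uhp[OF assms] in auto)
  then have "(\<lambda>z. f (moebius_act A z) / autfactor A z ^ 2) holomorphic_on uhp"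
    using autfactor_nonzero[OF assms] unfolding o_def autfactor_def
    by (intro holomorphic_intros) auto
  then show ?thesis by (simp add: slash2_autfactor[abs_def])
qed

text \<open>The congruence says that \<open>A\<close> times the inverse of \<open>B\<close> lies in
  \<open>Gamma0 N\<close>, so both matrices belong to the same coset and \<open>f\<close> cannot
  tell them apart.\<close>

lemma slash2_eq:
  assumes "A \<in> SL2Z" "B \<in> SL2Z" "z \<in> uhp"
    and "[ent A 2 1 * ent B 2 2 = ent A 2 2 * ent B 2 1] (mod int N)"
  shows "slash2 f A z = slash2 f B z"
proof -
  define C where "C = A ** mat2_inv B"
  have C: "C \<in> Gamma0 N" unfolding C_def by (rule Gamma0_mat2_inv[OF assms(1,2,4)])
  have "C ** B = A"
    unfolding C_def by (simp add: matrix_mul_assoc[symmetric] mat2_inv_left[OF assms(2)] matrix_mul_rid)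
  then have "slash2 f A z = slash2 (slash2 f C) B z"
    using slash2_mult[OF Gamma0_SL2Z[OF C] assms(2,3), of f] by simp
  also have "\<dots> = slash2 f B z"
    using slash2_Gamma0[OF C moebius_uhp[OF assms(2,3)]] by (simp add: slash2_autfactor)
  finally show ?thesis .
qed

text \<open>Translation by \<open>N\<close> changes the bottom row (c, d) into (c, cN + d), which is
  the same modulo \<open>N\<close>. The period \<open>N\<close> serves all cusps at once, although
  the width of a cusp may be smaller.\<close>

lemma slash2_periodic:
  assumes "A \<in> SL2Z" "z \<in> uhp"
  shows "slash2 f A (z + of_nat N) = slash2 f A z"
proof -
  define T where "T = mat2 1 (int N) 0 1"
  have T: "T \<in> SL2Z" unfolding T_def by (rule mat2_SL2Z) simp
  have "slash2 f (A ** T) z = slash2 (slash2 f A) T z" by (rule slash2_mult[OF assms(1) T assms(2)])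
  also have "\<dots> = slash2 f A (z + of_nat N)"
    unfolding slash2_autfactor[of "slash2 f A" T] by (simp add: autfactor_def moebius_act_def T_def)
  finally have "slash2 f A (z + of_nat N) = slash2 f (A ** T) z" ..
  also have "\<dots> = slash2 f A z"
    by (rule slash2_eq[OF SL2Z_mult[OF assms(1) T] assms])
      (simp add: mat2_mult_nth T_def cong_iff_dvd_diff algebra_simps)
  finally show ?thesis .
qed

lemma slash2_decay:
  assumes "A \<in> SL2Z" "\<rho> > 0"
  shows "\<exists>C\<ge>0. \<forall>z. Im z \<ge> \<rho> \<longrightarrow> norm (slash2 f A z) \<le> C * exp (- (2 * pi / N) * Im z)"
  using periodic_decay[OF slash2_holomorphic[OF assms(1)], of "real N" \<rho>]
    slash2_periodic[OF assms(1)] slash2_lim[OF assms(1)] N_pos assms(2) by simp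

lemma slash2_mat_1: "slash2 f (mat 1) = f"
  unfolding slash2_autfactor[abs_def] moebius_id by (simp add: autfactor_def mat_def)

lemma mat_1_SL2Z: "mat 1 \<in> SL2Z"
  by (simp add: SL2Z_def)

text \<open>The bottom row modulo \<open>N\<close> determines \<open>slash2 f A\<close>, so only
  finitely many functions occur; the sum of their bounds serves for all.\<close>

lemma slash2_uniform_bound:
  assumes "\<rho> > 0"
  shows "\<exists>C\<ge>0. \<forall>A\<in>SL2Z. \<forall>z. Im z \<ge> \<rho> \<longrightarrow> norm (slash2 f A z) \<le> C"
proof -
  have "\<exists>C\<ge>0. \<forall>z. Im z \<ge> \<rho> \<longrightarrow> norm (slash2 f A z) \<le> C" if A: "A \<in> SL2Z" for A
  proof -
    obtain C where C: "C \<ge> 0" "\<And>z. Im z \<ge> \<rho> \<Longrightarrow> norm (slash2 f A z) \<le> C * exp (- (2 * pi / N) * Im z)"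
      using slash2_decay[OF A assms] by blast
    have "norm (slash2 f A z) \<le> C" if "Im z \<ge> \<rho>" for z
    proof -
      have "- (2 * pi / N) * Im z \<le> 0" using that assms by simp
      then have "exp (- (2 * pi / N) * Im z) \<le> 1" by (simp only: exp_le_one_iff)
      then show ?thesis using C(2)[OF that] mult_left_mono[OF _ C(1), of "exp (- (2 * pi / N) * Im z)" 1] by simp
    qed
    then show ?thesis using C(1) by blast
  qed
  then obtain C where C: "\<And>A. A \<in> SL2Z \<Longrightarrow> C A \<ge> 0"
    "\<And>A z. A \<in> SL2Z \<Longrightarrow> Im z \<ge> \<rho> \<Longrightarrow> norm (slash2 f A z) \<le> C A" by metis
  define key where "key A = (ent A 2 1 mod int N, ent A 2 2 mod int N)" for A
  define rep where "rep \<kappa> = (SOME A. A \<in> SL2Z \<and> key A = \<kappa>)" for \<kappa>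
  have rep: "rep (key A) \<in> SL2Z" "key (rep (key A)) = key A" if "A \<in> SL2Z" for A
    using someI_ex[of "\<lambda>B. B \<in> SL2Z \<and> key B = key A"] that unfolding rep_def by auto
  have "key ` SL2Z \<subseteq> {0..<int N} \<times> {0..<int N}" using N_pos by (auto simp: key_def)
  then have fin: "finite (key ` SL2Z)" by (rule finite_subset) auto
  show ?thesis
  proof (intro exI[of _ "\<Sum>\<kappa>\<in>key ` SL2Z. C (rep \<kappa>)"] conjI ballI allI impI)
    show "0 \<le> (\<Sum>\<kappa>\<in>key ` SL2Z. C (rep \<kappa>))" using C rep by (intro sum_nonneg) auto
    fix A z assume A: "A \<in> SL2Z" and z: "\<rho> \<le> Im z"
    let ?B = "rep (key A)"
    have "[ent A 2 1 = ent ?B 2 1] (mod int N)" "[ent ?B 2 2 = ent A 2 2] (mod int N)"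
      using rep[OF A] by (simp_all add: key_def cong_def)
    then have "[ent A 2 1 * ent ?B 2 2 = ent ?B 2 1 * ent A 2 2] (mod int N)" by (rule cong_mult)
    then have "slash2 f A z = slash2 f ?B z"
      using A rep[OF A] z assms by (intro slash2_eq) (auto simp: uhp_iff mult.commute)
    also have "norm \<dots> \<le> C ?B" by (rule C(2)) (use rep[OF A] z in auto)
    also have "\<dots> \<le> (\<Sum>\<kappa>\<in>key ` SL2Z. C (rep \<kappa>))"
      by (rule member_le_sum[of "key A" _ "\<lambda>\<kappa>. C (rep \<kappa>)"]) (use A fin C rep in auto)
    finally show "norm (slash2 f A z) \<le> (\<Sum>\<kappa>\<in>key ` SL2Z. C (rep \<kappa>))" .
  qed
qed

text \<open>Dirichlet approximation of \<open>Re z\<close> supplies the bottom row of a matrix that moves \<open>z\<close>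
  up to bounded height.\<close>

lemma growth_bound: "\<exists>C\<ge>0. \<forall>z. 0 < Im z \<and> Im z \<le> 1 \<longrightarrow> norm (f z) \<le> C / Im z ^ 2"
proof -
  obtain C where C: "C \<ge> 0" "\<And>A z. A \<in> SL2Z \<Longrightarrow> Im z \<ge> 1/5 \<Longrightarrow> norm (slash2 f A z) \<le> C"
    using slash2_uniform_bound[of "1/5"] by auto
  have "norm (f z) \<le> C / Im z ^ 2" if z: "0 < Im z" "Im z \<le> 1" for z
  proof -
    define y where "y = Im z"
    \<comment> \<open>This size of \<open>Q\<close> balances the two parts of the automorphy factor:
      the real part is at most \<open>1 / Q \<le> sqrt y\<close> and the imaginary part at most
      \<open>Q * y \<le> 2 * sqrt y\<close>. Its square norm is then at most \<open>5 * y\<close>,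
      which lifts \<open>z\<close> to height at least 1/5.\<close>
    define Q where "Q = nat \<lceil>1 / sqrt y\<rceil>"
    have y: "0 < y" "y \<le> 1" using z by (auto simp: y_def)
    have "1 \<le> 1 / sqrt y" using y by simp
    then have Q1: "1 / sqrt y \<le> Q" "Q \<le> 2 / sqrt y" "Q > 0" unfolding Q_def by (linarith | simp)+
    obtain h k where hk: "coprime h k" "0 < k" "k \<le> int Q" "\<bar>of_int k * Re z - of_int h\<bar> < 1 / Q"
      using Dirichlet_approx_coprime[OF Q1(3)] by blast
    obtain A where A: "A \<in> SL2Z" "ent A 2 1 = k" "ent A 2 2 = - h"
      using complete_SL2Z_row[of k "- h"] hk(1) by (auto simp: coprime_commute)
    have zu: "z \<in> uhp" using z by (simp add: uhp_iff)
    have k1: "real_of_int k \<ge> 1" "real_of_int k \<le> Q" using hk by linarith+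
    have n: "norm (autfactor A z) ^ 2 = (of_int k * Re z - of_int h)^2 + (of_int k * y)^2"
      by (simp add: autfactor_def A cmod_power2 y_def)
    have "(of_int k * Re z - of_int h)^2 \<le> (1 / Q)^2"
      using hk(4) by (metis abs_ge_zero less_eq_real_def power2_abs power_mono)
    also have "\<dots> \<le> (sqrt y)^2"
      using Q1 y by (intro power_mono) (auto simp: field_simps)
    finally have 1: "(of_int k * Re z - of_int h)^2 \<le> y" using y by simp
    have "(of_int k * y)^2 \<le> (2 / sqrt y * y)^2"
      using k1 Q1 y by (intro power_mono mult_right_mono) auto
    also have "\<dots> = 4 * y" using y by (simp add: power_mult_distrib power_divide power2_eq_square)
    finally have up: "norm (autfactor A z) ^ 2 \<le> 5 * y" using 1 n by simp
    \<comment> \<open>Since \<open>k \<ge> 1\<close>, the automorphy factor is not too small either;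
      this is the source of the exponent 2 in the bound.\<close>
    have low: "norm (autfactor A z) ^ 2 \<ge> y ^ 2"
    proof -
      have "1 * y \<le> of_int k * y" using k1 y by (intro mult_right_mono) auto
      then have "y ^ 2 \<le> (of_int k * y) ^ 2" using y by (intro power_mono) auto
      then show ?thesis using n by (simp add: add_increasing)
    qed
    have pos: "norm (autfactor A z) ^ 2 > 0" using low y by (meson less_le_trans zero_less_power)
    have "Im (moebius_act A z) \<ge> 1/5"
      unfolding Im_moebius[OF A(1) zu] using up pos y by (simp add: y_def[symmetric] field_simps)
    then have "norm (slash2 f (mat2_inv A) (moebius_act A z)) \<le> C"
      by (intro C(2) mat2_inv_SL2Z A(1))
    then have "norm (f z) * norm (autfactor A z) ^ 2 \<le> C"
      unfolding slash2_mat2_inv[OF A(1) zu] by (simp add: norm_mult norm_power)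
    then have "norm (f z) * y ^ 2 \<le> C"
      using low mult_left_mono[OF low, of "norm (f z)"] by simp
    then show ?thesis using y by (simp add: y_def[symmetric] field_simps)
  qed
  then show ?thesis using C(1) by blast
qed

definition vert :: "rat \<Rightarrow> real \<Rightarrow> complex" where
  "vert r y = f (of_rat r + \<i> * of_real y)"

text \<open>The matrix sends infinity to \<open>k / D\<close>. Its inverse has automorphy factor
  \<open>- \<i> * D * y\<close> at height \<open>y\<close> above \<open>k / D\<close>, so small
  heights there become large ones at infinity.\<close>

lemma vert_cusp:
  assumes "k * d - b * D = 1" "D > 0" "y > 0"
  shows "norm (vert (of_int k / of_int D) y) =
    norm (slash2 f (mat2 k b D d) (moebius_act (mat2_inv (mat2 k b D d)) (of_rat (of_int k / of_int D) + \<i> * of_real y)))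
      / (of_int D * y) ^ 2"
   and "Im (moebius_act (mat2_inv (mat2 k b D d)) (of_rat (of_int k / of_int D) + \<i> * of_real y)) = 1 / (of_int D ^ 2 * y)"
proof -
  define A where "A = mat2 k b D d"
  define z where "z = (of_rat (of_int k / of_int D) + \<i> * of_real y :: complex)"
  have A: "A \<in> SL2Z" unfolding A_def by (rule mat2_SL2Z[OF assms(1)])
  have z: "z \<in> uhp" "Im z = y" using assms by (simp_all add: z_def uhp_iff of_rat_divide)
  have af: "autfactor (mat2_inv A) z = - (\<i> * of_real (of_int D * y))"
    using assms by (simp add: autfactor_def mat2_inv_def A_def z_def of_rat_divide field_simps)
  then have n: "norm (autfactor (mat2_inv A) z) ^ 2 = (of_int D * y) ^ 2"
    by (simp add: norm_mult power_mult_distrib)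
  have "slash2 f A (moebius_act (mat2_inv A) z) = f z * autfactor (mat2_inv A) z ^ 2"
    using slash2_mat2_inv[OF mat2_inv_SL2Z[OF A] z(1)] by (simp add: mat2_inv_inv)
  then have "norm (slash2 f A (moebius_act (mat2_inv A) z)) = norm (f z) * (of_int D * y) ^ 2"
    using n by (simp add: norm_mult norm_power)
  then show "norm (vert (of_int k / of_int D) y) =
    norm (slash2 f (mat2 k b D d) (moebius_act (mat2_inv (mat2 k b D d)) (of_rat (of_int k / of_int D) + \<i> * of_real y)))
      / (of_int D * y) ^ 2"
    using assms by (simp add: vert_def A_def[symmetric] z_def[symmetric])
  show "Im (moebius_act (mat2_inv (mat2 k b D d)) (of_rat (of_int k / of_int D) + \<i> * of_real y)) = 1 / (of_int D ^ 2 * y)"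
    unfolding A_def[symmetric] z_def[symmetric] Im_moebius[OF mat2_inv_SL2Z[OF A] z(1)] n z(2)
    using assms by (simp add: power2_eq_square field_simps)
qed

text \<open>For large \<open>y\<close> this is exponential decay at infinity. For small
  \<open>y\<close> it is the decay of \<open>f\<close> at the cusp \<open>r\<close>, where the
  exponential of a negative multiple of \<open>1 / y\<close> beats every power.\<close>

lemma vert_decay:
  "\<exists>C\<ge>0. \<forall>y>0. norm (vert r y) \<le> C * y ^ n \<and> norm (vert r y) * y ^ n \<le> C"
proof -
  obtain k D where r: "r = of_int k / of_int D" "D > 0" "coprime k D"
    by (metis quotient_of_div quotient_of_denom_pos quotient_of_coprime surj_pair)
  obtain u v where "u * k + v * D = gcd k D" using bezout_int by blast
  then have det: "k * u - (- v) * D = 1" using r(3) by (simp add: mult.commute)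
  define A where "A = mat2 k (- v) D u"
  have A: "A \<in> SL2Z" unfolding A_def by (rule mat2_SL2Z[OF det])
  obtain C1 where C1: "C1 \<ge> 0" "\<And>z. Im z \<ge> 1 \<Longrightarrow> norm (f z) \<le> C1 * exp (- (2 * pi / N) * Im z)"
    using slash2_decay[OF mat_1_SL2Z, of 1] by (auto simp: slash2_mat_1)
  define c where "c = 2 * pi / N"
  have c: "c > 0" using N_pos by (simp add: c_def)
  define \<delta> where "\<delta> = real_of_int D ^ 2"
  have \<delta>: "\<delta> > 0" using r by (simp add: \<delta>_def)
  obtain C2 where C2: "C2 \<ge> 0" "\<And>z. Im z \<ge> 1 / \<delta> \<Longrightarrow> norm (slash2 f A z) \<le> C2 * exp (- (2 * pi / N) * Im z)"
    using slash2_decay[OF A, of "1 / \<delta>"] \<delta> by auto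
  have large: "norm (vert r y) * y ^ n \<le> C1 * (fact n / c ^ n)" if "y \<ge> 1" for y
  proof -
    have "norm (vert r y) \<le> C1 * exp (- (c * y))"
      using C1(2)[of "of_rat r + \<i> * of_real y"] that r by (simp add: vert_def c_def of_rat_divide)
    also have "\<dots> \<le> C1 * (fact n / (c * y) ^ n)"
      using that c C1 by (intro mult_left_mono exp_minus_le_power) auto
    finally have "norm (vert r y) * y ^ n \<le> C1 * (fact n / (c * y) ^ n) * y ^ n"
      using that by (intro mult_right_mono) auto
    then show ?thesis using that c by (simp add: power_mult_distrib)
  qed
  have small: "norm (vert r y) \<le> C2 * (fact (n + 2) * \<delta> ^ (n + 1) / c ^ (n + 2)) * y ^ n" if "0 < y" "y \<le> 1" for y
  proof -
    define w where "w = moebius_act (mat2_inv A) (of_rat (of_int k / of_int D) + \<i> * of_real y)"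
    have w: "Im w = 1 / (\<delta> * y)" "norm (vert r y) = norm (slash2 f A w) / (\<delta> * y ^ 2)"
      using vert_cusp[OF det r(2) that(1)] by (simp_all add: w_def A_def \<delta>_def r(1) power_mult_distrib)
    have "norm (slash2 f A w) \<le> C2 * exp (- (c / (\<delta> * y)))"
      using C2(2)[of w] w(1) that \<delta> by (simp add: c_def field_simps)
    \<comment> \<open>Two powers more than \<open>n\<close>, to pay for the division by
      \<open>\<delta> * y ^ 2\<close> that comes from the automorphy factor.\<close>
    also have "\<dots> \<le> C2 * (fact (n + 2) / (c / (\<delta> * y)) ^ (n + 2))"
      using that c \<delta> C2 by (intro mult_left_mono exp_minus_le_power) auto
    finally have "norm (vert r y) \<le> C2 * (fact (n + 2) / (c / (\<delta> * y)) ^ (n + 2)) / (\<delta> * y ^ 2)"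
      unfolding w(2) using that \<delta> by (intro divide_right_mono) auto
    also have "\<dots> = C2 * (fact (n + 2) * \<delta> ^ (n + 1) / c ^ (n + 2)) * y ^ n"
      using that c \<delta> by (simp add: power_divide power_mult_distrib power_add power2_eq_square)
    finally show ?thesis .
  qed
  define K where "K = C1 * (fact n / c ^ n)"
  define L where "L = C2 * (fact (n + 2) * \<delta> ^ (n + 1) / c ^ (n + 2))"
  have KL: "K \<ge> 0" "L \<ge> 0" using C1 C2 c \<delta> by (auto simp: K_def L_def)
  have "norm (vert r y) \<le> (K + L) * y ^ n \<and> norm (vert r y) * y ^ n \<le> K + L" if "y > 0" for y
  proof (cases "y \<ge> 1")
    case True
    then have y1: "1 \<le> y ^ n" by simp
    have K: "norm (vert r y) * y ^ n \<le> K" using large[OF True] by (simp add: K_def)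
    have "norm (vert r y) * 1 \<le> norm (vert r y) * y ^ n" using y1 by (intro mult_left_mono) auto
    also have "\<dots> \<le> (K + L) * 1" using K KL by simp
    also have "\<dots> \<le> (K + L) * y ^ n" using KL y1 by (intro mult_left_mono) auto
    finally show ?thesis using K KL by simp
  next
    case False
    then have y1: "y ^ n \<le> 1" using that by (simp add: power_le_one)
    have yn: "0 \<le> y ^ n" using that by simp
    have s: "norm (vert r y) \<le> L * y ^ n" using small[of y] False that by (simp add: L_def)
    have LK: "L * y ^ n \<le> (K + L) * y ^ n" using KL yn by (intro mult_right_mono) auto
    have "norm (vert r y) * y ^ n \<le> norm (vert r y) * 1" using y1 by (intro mult_left_mono) auto
    also have "\<dots> \<le> L * y ^ n" using s by simp
    also have "\<dots> \<le> L * 1" using KL y1 by (intro mult_left_mono) auto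
    finally show ?thesis using s LK KL by auto
  qed
  then show ?thesis using KL by (intro exI[of _ "K + L"]) auto
qed

end

section \<open>Mellin transforms\<close>

lemma integrable_scale:
  fixes g :: "real \<Rightarrow> complex"
  assumes "c > 0" "g absolutely_integrable_on {0<..}"
  shows "(\<lambda>y. g (c * y)) absolutely_integrable_on {0<..}"
    and "integral {0<..} (\<lambda>y. g (c * y)) = integral {0<..} g / of_real c"
proof -
  let ?G = "\<lambda>x. indicator {0<..} x *\<^sub>R g x"
  have eq: "?G (0 + c * x) = indicator {0<..} x *\<^sub>R g (c * x)" for x
    using assms(1) by (simp add: indicator_def zero_less_mult_iff)
  have "integrable lebesgue ?G" using assms(2) by (simp add: set_integrable_def)
  then have "integrable lebesgue (\<lambda>x. ?G (0 + c * x))"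
    using assms(1) by (intro lebesgue_integrable_real_affine) auto
  then show int: "(\<lambda>y. g (c * y)) absolutely_integrable_on {0<..}"
    unfolding eq by (simp add: set_integrable_def)
  have "integral\<^sup>L lebesgue ?G = \<bar>c\<bar> *\<^sub>R integral\<^sup>L lebesgue (\<lambda>x. ?G (0 + c * x))"
    by (rule lebesgue_integral_real_affine) (use assms in auto)
  then have "integral\<^sup>L lebesgue ?G = c *\<^sub>R integral\<^sup>L lebesgue (\<lambda>x. indicator {0<..} x *\<^sub>R g (c * x))"
    unfolding eq using assms(1) by simp
  then have "integral {0<..} g = c *\<^sub>R integral {0<..} (\<lambda>y. g (c * y))"
    using set_lebesgue_integral_eq_integral(2)[OF int] set_lebesgue_integral_eq_integral(2)[OF assms(2)]
    by (simp add: set_lebesgue_integral_def)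
  then show "integral {0<..} (\<lambda>y. g (c * y)) = integral {0<..} g / of_real c"
    using assms(1) by (simp add: scaleR_conv_of_real)
qed

text \<open>The constant \<open>C\<close> dominates near 0 and \<open>C / y ^ 2\<close> near
  infinity. The explicit truncation error is what later makes truncated Mellin integrals converge
  uniformly.\<close>

lemma half_line_integral_bounds:
  fixes g :: "real \<Rightarrow> complex"
  assumes cont: "continuous_on {0<..} g" and C: "\<And>y. y > 0 \<Longrightarrow> norm (g y) \<le> C"
    "\<And>y. y > 0 \<Longrightarrow> norm (g y) * y ^ 2 \<le> C"
  shows "g absolutely_integrable_on {0<..}"
    and "t \<ge> 1 \<Longrightarrow> norm (integral {0<..} g - integral {1/t..t} g) \<le> 2 * C / t"
proof -
  have piece: "g absolutely_integrable_on S"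
    if "S \<in> sets lebesgue" "S \<subseteq> {0<..}" "b integrable_on S" "\<And>y. y \<in> S \<Longrightarrow> norm (g y) \<le> b y" for S b
    by (rule measurable_bounded_by_integrable_imp_absolutely_integrable[OF _ that(1,3,4)])
      (use that cont in \<open>auto intro!: continuous_imp_measurable_on_sets_lebesgue intro: continuous_on_subset\<close>)
  have left: "g absolutely_integrable_on {0<..<u}" "norm (integral {0<..<u} g) \<le> C * u" if "u > 0" for u
  proof -
    have h: "((\<lambda>_. C) has_integral (C * u)) {0<..<u}"
      using has_integral_const_real[of C 0 u] that by (simp add: has_integral_Icc_iff_Ioo mult.commute)
    then have i: "(\<lambda>_. C) integrable_on {0<..<u}" by blast
    show a: "g absolutely_integrable_on {0<..<u}" by (rule piece[OF _ _ i]) (use C in auto)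
    have "norm (integral {0<..<u} g) \<le> integral {0<..<u} (\<lambda>_. C)"
      by (rule integral_norm_bound_integral) (use a i C in \<open>auto simp: set_lebesgue_integral_eq_integral\<close>)
    then show "norm (integral {0<..<u} g) \<le> C * u" using h by (simp add: integral_unique)
  qed
  have right: "g absolutely_integrable_on {u<..}" "norm (integral {u<..} g) \<le> C / u" if "u > 0" for u
  proof -
    have "((\<lambda>x. C * x powr (-2)) has_integral (C * (- (u powr (-2+1)) / (-2+1)))) {u..}"
      by (intro has_integral_mult_right has_integral_powr_to_inf) (use that in auto)
    then have "((\<lambda>x. C * x powr (-2)) has_integral (C / u)) {u..}"
      using that by (simp add: powr_minus divide_inverse)
    then have h: "((\<lambda>x. C * x powr (-2)) has_integral (C / u)) {u<..}"
      by (subst has_integral_spike_set_eq[where T = "{u..}"]) (auto intro: negligible_subset[of "{u}"])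
    then have i: "(\<lambda>x. C * x powr (-2)) integrable_on {u<..}" by blast
    have b: "norm (g y) \<le> C * y powr (-2)" if "y \<in> {u<..}" for y
      using C(2)[of y] that \<open>u > 0\<close> by (simp add: powr_minus field_simps)
    show a: "g absolutely_integrable_on {u<..}" by (rule piece[OF _ _ i]) (use that b in auto)
    have "norm (integral {u<..} g) \<le> integral {u<..} (\<lambda>x. C * x powr (-2))"
      by (rule integral_norm_bound_integral) (use a i b in \<open>auto simp: set_lebesgue_integral_eq_integral\<close>)
    then show "norm (integral {u<..} g) \<le> C / u" by (simp only: integral_unique[OF h])
  qed
  have mid: "g absolutely_integrable_on {u..v}" if "u > 0" for u v
    by (rule absolutely_integrable_continuous_real) (use that in \<open>auto intro: continuous_on_subset[OF cont]\<close>)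
  have split: "{0<..} = {0<..<u} \<union> ({u..v} \<union> {v<..})" if "0 < u" "u \<le> v" for u v :: real
    using that by auto
  have "g absolutely_integrable_on ({0<..<1} \<union> ({1..1} \<union> {1<..}))"
    by (intro set_integrable_Un left mid right) auto
  then show abs: "g absolutely_integrable_on {0<..}" using split[of 1 1] by simp
  show "norm (integral {0<..} g - integral {1/t..t} g) \<le> 2 * C / t" if t: "t \<ge> 1"
  proof -
    have "1 / t \<le> 1" using t by simp
    then have t1: "1 / t \<le> t" "0 < 1 / t" using t order_trans by (blast, simp)
    have disj: "{1/t..t} \<inter> {t<..} = {}" by auto
    have i1: "g integrable_on {0<..<1/t}" and i2: "g integrable_on {1/t..t}" and i3: "g integrable_on {t<..}"
      using left(1)[of "1/t"] mid[of "1/t" t] right(1)[of t] t by (auto simp: set_lebesgue_integral_eq_integral)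
    have i23: "g integrable_on ({1/t..t} \<union> {t<..})"
      by (rule integrable_Un[OF _ i2 i3]) (simp add: disj)
    have "integral ({1/t..t} \<union> {t<..}) g = integral {1/t..t} g + integral {t<..} g"
      by (rule integral_Un[OF i2 i3]) (simp add: disj)
    moreover have "integral ({0<..<1/t} \<union> ({1/t..t} \<union> {t<..})) g = integral {0<..<1/t} g + integral ({1/t..t} \<union> {t<..}) g"
    proof (rule integral_Un[OF i1 i23])
      have "{0<..<1/t} \<inter> ({1/t..t} \<union> {t<..}) = {}" using t1 by auto
      then show "negligible ({0<..<1/t} \<inter> ({1/t..t} \<union> {t<..}))" by simp
    qed
    ultimately have "integral {0<..} g - integral {1/t..t} g = integral {0<..<1/t} g + integral {t<..} g"
      using split[OF t1(2,1)] by simp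
    then have "norm (integral {0<..} g - integral {1/t..t} g) \<le> C * (1/t) + C / t"
      using norm_triangle_ineq[of "integral {0<..<1/t} g" "integral {t<..} g"] left(2)[of "1/t"] right(2)[of t] t
      by simp
    then show ?thesis by simp
  qed
qed

text \<open>The first bound is decay at 0, the second decay at infinity; together they make the
  Mellin transform converge for every \<open>s\<close>.\<close>

definition rapidly_decaying :: "(real \<Rightarrow> complex) \<Rightarrow> bool" where
  "rapidly_decaying h \<longleftrightarrow> continuous_on {0<..} h \<and>
     (\<forall>n. \<exists>C\<ge>0. \<forall>y>0. norm (h y) \<le> C * y ^ n \<and> norm (h y) * y ^ n \<le> C)"

lemma rapidly_decaying_bound:
  assumes "rapidly_decaying h"
  shows "\<exists>C\<ge>0. \<forall>s y. \<bar>Re s\<bar> \<le> R \<longrightarrow> y > 0 \<longrightarrow>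
     norm (h y * of_real y powr (s - 1)) \<le> C \<and> norm (h y * of_real y powr (s - 1)) * y ^ 2 \<le> C"
proof -
  let ?h = "\<lambda>s y. h y * of_real y powr (s - 1)"
  \<comment> \<open>With \<open>\<bar>Re s\<bar> \<le> R\<close> the exponent
    \<open>Re s - 1\<close> of \<open>y\<close> lies between \<open>- m\<close> and
    \<open>m - 2\<close>, so order \<open>m\<close> absorbs it at both ends together with the extra
    \<open>y ^ 2\<close>.\<close>
  define m where "m = nat \<lceil>\<bar>R\<bar>\<rceil> + 1"
  have m: "real m \<ge> \<bar>R\<bar> + 1" unfolding m_def by linarith
  obtain C where C: "C \<ge> 0" "\<And>y. y > 0 \<Longrightarrow> norm (h y) \<le> C * y ^ m" "\<And>y. y > 0 \<Longrightarrow> norm (h y) * y ^ m \<le> C"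
    using assms unfolding rapidly_decaying_def by meson
  have "norm (?h s y) \<le> C \<and> norm (?h s y) * y ^ 2 \<le> C"
    if s: "\<bar>Re s\<bar> \<le> R" and y: "y > 0" for s y
  proof -
    define x where "x = Re s - 1"
    have x: "x + 2 \<le> m" "- m \<le> x" using s m by (auto simp: x_def)
    have n: "norm (?h s y) = norm (h y) * y powr x"
      using y by (simp add: norm_mult norm_powr_real_powr x_def)
    show ?thesis
    proof (cases "y \<ge> 1")
      case True
      have "norm (h y) * y powr x * y ^ 2 = norm (h y) * y powr (x + 2)"
        using y by (simp add: powr_add)
      also have "\<dots> \<le> norm (h y) * y powr m"
        using True x by (intro mult_left_mono powr_mono) auto
      also have "\<dots> \<le> C" using C(3)[OF y] y by (simp add: powr_realpow)
      finally have 1: "norm (h y) * y powr x * y ^ 2 \<le> C" .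
      have "norm (h y) * y powr x * 1 \<le> norm (h y) * y powr x * y ^ 2"
        using True by (intro mult_left_mono) auto
      then show ?thesis using 1 n by simp
    next
      case False
      have "norm (h y) * y powr x \<le> (C * y ^ m) * y powr (- m)"
        using False y x C by (intro mult_mono powr_mono') auto
      also have "\<dots> = C" using y by (simp add: powr_minus powr_realpow)
      finally have 1: "norm (h y) * y powr x \<le> C" .
      have "norm (h y) * y powr x * y ^ 2 \<le> norm (h y) * y powr x * 1"
        using False y by (intro mult_left_mono power_le_one) auto
      then show ?thesis using 1 n by simp
    qed
  qed
  then show ?thesis using C(1) by blast
qed

lemma continuous_on_mellin:
  assumes "rapidly_decaying h"
  shows "continuous_on {0<..} (\<lambda>y. h y * of_real y powr s)"
  using assms unfolding rapidly_decaying_def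
  by (intro continuous_intros continuous_on_powr_complex) (auto simp: complex_nonpos_Reals_iff)

lemma mellin_integrable:
  assumes "rapidly_decaying h"
  shows "(\<lambda>y. h y * of_real y powr (s - 1)) absolutely_integrable_on {0<..}"
proof -
  obtain C where C: "C \<ge> 0" "\<And>y. y > 0 \<Longrightarrow> norm (h y * of_real y powr (s - 1)) \<le> C"
    "\<And>y. y > 0 \<Longrightarrow> norm (h y * of_real y powr (s - 1)) * y ^ 2 \<le> C"
    using rapidly_decaying_bound[OF assms, of "\<bar>Re s\<bar>"] by auto
  then show ?thesis by (intro half_line_integral_bounds(1) continuous_on_mellin assms)
qed

text \<open>The integrals over \<open>{1/n..n}\<close> are holomorphic by differentiation under the
  integral sign, and they converge uniformly on discs because the bounds hold uniformly in a
  vertical strip.\<close>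

lemma mellin_holomorphic:
  assumes "rapidly_decaying h"
  shows "(\<lambda>s. integral {0<..} (\<lambda>y. h y * of_real y powr (s - 1))) holomorphic_on UNIV"
proof (rule holomorphic_uniform_sequence)
  let ?M = "\<lambda>s. integral {0<..} (\<lambda>y. h y * of_real y powr (s - 1))"
  define M where "M n s = integral {1 / real (Suc n)..real (Suc n)} (\<lambda>y. h y * of_real y powr (s - 1))" for n s
  show "M n holomorphic_on UNIV" for n
  proof -
    let ?I = "cbox (1 / real (Suc n)) (real (Suc n))"
    have pos: "y > 0" if "y \<in> ?I" for y
      using that by (auto intro: less_le_trans[rotated])
    have hc: "continuous_on ?I h"
      using assms pos unfolding rapidly_decaying_def by (auto intro: continuous_on_subset)
    have "(\<lambda>s. integral ?I (\<lambda>y. h y * of_real y powr (s - 1))) holomorphic_on UNIV"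
    proof (rule leibniz_rule_holomorphic[where fx = "\<lambda>s y. h y * (of_real y powr (s - 1) * Ln (of_real y))"])
      show "((\<lambda>s. h y * of_real y powr (s - 1)) has_field_derivative h y * (of_real y powr (s - 1) * Ln (of_real y)))
         (at s within UNIV)" if "y \<in> ?I" for s y
        using pos[OF that] by (auto intro!: derivative_eq_intros simp: powr_def)
      show "(\<lambda>y. h y * of_real y powr (s - 1)) integrable_on ?I" for s
        by (intro integrable_continuous continuous_on_subset[OF continuous_on_mellin[OF assms]]) (use pos in auto)
      have "continuous_on (UNIV \<times> ?I) (\<lambda>p. h (snd p) * (of_real (snd p) powr (fst p - 1) * Ln (of_real (snd p))))"
        using pos pos[THEN less_imp_le]
        by (intro continuous_intros continuous_on_compose2[OF hc] continuous_on_powr_complex)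
          (auto simp: complex_nonpos_Reals_iff not_le)
      then show "continuous_on (UNIV \<times> ?I) (\<lambda>(s, y). h y * (of_real y powr (s - 1) * Ln (of_real y)))"
        by (simp add: case_prod_unfold)
    qed auto
    then show ?thesis by (simp add: M_def[abs_def])
  qed
  show "\<exists>d. 0 < d \<and> cball s d \<subseteq> UNIV \<and>
     uniform_limit (cball s d) M ?M sequentially" for s
  proof -
    define R where "R = norm s + 1"
    obtain C where C: "C \<ge> 0" "\<And>s y. \<bar>Re s\<bar> \<le> R \<Longrightarrow> y > 0 \<Longrightarrow> norm (h y * of_real y powr (s - 1)) \<le> C"
      "\<And>s y. \<bar>Re s\<bar> \<le> R \<Longrightarrow> y > 0 \<Longrightarrow> norm (h y * of_real y powr (s - 1)) * y ^ 2 \<le> C"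
      using rapidly_decaying_bound[OF assms, of R] by blast
    have b: "norm (?M t - M n t) \<le> 2 * C / real (Suc n)"
      if "t \<in> cball s 1" for n t
    proof -
      have "norm t \<le> R" using that norm_triangle_ineq2[of t s] by (simp add: R_def dist_norm norm_minus_commute)
      then have "\<bar>Re t\<bar> \<le> R" using abs_Re_le_cmod order_trans by blast
      then show ?thesis unfolding M_def
        by (intro half_line_integral_bounds(2) continuous_on_mellin assms C(2,3)) auto
    qed
    have "uniform_limit (cball s 1) M ?M sequentially"
    proof (rule uniform_limitI)
      fix e :: real assume "e > 0"
      have "(\<lambda>n. 2 * C / real (Suc n)) \<longlonglongrightarrow> 0"
        using tendsto_mult_left[OF LIMSEQ_inverse_real_of_nat, of "2 * C"] by (simp add: divide_inverse)
      then have "\<forall>\<^sub>F n in sequentially. 2 * C / real (Suc n) < e"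
        using \<open>e > 0\<close> by (rule order_tendstoD)
      then show "\<forall>\<^sub>F n in sequentially. \<forall>t\<in>cball s 1.
          dist (M n t) (?M t) < e"
      proof eventually_elim
        case (elim n)
        show ?case
        proof
          fix t assume "t \<in> cball s 1"
          from le_less_trans[OF b[OF this] elim]
          show "dist (M n t) (?M t) < e"
            by (simp add: dist_norm norm_minus_commute)
        qed
      qed
    qed
    then show ?thesis by (intro exI[of _ 1]) auto
  qed
qed auto

lemma Gamma_integral_scaled:
  assumes "Re s > 0" "c > 0"
  shows "(\<lambda>y. of_real (exp (- (c * y))) * of_real y powr (s - 1)) absolutely_integrable_on {0<..}"
    and "integral {0<..} (\<lambda>y. of_real (exp (- (c * y))) * of_real y powr (s - 1)) = Gamma s * of_real c powr (- s)"
proof -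
  let ?g = "\<lambda>y. of_real (exp (- (c * y))) * of_real y powr (s - 1) :: complex"
  define G where "G = (\<lambda>t. of_real t powr (s - 1) / of_real (exp t) :: complex)"
  have G: "G absolutely_integrable_on {0<..}" unfolding G_def
    by (rule absolutely_integrable_Gamma_integral'[OF assms(1)])
  have iG: "integral {0<..} G = Gamma s"
    unfolding G_def by (rule integral_unique[OF Gamma_integral_complex'[OF assms(1)]])
  have eq: "?g y = of_real c powr (1 - s) * G (c * y)" if "y \<in> {0<..}" for y
  proof -
    have "complex_of_real (c * y) powr (s - 1) = of_real c powr (s - 1) * of_real y powr (s - 1)"
      using that assms by (simp add: powr_times_real)
    moreover have "complex_of_real c powr (1 - s) * of_real c powr (s - 1) = 1"
      using assms by (simp add: powr_add[symmetric])
    ultimately show ?thesis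
      by (simp add: G_def exp_minus field_simps)
  qed
  have "(\<lambda>y. of_real c powr (1 - s) * G (c * y)) absolutely_integrable_on {0<..}"
    by (intro set_integrable_mult_right integrable_scale(1) assms G)
  then show "?g absolutely_integrable_on {0<..}"
    by (subst set_integrable_cong[OF refl refl eq])
  have "integral {0<..} ?g =
     integral {0<..} (\<lambda>y. of_real c powr (1 - s) * G (c * y))"
    by (rule integral_cong) (rule eq)
  also have "\<dots> = of_real c powr (1 - s) * (Gamma s / of_real c)"
    using integrable_scale(2)[OF assms(2) G] by (simp add: iG)
  also have "\<dots> = Gamma s * of_real c powr (- s)"
    using assms powr_add[of "complex_of_real c" 1 "- s"] by simp
  finally show "integral {0<..} ?g = Gamma s * of_real c powr (- s)" .
qed

text \<open>Each exponential is split into two equal halves: one supplies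
  \<open>4! / (pi * n * y) ^ 4\<close>, which makes the sum over \<open>n\<close> converge, and the
  other supplies \<open>exp (- (pi * y))\<close>. The constant 24 is \<open>4!\<close>.\<close>

lemma theta_majorant:
  fixes y :: real
  assumes "y > 0"
  shows "(\<Sum>n<K. real (Suc n) ^ 2 * exp (- (2 * pi * real (Suc n) * y)))
    \<le> (24 / pi ^ 4 * (\<Sum>n. 1 / real (Suc n) ^ 2)) * (exp (- (pi * y)) / y ^ 4)"
proof -
  let ?K = "24 / pi ^ 4 * (exp (- (pi * y)) / y ^ 4)"
  have sm: "summable (\<lambda>n. 1 / real (Suc n) ^ 2)"
    using summable_Suc_iff[of "\<lambda>n. 1 / real n ^ 2"] inverse_power_summable[of 2, where 'a = real]
    by (simp add: divide_inverse)
  have "real (Suc n) ^ 2 * exp (- (2 * pi * real (Suc n) * y)) \<le> ?K * (1 / real (Suc n) ^ 2)" for n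
  proof -
    define k where "k = real (Suc n)"
    have k: "k \<ge> 1" by (simp add: k_def)
    have "exp (- (pi * k * y)) \<le> fact 4 / (pi * k * y) ^ 4"
      using assms k by (intro exp_minus_le_power) auto
    moreover have "exp (- (pi * k * y)) \<le> exp (- (pi * y))"
      using assms k by simp
    ultimately have "exp (- (pi * k * y)) * exp (- (pi * k * y)) \<le> fact 4 / (pi * k * y) ^ 4 * exp (- (pi * y))"
      using assms k by (intro mult_mono) auto
    then have "exp (- (2 * pi * k * y)) \<le> fact 4 / (pi * k * y) ^ 4 * exp (- (pi * y))"
      by (simp add: mult.assoc flip: exp_add)
    then have "k ^ 2 * exp (- (2 * pi * k * y)) \<le> k ^ 2 * (fact 4 / (pi * k * y) ^ 4 * exp (- (pi * y)))"
      by (intro mult_left_mono) auto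
    also have "\<dots> = ?K * (1 / k ^ 2)"
      using k assms by (simp add: fact_numeral power_mult_distrib field_simps eval_nat_numeral)
    finally show ?thesis by (simp add: k_def)
  qed
  then have "(\<Sum>n<K. real (Suc n) ^ 2 * exp (- (2 * pi * real (Suc n) * y)))
     \<le> (\<Sum>n<K. ?K * (1 / real (Suc n) ^ 2))"
    by (intro sum_mono)
  also have "\<dots> = ?K * (\<Sum>n<K. 1 / real (Suc n) ^ 2)"
    by (simp only: sum_distrib_left)
  also have "\<dots> \<le> ?K * (\<Sum>n. 1 / real (Suc n) ^ 2)"
    using assms by (intro mult_left_mono sum_le_suminf sm) auto
  finally show ?thesis by (simp add: mult_ac)
qed

text \<open>The continuation is \<open>(2 * pi) powr s / Gamma s\<close> times the Mellin transform
  of \<open>h\<close>; \<open>rGamma\<close> is entire and \<open>Gamma 1 = 1\<close> gives the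
  value at 1. The majorant loses \<open>y ^ 4\<close> at 0, hence termwise integration in the half
  plane \<open>Re s > 4\<close>.\<close>

lemma dirichlet_series_continuation:
  fixes b :: "nat \<Rightarrow> complex"
  assumes h: "rapidly_decaying h"
    and b: "\<And>n. norm (b n) \<le> C * real n ^ 2" "C \<ge> 0"
    and sums: "\<And>y. y > 0 \<Longrightarrow> (\<lambda>n. b (Suc n) * of_real (exp (- (2 * pi * real (Suc n) * y)))) sums h y"
  shows "\<exists>F. F holomorphic_on UNIV \<and> F 1 = 2 * of_real pi * integral {0<..} h \<and>
    (\<forall>s. Re s > 4 \<longrightarrow> (\<lambda>n. b (Suc n) * of_nat (Suc n) powr (- s)) sums F s)"
proof -
  define M where "M s = integral {0<..} (\<lambda>y. h y * of_real y powr (s - 1))" for s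
  define F where "F s = of_real (2 * pi) powr s * rGamma s * M s" for s
  have "F holomorphic_on UNIV"
    unfolding F_def M_def by (intro holomorphic_intros mellin_holomorphic h)
  moreover have "F 1 = 2 * of_real pi * integral {0<..} h"
  proof -
    have "M 1 = integral {0<..} h" unfolding M_def by (rule integral_cong) auto
    then show ?thesis by (simp add: F_def)
  qed
  moreover have "(\<lambda>n. b (Suc n) * of_nat (Suc n) powr (- s)) sums F s" if s: "Re s > 4" for s
  proof -
    let ?g = "\<lambda>n. b (Suc n) * (Gamma s * of_real (2 * pi * real (Suc n)) powr (- s))"
    define T where "T n y = b (Suc n) * (of_real (exp (- (2 * pi * real (Suc n) * y))) * of_real y powr (s - 1))" for n y
    define D where "D = C * (24 / pi ^ 4 * (\<Sum>n. 1 / real (Suc n) ^ 2))"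
    define H where "H y = D * norm (complex_of_real (exp (- (pi * y))) * of_real y powr (s - 4 - 1))" for y
    have T_int: "T n integrable_on {0<..}"
      "integral {0<..} (T n) = ?g n" for n
    proof -
      have c: "2 * pi * real (Suc n) > 0" and s0: "Re s > 0" using s by auto
      show "T n integrable_on {0<..}"
        unfolding T_def using Gamma_integral_scaled(1)[OF s0 c]
        by (intro integrable_on_mult_right) (simp add: set_lebesgue_integral_eq_integral)
      show "integral {0<..} (T n) = ?g n"
        unfolding T_def integral_mult_right Gamma_integral_scaled(2)[OF s0 c] ..
    qed
    have H_int: "H integrable_on {0<..}"
    proof -
      have "(\<lambda>y. of_real (exp (- (pi * y))) * of_real y powr (s - 4 - 1) :: complex) absolutely_integrable_on {0<..}"
        by (rule Gamma_integral_scaled(1)) (use s in auto)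
      then show ?thesis unfolding H_def
        by (intro integrable_on_mult_right) (auto simp: absolutely_integrable_on_def)
    qed
    have bound: "norm (\<Sum>n<K. T n y) \<le> H y" if "y \<in> {0<..}" for K y
    proof -
      have y: "y > 0" using that by simp
      have p: "norm (complex_of_real y powr (s - 1)) = y powr (Re s - 1)"
        "norm (complex_of_real y powr (s - 4 - 1)) = y powr (Re s - 1) / y ^ 4"
        using y powr_diff[of y "Re s - 1" 4] powr_realpow[of y 4]
        by (simp_all add: norm_powr_real_powr algebra_simps)
      have "norm (\<Sum>n<K. T n y) \<le> (\<Sum>n<K. C * real (Suc n) ^ 2 * (exp (- (2 * pi * real (Suc n) * y)) * y powr (Re s - 1)))"
      proof (rule sum_norm_le)
        show "norm (T n y) \<le> C * real (Suc n) ^ 2 * (exp (- (2 * pi * real (Suc n) * y)) * y powr (Re s - 1))" for n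
          unfolding T_def norm_mult p(1) using b(1)[of "Suc n"] b(2) by (intro mult_mono) auto
      qed
      also have "\<dots> = C * y powr (Re s - 1) * (\<Sum>n<K. real (Suc n) ^ 2 * exp (- (2 * pi * real (Suc n) * y)))"
        by (simp add: sum_distrib_left mult_ac)
      also have "\<dots> \<le> C * y powr (Re s - 1) * ((24 / pi ^ 4 * (\<Sum>n. 1 / real (Suc n) ^ 2)) * (exp (- (pi * y)) / y ^ 4))"
        using b(2) by (intro mult_left_mono theta_majorant y) auto
      also have "\<dots> = H y"
        unfolding H_def D_def norm_mult p(2) by simp
      finally show ?thesis .
    qed
    have conv: "(\<lambda>K. \<Sum>n<K. T n y) \<longlonglongrightarrow> h y * of_real y powr (s - 1)" if "y \<in> {0<..}" for y
      using sums_mult2[OF sums[of y], of "of_real y powr (s - 1)"] that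
      by (simp add: T_def sums_def mult.assoc)
    have "(\<lambda>K. integral {0<..} (\<lambda>y. \<Sum>n<K. T n y)) \<longlonglongrightarrow> M s"
      unfolding M_def
      by (rule dominated_convergence(2)[OF _ H_int bound conv]) (auto intro: integrable_sum T_int)
    moreover have "integral {0<..} (\<lambda>y. \<Sum>n<K. T n y) =
        (\<Sum>n<K. ?g n)" for K
      by (simp add: integral_sum T_int)
    ultimately have "(\<lambda>n. ?g n) sums M s"
      by (simp add: sums_def)
    then have "(\<lambda>n. of_real (2 * pi) powr s * rGamma s * ?g n) sums F s"
      unfolding F_def by (rule sums_mult)
    moreover have eq: "of_real (2 * pi) powr s * rGamma s * ?g n
       = b (Suc n) * of_nat (Suc n) powr (- s)" for n
    proof -
      have "of_real (2 * pi * real (Suc n)) powr (- s) = of_real (2 * pi) powr (- s) * of_nat (Suc n) powr (- s)"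
        using powr_times_real[of "of_real (2 * pi)" "of_nat (Suc n)" "- s"] by simp
      moreover have "complex_of_real (2 * pi) powr s * of_real (2 * pi) powr (- s) = 1"
        by (simp add: powr_minus)
      moreover have "rGamma s * Gamma s = 1"
      proof -
        have "s \<notin> \<int>\<^sub>\<le>\<^sub>0" using s by (auto elim!: nonpos_Ints_cases)
        then show ?thesis by (simp add: rGamma_inverse_Gamma Gamma_eq_zero_iff)
      qed
      ultimately show ?thesis by (simp add: mult_ac)
    qed
    ultimately show ?thesis by (simp only: eq)
  qed
  ultimately show ?thesis by blast
qed

text \<open>Two continuations agree on a common half plane of convergence, hence everywhere by the
  identity theorem, so the definite description is met.\<close>

lemma twisted_L_eqI:
  assumes F: "F holomorphic_on UNIV"
    "\<And>s. Re s > \<sigma> \<Longrightarrow> (\<lambda>n. of_int (psi (int (Suc n))) * of_rat (a (Suc n)) * of_nat (Suc n) powr (- s)) sums F s"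
  shows "twisted_L a psi = F"
  unfolding twisted_L_def
proof (rule the_equality)
  let ?L = "\<lambda>s n. of_int (psi (int (Suc n))) * of_rat (a (Suc n)) * of_nat (Suc n) powr (- s)"
  show "F holomorphic_on UNIV \<and> (\<exists>\<sigma>. \<forall>s. Re s > \<sigma> \<longrightarrow>
     ?L s sums F s)"
    using F by blast
next
  let ?L = "\<lambda>s n. of_int (psi (int (Suc n))) * of_rat (a (Suc n)) * of_nat (Suc n) powr (- s)"
  fix G assume "G holomorphic_on UNIV \<and> (\<exists>\<sigma>. \<forall>s. Re s > \<sigma> \<longrightarrow>
     ?L s sums G s)"
  then obtain \<tau> where G: "G holomorphic_on UNIV" "\<And>s. Re s > \<tau> \<Longrightarrow>
     ?L s sums G s"
    by blast
  show "G = F"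
  proof
    fix s
    show "G s = F s"
    proof (rule analytic_continuation_open[where s = "{s. Re s > max \<sigma> \<tau>}" and s' = UNIV and f = G and g = F])
      show "open {s. Re s > max \<sigma> \<tau>}" by (rule open_halfspace_Re_gt)
      show "{s. Re s > max \<sigma> \<tau>} \<noteq> {}"
        by (auto intro!: exI[of _ "of_real (max \<sigma> \<tau> + 1)"])
      show "G z = F z" if "z \<in> {s. Re s > max \<sigma> \<tau>}" for z
        by (rule sums_unique2[OF G(2) F(2)]) (use that in auto)
    qed (use F(1) G(1) in \<open>simp_all add: connected_UNIV\<close>)
  qed
qed

section \<open>Fourier expansions and Hecke operators\<close>

lemma complex_of_rat: "(of_rat r :: complex) = of_real (of_rat r)"
  by (cases r) (simp add: of_rat_rat)

definition unit_exp :: "real \<Rightarrow> complex" where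
  "unit_exp x = cis (2 * pi * x)"

lemma unit_exp_add: "unit_exp (x + y) = unit_exp x * unit_exp y"
  by (simp add: unit_exp_def cis_mult algebra_simps)

lemma unit_exp_int: "unit_exp (of_int n) = 1"
  by (simp add: unit_exp_def cis_multiple_2pi)

lemma unit_exp_power: "unit_exp x ^ n = unit_exp (of_nat n * x)"
  by (simp add: unit_exp_def Complex.DeMoivre mult_ac)

lemma cnj_unit_exp: "cnj (unit_exp x) = unit_exp (- x)"
  by (simp add: unit_exp_def cis_cnj)

lemma unit_exp_eq_1_iff: "unit_exp x = 1 \<longleftrightarrow> x \<in> \<int>"
proof
  assume "unit_exp x = 1"
  then have "cos (2 * pi * x) = 1" by (simp add: unit_exp_def complex_eq_iff)
  then obtain n :: int where "2 * pi * x = of_int n * 2 * pi" by (auto simp: cos_one_2pi_int)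
  then show "x \<in> \<int>" by simp
qed (auto elim!: Ints_cases simp: unit_exp_int)

lemma sum_unit_exp:
  assumes "q > 0"
  shows "(\<Sum>b<q. unit_exp (of_nat b * of_int n / of_nat q)) = (if int q dvd n then of_nat q else 0)"
proof -
  define \<zeta> where "\<zeta> = unit_exp (of_int n / of_nat q)"
  have pow: "unit_exp (of_nat b * of_int n / of_nat q) = \<zeta> ^ b" for b
    by (simp add: \<zeta>_def unit_exp_power)
  have 1: "\<zeta> = 1 \<longleftrightarrow> int q dvd n"
  proof -
    have "real_of_int n / real q \<in> \<int> \<longleftrightarrow> int q dvd n"
      using assms of_int_div_of_int_in_Ints_iff[of n "int q", where 'a = real] by simp
    then show ?thesis by (simp add: \<zeta>_def unit_exp_eq_1_iff)
  qed
  have q: "\<zeta> ^ q = 1" using assms by (simp add: \<zeta>_def unit_exp_power unit_exp_int)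
  show ?thesis
  proof (cases "\<zeta> = 1")
    case False
    then have "(\<Sum>b<q. \<zeta> ^ b) = 0" using geometric_sum[OF False, of q] q by simp
    then show ?thesis using False 1 by (simp add: pow)
  qed (use 1 in \<open>simp add: pow\<close>)
qed

lemma norm_q_param: "norm (q_param z) = exp (- (2 * pi * Im z))"
  by (simp add: q_param_def)

lemma q_param_shift: "q_param (z + of_real x) = q_param z * unit_exp x"
  by (simp add: q_param_def unit_exp_def exp_add cis_conv_exp algebra_simps)

lemma q_param_mult: "q_param (of_nat k * z) = q_param z ^ k"
  by (simp add: q_param_def exp_of_nat_mult[symmetric] mult_ac)

lemma q_param_vert: "q_param (of_real x + \<i> * of_real y) = unit_exp x * of_real (exp (- (2 * pi * y)))"
  by (simp add: q_param_def unit_exp_def exp_add cis_conv_exp algebra_simps exp_diff exp_minus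
      exp_of_real[symmetric])
    (simp add: divide_inverse)

lemma q_param_surj:
  assumes "0 < norm w" "norm w < 1"
  shows "\<exists>z \<in> uhp. q_param z = w"
proof
  let ?z = "Ln w / (2 * of_real pi * \<i>)"
  show e: "q_param ?z = w" using assms by (simp add: q_param_def)
  have "exp (- (2 * pi * Im ?z)) < exp 0" using assms(2) norm_q_param[of ?z] e by simp
  then have "2 * pi * Im ?z > 0" unfolding exp_less_cancel_iff by simp
  then show "?z \<in> uhp" by (simp add: uhp_iff zero_less_mult_iff)
qed

lemma sums_multiples_iff:
  fixes F :: "nat \<Rightarrow> 'a::real_normed_vector"
  assumes "q > 0" "\<And>n. \<not> q dvd n \<Longrightarrow> F n = 0"
  shows "(\<lambda>n. F (q * n)) sums c \<longleftrightarrow> F sums c"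
proof (rule sums_mono_reindex)
  show "strict_mono (\<lambda>n. q * n)" using assms(1) by (simp add: strict_mono_def)
  show "F n = 0" if "n \<notin> range (\<lambda>n. q * n)" for n
    using that assms(2)[of n] by (auto simp: dvd_def)
qed

text \<open>Values of \<open>q_param\<close> are never 0, so the hypothesis covers the punctured
  disc only; \<open>c 0 = 0\<close> supplies the centre.\<close>

lemma power_series_zero:
  fixes c :: "nat \<Rightarrow> complex"
  assumes "\<And>w. 0 < norm w \<Longrightarrow> norm w < 1 \<Longrightarrow> (\<lambda>n. c n * w ^ n) sums 0" and "c 0 = 0"
  shows "c n = 0"
proof -
  define F where "F = Abs_fps c"
  have r: "fps_conv_radius F \<ge> 1"
    unfolding fps_conv_radius_def
  proof (rule conv_radius_geI_ex)
    fix r :: real assume "0 < r" "ereal r < 1"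
    then show "\<exists>z. norm z = r \<and> summable (\<lambda>n. fps_nth F n * z ^ n)"
      using assms(1)[of "of_real r"]
      by (intro exI[of _ "of_real r"]) (auto simp: F_def sums_iff)
  qed
  have "F = 0"
  proof (rule eval_fps_eqD)
    show "fps_conv_radius F > 0" using r by (rule less_le_trans[rotated]) simp
    have "eval_fps F w = 0" if "w \<in> ball 0 1" for w
    proof (cases "w = 0")
      case True then show ?thesis using assms(2) by (simp add: F_def eval_fps_at_0)
    next
      case False then show ?thesis using assms(1)[of w] that by (simp add: eval_fps_def F_def sums_iff)
    qed
    then show "\<forall>\<^sub>F z in nhds 0. eval_fps F z = eval_fps 0 z"
      by (intro eventually_nhds_in_open[of "ball 0 1", THEN eventually_mono]) auto
  qed auto
  then show ?thesis using fps_nth_Abs_fps[of c n] by (simp add: F_def)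
qed

context newform
begin

text \<open>Cauchy's estimate on the circle of radius \<open>exp (- 2 * pi / n)\<close>, which is
  height \<open>1 / n\<close>: there \<open>growth_bound\<close> gives \<open>C * n ^ 2\<close>, and
  the \<open>n\<close>-th power of the inverse radius is the constant
  \<open>exp (2 * pi)\<close>.\<close>

lemma coeff_bound: "\<exists>C\<ge>0. \<forall>n. norm (of_rat (a n) :: complex) \<le> C * real n ^ 2"
proof -
  define F where "F = Abs_fps (\<lambda>n. of_rat (a n) :: complex)"
  have sums: "(\<lambda>n. fps_nth F n * w ^ n) sums f z" if "z \<in> uhp" "q_param z = w" for z w
    using q_expansion[OF that(1)] that(2) by (simp add: F_def)
  have r: "fps_conv_radius F \<ge> 1"
    unfolding fps_conv_radius_def
  proof (rule conv_radius_geI_ex)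
    fix r :: real assume "0 < r" "ereal r < 1"
    then obtain z where "z \<in> uhp" "q_param z = of_real r" using q_param_surj[of "of_real r"] by auto
    then show "\<exists>z. norm z = r \<and> summable (\<lambda>n. fps_nth F n * z ^ n)"
      using sums \<open>0 < r\<close> by (intro exI[of _ "of_real r"]) (auto simp: sums_iff)
  qed
  have ev: "eval_fps F (q_param z) = f z" if "z \<in> uhp" for z
    using sums[OF that refl] by (simp add: eval_fps_def sums_iff)
  obtain C where C: "C \<ge> 0" "\<And>z. 0 < Im z \<Longrightarrow> Im z \<le> 1 \<Longrightarrow> norm (f z) \<le> C / Im z ^ 2"
    using growth_bound by blast
  have "norm (of_rat (a n) :: complex) \<le> C * exp (2 * pi) * real n ^ 2" for n
  proof (cases "n = 0")
    case False
    define \<rho> where "\<rho> = exp (- (2 * pi * (1 / n)))"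
    have \<rho>: "0 < \<rho>" "\<rho> < 1" using False by (auto simp: \<rho>_def)
    have sub: "cball 0 \<rho> \<subseteq> eball (0::complex) (fps_conv_radius F)"
    proof
      fix w :: complex assume "w \<in> cball 0 \<rho>"
      then have "ereal (norm w) < 1" using \<rho> by simp
      then have "ereal (norm w) < fps_conv_radius F" using r by (rule less_le_trans)
      then show "w \<in> eball 0 (fps_conv_radius F)" by (simp add: in_eball_iff)
    qed
    have "norm ((deriv ^^ n) (eval_fps F) 0) \<le> fact n * (C * real n ^ 2) / \<rho> ^ n"
    proof (rule Cauchy_inequality)
      show "eval_fps F holomorphic_on ball 0 \<rho>"
        using sub ball_subset_cball by (intro holomorphic_on_eval_fps) blast
      show "continuous_on (cball 0 \<rho>) (eval_fps F)"
        using sub by (intro holomorphic_on_imp_continuous_on holomorphic_on_eval_fps)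
      show "norm (eval_fps F w) \<le> C * real n ^ 2" if "norm (0 - w) = \<rho>" for w
      proof -
        have "norm w = \<rho>" using that by simp
        then obtain z where z: "z \<in> uhp" "q_param z = w" using q_param_surj[of w] \<rho> by metis
        have "exp (- (2 * pi * Im z)) = exp (- (2 * pi * (1 / n)))"
          using norm_q_param[of z] that z(2) by (simp add: \<rho>_def)
        then have "2 * pi * Im z = 2 * pi * (1 / n)" by simp
        then have "Im z = 1 / n" by (subst (asm) mult_cancel_left) simp
        then have "norm (f z) \<le> C / (1 / n) ^ 2" using C(2)[of z] False by simp
        then show ?thesis using ev[OF z(1)] z(2) by (simp add: power_divide)
      qed
    qed (rule \<rho>(1))
    moreover have "fps_conv_radius F > 0" using r by (rule less_le_trans[rotated]) simp
    then have "of_rat (a n) = (deriv ^^ n) (eval_fps F) 0 / fact n"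
      using fps_nth_conv_deriv[of F n] by (simp add: F_def)
    then have "norm (of_rat (a n) :: complex) = norm ((deriv ^^ n) (eval_fps F) 0) / fact n"
      by (simp add: norm_divide)
    ultimately have "norm (of_rat (a n) :: complex) \<le> fact n * (C * real n ^ 2) / \<rho> ^ n / fact n"
      by (simp only: divide_right_mono fact_ge_zero)
    then have "norm (of_rat (a n) :: complex) \<le> C * real n ^ 2 / \<rho> ^ n"
      by simp
    also have "\<rho> ^ n = exp (- (2 * pi))"
      using False by (simp add: \<rho>_def exp_of_nat_mult[symmetric])
    finally show ?thesis by (simp add: exp_minus field_simps)
  qed (simp add: a_0)
  then show ?thesis using C(1) by (intro exI[of _ "C * exp (2 * pi)"]) auto
qed

lemma vert_sums:
  assumes "y > 0"
  shows "(\<lambda>n. of_rat (a n) * (unit_exp (of_nat n * of_rat r) * of_real (exp (- (2 * pi * real n * y))))) sums vert r y"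
proof -
  have "of_rat r + \<i> * of_real y \<in> uhp" using assms by (simp add: uhp_iff complex_of_rat)
  from q_expansion[OF this] have "(\<lambda>n. of_rat (a n) * q_param (of_real (of_rat r) + \<i> * of_real y) ^ n) sums vert r y"
    by (simp add: vert_def complex_of_rat[of r])
  then show ?thesis
    by (simp add: q_param_vert power_mult_distrib unit_exp_power exp_of_nat_mult[symmetric] mult_ac
        flip: of_real_power)
qed

lemma vert_period: "vert (r + 1) y = vert r y" if "y > 0"
proof (rule sums_unique2[OF vert_sums[OF that]])
  have "unit_exp (of_nat n * of_rat (r + 1)) = unit_exp (of_nat n * of_rat r)" for n
    using unit_exp_int[of "int n"] by (simp add: of_rat_add ring_distribs unit_exp_add)
  then show "(\<lambda>n. of_rat (a n) * (unit_exp (of_nat n * of_rat (r + 1)) * of_real (exp (- (2 * pi * real n * y))))) sums vert r y"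
    using vert_sums[OF that] by simp
qed

text \<open>Rational coefficients are real, so conjugation only inverts the root of unity.\<close>

lemma vert_uminus: "vert (- r) y = cnj (vert r y)" if "y > 0"
proof (rule sums_unique2[OF vert_sums[OF that]])
  have "cnj (of_rat (a n)) = of_rat (a n)" for n
    by (simp add: complex_of_rat)
  then show "(\<lambda>n. of_rat (a n) * (unit_exp (of_nat n * of_rat (- r)) * of_real (exp (- (2 * pi * real n * y))))) sums cnj (vert r y)"
    using sums_cnj[THEN iffD2, OF vert_sums[OF that, of r]] by (simp add: of_rat_minus cnj_unit_exp)
qed

text \<open>The Hecke eigenvalue is the \<open>q\<close>-th coefficient, by comparing coefficients of \<open>q\<^sup>1\<close>.\<close>

lemma hecke_relation:
  assumes q: "prime q" "\<not> q dvd N" and z: "z \<in> uhp"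
  shows "of_rat (a q) * f z = of_nat q * f (of_nat q * z) + (\<Sum>b<q. f ((z + of_nat b) / of_nat q)) / of_nat q"
proof -
  let ?avg = "\<lambda>z. (\<Sum>b<q. f ((z + of_nat b) / of_nat q)) / of_nat q"
  have q0: "q > 0" "q \<noteq> 1" "1 < q" using q prime_gt_1_nat[of q] by auto
  have ev: "hecke_op N q f z = of_nat q * f (of_nat q * z) + ?avg z" for z
  proof -
    have "{d. d dvd q \<and> coprime (q div d) N} = {1, q}"
      using q q0 by (auto simp: prime_nat_iff prime_imp_coprime)
    then show ?thesis using q0
      by (simp add: hecke_op_def algebra_simps power2_eq_square)
  qed
  have "hecke_eigenform N f" using newform by (simp add: rational_newform_def)
  then obtain l where l: "\<And>z. z \<in> uhp \<Longrightarrow> hecke_op N q f z = l * f z"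
    unfolding hecke_eigenform_def using q0 by (meson less_imp_le)
  \<comment> \<open>The \<open>n\<close>-th Fourier coefficient of \<open>l * f\<close> minus that
    of the Hecke image of \<open>f\<close>. As \<open>q\<close> does not divide 1,
    \<open>c 1\<close> is \<open>l - a q\<close>.\<close>
  define c where "c n = l * of_rat (a n) - (if q dvd n then of_nat q * of_rat (a (n div q)) else 0) - of_rat (a (q * n))" for n
  have "c 1 = 0"
  proof (rule power_series_zero)
    fix w :: complex assume "0 < norm w" "norm w < 1"
    then obtain z where z: "z \<in> uhp" "q_param z = w" using q_param_surj by blast
    have s1: "(\<lambda>n. l * of_rat (a n) * w ^ n) sums (l * f z)"
      using sums_mult[OF q_expansion[OF z(1)], of l] z(2) by (simp add: mult.assoc)
    have s2: "(\<lambda>n. (if q dvd n then of_nat q * of_rat (a (n div q)) else 0) * w ^ n) sums (of_nat q * f (of_nat q * z))"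
    proof (subst sums_multiples_iff[OF q0(1), symmetric])
      have "of_nat q * z \<in> uhp" using z q0 by (simp add: uhp_iff)
      from sums_mult[OF q_expansion[OF this], of "of_nat q"]
      show "(\<lambda>n. (if q dvd q * n then of_nat q * of_rat (a (q * n div q)) else 0) * w ^ (q * n)) sums (of_nat q * f (of_nat q * z))"
        using q0 z(2) by (simp add: q_param_mult power_mult mult.assoc)
    qed simp
    \<comment> \<open>Averaging over the \<open>q\<close> translates keeps exactly the exponents
      divisible by \<open>q\<close>.\<close>
    have s3: "(\<lambda>n. of_rat (a (q * n)) * w ^ n) sums (?avg z)"
    proof -
      define u where "u = q_param (z / of_nat q)"
      have uq: "u ^ q = w" using q0 z(2) q_param_mult[of q "z / of_nat q"] by (simp add: u_def)
      have "(\<lambda>n. of_rat (a n) * (u * unit_exp (of_nat b / of_nat q)) ^ n) sums f ((z + of_nat b) / of_nat q)" for b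
      proof -
        have "(z + of_nat b) / of_nat q \<in> uhp" using z q0 by (simp add: uhp_iff)
        moreover have "q_param ((z + of_nat b) / of_nat q) = u * unit_exp (of_nat b / of_nat q)"
          using q_param_shift[of "z / of_nat q" "of_nat b / of_nat q"] by (simp add: u_def add_divide_distrib)
        ultimately show ?thesis using q_expansion by metis
      qed
      then have "(\<lambda>n. (\<Sum>b<q. of_rat (a n) * (u * unit_exp (of_nat b / of_nat q)) ^ n) / of_nat q)
          sums (?avg z)"
        by (intro sums_divide sums_sum)
      moreover have "(\<Sum>b<q. of_rat (a n) * (u * unit_exp (of_nat b / of_nat q)) ^ n) / of_nat q =
         (if q dvd n then of_rat (a n) * u ^ n else 0)" for n
      proof -
        have "(\<Sum>b<q. of_rat (a n) * (u * unit_exp (of_nat b / of_nat q)) ^ n) =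
           of_rat (a n) * u ^ n * (\<Sum>b<q. unit_exp (of_nat b * of_int (int n) / of_nat q))"
          by (simp add: sum_distrib_left power_mult_distrib unit_exp_power mult_ac)
        then show ?thesis unfolding sum_unit_exp[OF q0(1)] using q0 by simp
      qed
      ultimately have "(\<lambda>n. if q dvd n then of_rat (a n) * u ^ n else 0)
          sums (?avg z)" by simp
      then have "(\<lambda>n. if q dvd q * n then of_rat (a (q * n)) * u ^ (q * n) else 0)
          sums (?avg z)"
        by (subst sums_multiples_iff[OF q0(1)]) auto
      then show ?thesis using uq by (simp add: power_mult)
    qed
    have "(\<lambda>n. c n * w ^ n) sums (l * f z - of_nat q * f (of_nat q * z) - ?avg z)"
      using sums_diff[OF sums_diff[OF s1 s2] s3] by (simp add: c_def algebra_simps)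
    moreover have "l * f z - of_nat q * f (of_nat q * z) - ?avg z = 0"
      using ev[of z] l[OF z(1)] by simp
    ultimately show "(\<lambda>n. c n * w ^ n) sums 0" by simp
  qed (simp add: c_def a_0)
  then have "l = of_rat (a q)" using q0 a_1 by (simp add: c_def)
  then show ?thesis using ev[of z] l[OF z] by simp
qed

lemma vert_hecke:
  assumes q: "prime q" "\<not> q dvd N" and y: "y > 0"
  shows "of_rat (a q) * vert r y = of_nat q * vert (of_nat q * r) (real q * y)
     + (\<Sum>b<q. vert ((r + of_nat b) / of_nat q) (1 / real q * y)) / of_nat q"
proof -
  have q0: "q > 0" using q prime_gt_0_nat by blast
  have "of_rat r + \<i> * of_real y \<in> uhp" using y by (simp add: uhp_iff complex_of_rat)
  from hecke_relation[OF q this] show ?thesis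
    by (simp add: vert_def of_rat_mult of_rat_add of_rat_divide field_simps)
qed

lemma vert_rapidly_decaying: "rapidly_decaying (vert r)"
proof -
  have "continuous_on {0<..} (f \<circ> (\<lambda>y. of_rat r + \<i> * of_real y))"
    by (intro continuous_on_compose continuous_intros
        continuous_on_subset[OF holomorphic_on_imp_continuous_on[OF hol]])
      (auto simp: uhp_iff complex_of_rat)
  then have "continuous_on {0<..} (vert r)" by (simp add: vert_def[abs_def] o_def)
  then show ?thesis using vert_decay by (simp add: rapidly_decaying_def)
qed

lemma vert_integrable: "vert r absolutely_integrable_on {0<..}"
proof -
  have "(\<lambda>y. vert r y * of_real y powr (1 - 1)) absolutely_integrable_on {0<..}"
    by (rule mellin_integrable[OF vert_rapidly_decaying])
  then show ?thesis by (subst (asm) set_integrable_cong[OF refl refl, where f' = "vert r"]) auto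
qed

text \<open>\<open>J(r)\<close> of the overview, that is the integral of \<open>f(q) dq/q\<close>
  along the vertical line from infinity down to \<open>r\<close>.\<close>

definition cusp_int :: "rat \<Rightarrow> complex" where
  "cusp_int r = 2 * of_real pi * integral {0<..} (vert r)"

lemma cusp_int_period: "cusp_int (r + 1) = cusp_int r"
proof -
  have "integral {0<..} (vert (r + 1)) = integral {0<..} (vert r)"
    by (rule integral_cong) (simp add: vert_period)
  then show ?thesis by (simp add: cusp_int_def)
qed

lemma cusp_int_uminus: "cusp_int (- r) = cnj (cusp_int r)"
proof -
  have "integral {0<..} (vert (- r)) = integral {0<..} (\<lambda>y. cnj (vert r y))"
    by (rule integral_cong) (simp add: vert_uminus)
  then show ?thesis by (simp add: cusp_int_def integral_cnj)
qed

text \<open>Rescaling \<open>y\<close> cancels the weights \<open>q\<close> and \<open>1 / q\<close>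
  of the Hecke operator and leaves coefficients 1.\<close>

lemma cusp_int_hecke:
  assumes q: "prime q" "\<not> q dvd N"
  shows "of_rat (a q) * cusp_int r = cusp_int (of_nat q * r) + (\<Sum>b<q. cusp_int ((r + of_nat b) / of_nat q))"
proof -
  have q0: "real q > 0" "1 / real q > 0" using q prime_gt_0_nat by auto
  have i1: "(\<lambda>y. vert r' (real q * y)) integrable_on {0<..}"
    "(\<lambda>y. vert r' (1 / real q * y)) integrable_on {0<..}" for r'
    using integrable_scale(1)[OF q0(1) vert_integrable] integrable_scale(1)[OF q0(2) vert_integrable]
    by (simp_all add: set_lebesgue_integral_eq_integral)
  have "of_rat (a q) * integral {0<..} (vert r) = integral {0<..} (\<lambda>y. of_rat (a q) * vert r y)"
    by simp
  also have "\<dots> = integral {0<..} (\<lambda>y. of_nat q * vert (of_nat q * r) (real q * y)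
     + (\<Sum>b<q. vert ((r + of_nat b) / of_nat q) (1 / real q * y)) / of_nat q)"
    by (rule integral_cong) (use vert_hecke[OF q] in simp)
  also have "\<dots> = of_nat q * integral {0<..} (\<lambda>y. vert (of_nat q * r) (real q * y))
     + (\<Sum>b<q. integral {0<..} (\<lambda>y. vert ((r + of_nat b) / of_nat q) (1 / real q * y))) / of_nat q"
    using i1 by (subst integral_add)
      (auto intro!: integrable_on_mult_right integrable_on_divide integrable_sum simp: integral_sum)
  also have "\<dots> = integral {0<..} (vert (of_nat q * r))
     + (\<Sum>b<q. integral {0<..} (vert ((r + of_nat b) / of_nat q)))"
    unfolding integrable_scale(2)[OF q0(1) vert_integrable] integrable_scale(2)[OF q0(2) vert_integrable]
    using q0 by (simp add: sum_divide_distrib)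
  finally have "of_rat (a q) * integral {0<..} (vert r) = \<dots>" .
  then show ?thesis
    by (simp add: cusp_int_def algebra_simps sum_distrib_left)
qed

end

section \<open>Periods\<close>

text \<open>For the matrix with rows (K, -U) and (D, V): the pole is \<open>- V / D\<close> and
  infinity goes to \<open>K / D\<close>, so the vertical line above the pole is mapped to the one
  above \<open>K / D\<close>, with the height inverted.\<close>

lemma horocycle_point:
  fixes D K U V t w :: complex
  assumes "D \<noteq> 0" "t \<noteq> 0" "U * D + V * K = 1" "w = - V / D + \<i> * (t / D ^ 2)"
  shows "(K * w - U) / (D * w + V) = K / D + \<i> * (1 / t)"
proof -
  have den: "D * w + V = \<i> * t / D" unfolding assms(4) using assms(1) by (simp add: field_simps power2_eq_square)
  have "D * (K * w - U) = K * (D * w + V) - (U * D + V * K)" by (simp add: algebra_simps)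
  then have "K * w - U = (K * (\<i> * t / D) - 1) / D" unfolding den assms(3) using assms(1) by (simp add: field_simps)
  then have "(K * w - U) / (D * w + V) = (K * (\<i> * t / D) - 1) / D / (\<i> * t / D)" by (simp only: den)
  also have "\<dots> = K / D - 1 / (\<i> * t)" using assms(1,2) by (simp add: field_simps)
  also have "1 / (\<i> * t) = - (\<i> * (1 / t))" using assms(2) by (simp add: field_simps)
  finally show ?thesis by simp
qed

context newform
begin

text \<open>Determined only up to a constant, which cancels wherever it is used.\<close>

definition prim :: "complex \<Rightarrow> complex" where
  "prim = (SOME P. \<forall>z\<in>uhp. (P has_field_derivative form_dq_q f z) (at z))"

lemma prim_deriv: "z \<in> uhp \<Longrightarrow> (prim has_field_derivative form_dq_q f z) (at z)"
proof -
  have "form_dq_q f holomorphic_on uhp"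
    unfolding form_dq_q_def by (intro holomorphic_intros hol)
  then obtain P where "\<And>z. z \<in> uhp \<Longrightarrow> (P has_field_derivative form_dq_q f z) (at z within uhp)"
    using holomorphic_convex_primitive'[OF convex_uhp open_uhp] by metis
  then have "\<forall>z\<in>uhp. (P has_field_derivative form_dq_q f z) (at z)"
    using open_uhp at_within_open by metis
  then have "\<forall>z\<in>uhp. (prim has_field_derivative form_dq_q f z) (at z)"
    unfolding prim_def by (rule someI[where P = "\<lambda>P. \<forall>z\<in>uhp. (P has_field_derivative form_dq_q f z) (at z)"])
  then show "z \<in> uhp \<Longrightarrow> (prim has_field_derivative form_dq_q f z) (at z)" by blast
qed

lemma prim_moebius_deriv:
  assumes "A \<in> SL2Z" "z \<in> uhp"
  shows "((\<lambda>z. prim (moebius_act A z)) has_field_derivative 2 * of_real pi * \<i> * slash2 f A z) (at z)"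
proof -
  have "((\<lambda>z. prim (moebius_act A z)) has_field_derivative
      form_dq_q f (moebius_act A z) * (1 / autfactor A z ^ 2)) (at z)"
    by (rule DERIV_chain2[OF prim_deriv[OF moebius_uhp[OF assms]] moebius_has_field_derivative[OF assms]])
  then show ?thesis by (simp add: form_dq_q_def slash2_autfactor)
qed

text \<open>The two points come from a horizontal segment of fixed length at height
  \<open>t\<close>, along which \<open>slash2 f A\<close> tends to 0.\<close>

lemma prim_cusp_shift:
  assumes "A \<in> SL2Z"
  shows "((\<lambda>t. prim (moebius_act A (of_real x + \<i> * of_real t)) - prim (moebius_act A (\<i> * of_real t))) \<longlongrightarrow> 0) at_top"
proof (rule tendstoI)
  let ?d = "\<lambda>t. prim (moebius_act A (of_real x + \<i> * of_real t)) - prim (moebius_act A (\<i> * of_real t))"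
  fix e :: real assume e: "e > 0"
  define \<eta> where "\<eta> = e / (2 * (2 * pi * (\<bar>x\<bar> + 1)))"
  have \<eta>: "\<eta> > 0" using e by (simp add: \<eta>_def)
  obtain Y where Y: "\<And>z. Im z \<ge> Y \<Longrightarrow> norm (slash2 f A z) < \<eta>"
    using at_i_infinity_D[OF slash2_lim[OF assms] \<eta>] by blast
  have "dist (?d t) 0 < e"
    if t: "t \<ge> max Y 1" for t
  proof -
    define S where "S = {z. Im z = t}"
    have S: "S \<subseteq> uhp" using t by (auto simp: S_def uhp_iff)
    have cv: "convex S" using convex_hyperplane[of \<i> t] by (simp add: S_def inner_complex_def)
    have "norm (?d t)
       \<le> 2 * pi * \<eta> * norm ((of_real x + \<i> * of_real t) - \<i> * of_real t)"
    proof (rule field_differentiable_bound[OF cv, where f' = "\<lambda>z. 2 * of_real pi * \<i> * slash2 f A z"])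
      show "((\<lambda>z. prim (moebius_act A z)) has_field_derivative 2 * of_real pi * \<i> * slash2 f A z) (at z within S)"
        if "z \<in> S" for z
        using prim_moebius_deriv[OF assms, of z] that S has_field_derivative_at_within by blast
      show "norm (2 * of_real pi * \<i> * slash2 f A z) \<le> 2 * pi * \<eta>" if "z \<in> S" for z
        using Y[of z] that t by (simp add: norm_mult S_def less_imp_le)
    qed (auto simp: S_def)
    also have "\<dots> = 2 * pi * \<eta> * \<bar>x\<bar>" by simp
    also have "\<dots> \<le> 2 * pi * \<eta> * (\<bar>x\<bar> + 1)" using \<eta> by (intro mult_left_mono) auto
    also have "\<dots> = e / 2" by (simp add: \<eta>_def field_simps add_nonneg_eq_0_iff)
    finally show ?thesis using e by simp
  qed
  then show "\<forall>\<^sub>F t in at_top. dist (?d t) 0 < e"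
    by (rule eventually_at_top_linorderI)
qed

lemma integral_vert:
  assumes "0 < s" "s \<le> t"
  shows "2 * of_real pi * integral {s..t} (vert r) =
     prim (of_rat r + \<i> * of_real s) - prim (of_rat r + \<i> * of_real t)"
proof -
  let ?P = "\<lambda>y. prim (of_rat r + \<i> * of_real y)"
  have "((\<lambda>y. - (2 * of_real pi) * vert r y) has_integral
      (?P t - ?P s)) {s..t}"
  proof (rule fundamental_theorem_of_calculus[OF assms(2)])
    fix y assume y: "y \<in> {s..t}"
    have "of_rat r + \<i> * of_real y \<in> uhp" using y assms by (simp add: uhp_iff complex_of_rat)
    from prim_deriv[OF this]
    have "((prim \<circ> (\<lambda>y. of_rat r + \<i> * of_real y)) has_vector_derivative
        (\<i> * form_dq_q f (of_rat r + \<i> * of_real y))) (at y within {s..t})"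
      by (intro field_vector_diff_chain_within)
        (auto intro!: derivative_eq_intros has_field_derivative_at_within simp: has_vector_derivative_def scaleR_conv_of_real mult.commute)
    moreover have "\<i> * form_dq_q f (of_rat r + \<i> * of_real y) = (\<i> * \<i>) * (2 * of_real pi * vert r y)"
      unfolding form_dq_q_def vert_def by (simp only: mult_ac)
    then have "\<i> * form_dq_q f (of_rat r + \<i> * of_real y) = - (2 * of_real pi) * vert r y" by simp
    ultimately show "((\<lambda>y. ?P y) has_vector_derivative - (2 * of_real pi) * vert r y) (at y within {s..t})"
      by (simp only: o_def)
  qed
  then have "integral {s..t} (\<lambda>y. - (2 * of_real pi) * vert r y) =
      ?P t - ?P s"
    by (rule integral_unique)
  then have "- (2 * of_real pi) * integral {s..t} (vert r) =
      ?P t - ?P s"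
    by (simp only: integral_mult_right)
  then show ?thesis by (simp add: algebra_simps)
qed

lemma cusp_int_limit:
  "((\<lambda>t. prim (of_rat r + \<i> * of_real (1 / t)) - prim (of_rat r + \<i> * of_real t)) \<longlongrightarrow> cusp_int r) at_top"
proof -
  let ?P = "\<lambda>y. prim (of_rat r + \<i> * of_real y)"
  obtain C where C: "C \<ge> 0" "\<And>y. y > 0 \<Longrightarrow> norm (vert r y) \<le> C" "\<And>y. y > 0 \<Longrightarrow> norm (vert r y) * y ^ 2 \<le> C"
  proof -
    obtain C0 C2 where "C0 \<ge> 0" "C2 \<ge> 0" "\<And>y. y > 0 \<Longrightarrow> norm (vert r y) * y ^ 0 \<le> C0"
      "\<And>y. y > 0 \<Longrightarrow> norm (vert r y) * y ^ 2 \<le> C2"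
      using vert_decay[of r 0] vert_decay[of r 2] by blast
    then show ?thesis by (intro that[of "C0 + C2"]) fastforce+
  qed
  have cont: "continuous_on {0<..} (vert r)"
    using vert_rapidly_decaying[of r] by (simp add: rapidly_decaying_def)
  have b: "norm (?P (1 / t) - ?P t - cusp_int r)
      \<le> 2 * pi * (2 * C) / t" if t: "t \<ge> 1" for t
  proof -
    have "1 / t \<le> 1" using t by simp
    then have "1 / t \<le> t" "0 < 1 / t" using t order_trans by (blast, simp)
    from integral_vert[OF this(2,1), of r]
    have "?P (1 / t) - ?P t - cusp_int r =
       - (2 * of_real pi * (integral {0<..} (vert r) - integral {1/t..t} (vert r)))"
      by (simp add: cusp_int_def algebra_simps)
    also have "norm \<dots> = 2 * pi * norm (integral {0<..} (vert r) - integral {1/t..t} (vert r))"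
      by (simp only: norm_minus_cancel norm_mult) simp
    also have "\<dots> \<le> 2 * pi * (2 * C / t)"
      using half_line_integral_bounds(2)[OF cont C(2,3) t] by (intro mult_left_mono) auto
    finally show ?thesis by simp
  qed
  have "((\<lambda>t. 2 * pi * (2 * C) / t) \<longlongrightarrow> 0) at_top"
    by real_asymp
  then have "((\<lambda>t. ?P (1 / t) - ?P t - cusp_int r) \<longlongrightarrow> 0) at_top"
    by (rule Lim_null_comparison[rotated]) (use b in \<open>auto intro!: eventually_at_top_linorderI[of 1]\<close>)
  then show ?thesis by (rule LIM_zero_cancel)
qed

text \<open>The integrand is at most a constant over \<open>t ^ 2\<close> on a segment of length
  proportional to \<open>t\<close>. This reconciles cutoffs that differ by a constant
  factor.\<close>

lemma prim_tail:
  assumes "c \<ge> 1"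
  shows "((\<lambda>t. prim (\<i> * of_real t) - prim (\<i> * of_real (t * c))) \<longlongrightarrow> 0) at_top"
proof -
  obtain C where C: "C \<ge> 0" "\<And>y. y > 0 \<Longrightarrow> norm (vert 0 y) * y ^ 2 \<le> C"
    using vert_decay[of 0 2] by blast
  have b: "norm (prim (\<i> * of_real t) - prim (\<i> * of_real (t * c))) \<le> 2 * pi * (C * (c - 1) / t)" if t: "t > 0" for t
  proof -
    have le: "t \<le> t * c" using assms t by simp
    have "continuous_on {t..t * c} (vert 0)"
      using vert_rapidly_decaying[of 0] t unfolding rapidly_decaying_def
      by (auto intro: continuous_on_subset)
    moreover have "norm (vert 0 y) \<le> C / t ^ 2" if "y \<in> {t..t * c}" for y
    proof -
      have "norm (vert 0 y) * t ^ 2 \<le> norm (vert 0 y) * y ^ 2"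
        using that t by (intro mult_left_mono power_mono) auto
      also have "\<dots> \<le> C" using that t by (intro C(2)) auto
      finally show ?thesis using t by (simp add: field_simps)
    qed
    ultimately have "norm (integral {t..t * c} (vert 0)) \<le> C / t ^ 2 * (t * c - t)"
      by (intro integral_bound le)
    also have "\<dots> = C * (c - 1) / t" using t by (simp add: field_simps power2_eq_square)
    finally have "2 * pi * norm (integral {t..t * c} (vert 0)) \<le> 2 * pi * (C * (c - 1) / t)"
      by (intro mult_left_mono) auto
    moreover have "prim (\<i> * of_real t) - prim (\<i> * of_real (t * c)) = 2 * of_real pi * integral {t..t * c} (vert 0)"
      using integral_vert[OF t le, of 0] by simp
    ultimately show ?thesis by (simp only: norm_mult) simp
  qed
  have "((\<lambda>t. 2 * pi * (C * (c - 1) / t)) \<longlongrightarrow> 0) at_top" by real_asymp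
  then show ?thesis
    by (rule Lim_null_comparison[rotated]) (use b in \<open>auto intro!: eventually_at_top_linorderI[of 1]\<close>)
qed

text \<open>The path from \<open>0\<close> to \<open>k/D\<close> is closed on \<open>X\<^sub>0(N)\<close>, since the matrix \<open>B\<close> of
  \<open>\<Gamma>\<^sub>0(N)\<close> carries \<open>0\<close> to \<open>k/D\<close>.\<close>

lemma cusp_int_diff_period:
  assumes "coprime D N" "D > 0"
  shows "cusp_int (of_int k / of_nat D) - cusp_int 0 \<in> period_lattice N f"
proof -
  define r where "r = (of_int k / of_nat D :: rat)"
  obtain k' D' :: int where r: "r = of_int k' / of_int D'" "D' > 0" "coprime k' D'"
    by (metis quotient_of_div quotient_of_denom_pos quotient_of_coprime surj_pair)
  have "of_int (k' * int D) = (of_int (k * D') :: rat)"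
    using r(1,2) assms(2) unfolding r_def by (simp add: field_simps)
  then have "k' * int D = k * D'" by (simp only: of_int_eq_iff)
  then have "D' dvd int D" using r(3) by (metis coprime_commute coprime_dvd_mult_right_iff dvd_triv_right)
  then have "coprime D' (int N)" using assms(1) by (metis coprime_divisors coprime_int_iff dvd_refl)
  then have "coprime D' (k' * int N)" using r(3) by (simp add: coprime_commute)
  \<comment> \<open>Bezout is applied to \<open>k' * int N\<close> instead of \<open>k'\<close>, so
    that the lower left entry of \<open>B\<close> becomes a multiple of \<open>N\<close>.\<close>
  then obtain u v where uv: "u * D' + v * (k' * int N) = 1"
    using bezout_int[of D' "k' * int N"] by auto
  define B where "B = mat2 u k' (- v * int N) D'"
  have B: "B \<in> SL2Z" unfolding B_def by (rule mat2_SL2Z) (use uv in \<open>simp add: algebra_simps\<close>)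
  then have BG: "B \<in> Gamma0 N" by (simp add: Gamma0_def B_def)
  define per where "per = prim (moebius_act B \<i>) - prim \<i>"
  have const: "prim (moebius_act B z) - prim z = per" if z: "z \<in> uhp" for z
  proof -
    have "((\<lambda>z. prim (moebius_act B z) - prim z) has_field_derivative 0) (at z within uhp)" if "z \<in> uhp" for z
    proof -
      have "((\<lambda>z. prim (moebius_act B z) - prim z) has_field_derivative
          (2 * of_real pi * \<i> * slash2 f B z - form_dq_q f z)) (at z)"
        by (intro DERIV_diff prim_moebius_deriv prim_deriv B that)
      then show ?thesis using slash2_Gamma0[OF BG that]
        by (simp add: form_dq_q_def has_field_derivative_at_within)
    qed
    from has_field_derivative_zero_constant[OF convex_uhp this]
    obtain c where "\<And>z. z \<in> uhp \<Longrightarrow> prim (moebius_act B z) - prim z = c" by blast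
    moreover have "\<i> \<in> uhp" by (simp add: uhp_iff)
    ultimately show ?thesis using z by (simp add: per_def)
  qed
  have "per \<in> period_lattice N f"
  proof -
    define p where "p = linepath \<i> (moebius_act B \<i>)"
    have i: "\<i> \<in> uhp" by (simp add: uhp_iff)
    have im: "path_image p \<subseteq> uhp"
      unfolding p_def path_image_linepath
      by (intro closed_segment_subset convex_uhp moebius_uhp B i)
    have "(form_dq_q f has_contour_integral (prim (pathfinish p) - prim (pathstart p))) p"
      by (rule contour_integral_primitive[where S = uhp])
        (use im prim_deriv in \<open>auto simp: p_def intro: has_field_derivative_at_within\<close>)
    then have "contour_integral p (form_dq_q f) = per"
      by (simp add: p_def per_def contour_integral_unique)
    moreover have "X0_closed_path N p"
      unfolding X0_closed_path_def using im BG by (auto simp: p_def)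
    ultimately show ?thesis
      unfolding period_lattice_def
      by (intro CollectI exI[of _ "1::nat"] exI[of _ "\<lambda>_. 1::int"] exI[of _ "\<lambda>_. p"]) simp
  qed
  moreover have "cusp_int r - cusp_int 0 = per"
  proof -
    \<comment> \<open>\<open>S\<close> exchanges 0 and infinity, so \<open>B ** S\<close> sends
      infinity to \<open>r\<close>, and the approach to \<open>r\<close> turns into an approach to
      infinity, where \<open>prim_cusp_shift\<close> applies. The heights then differ by the factor
      \<open>D' ^ 2\<close>.\<close>
    define S where "S = mat2 0 (-1) 1 0"
    have S: "S \<in> SL2Z" unfolding S_def by (rule mat2_SL2Z) simp
    define x where "x = real_of_int (- v * int N) / of_int D'"
    have Sz: "moebius_act S (\<i> * of_real t) = \<i> * of_real (1 / t)" if "t > 0" for t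
      using that by (simp add: moebius_act_def S_def field_simps)
    have BSz: "moebius_act (B ** S) (of_real x + \<i> * of_real (t / of_int D' ^ 2)) = of_rat r + \<i> * of_real (1 / t)" if "t > 0" for t
    proof -
      have "complex_of_int u * of_int D' + of_int (v * int N) * of_int k' = of_int (u * D' + v * (k' * int N))"
        by (simp add: mult_ac)
      then have "complex_of_int u * of_int D' + of_int (v * int N) * of_int k' = 1" by (simp only: uv of_int_1)
      then have "(of_int k' * w - of_int u) / (of_int D' * w + of_int (v * int N)) = of_int k' / of_int D' + \<i> * (1 / of_real t)"
        if "w = - of_int (v * int N) / of_int D' + \<i> * (of_real t / of_int D' ^ 2)" for w :: complex
        using that \<open>t > 0\<close> r(2) by (intro horocycle_point) auto
      moreover have "moebius_act (B ** S) w = (of_int k' * w - of_int u) / (of_int D' * w + of_int (v * int N))" for w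
        by (simp add: moebius_act_def mat2_mult_nth B_def S_def)
      ultimately show ?thesis by (simp add: x_def r(1) of_rat_divide)
    qed
    let ?c = "of_int D' ^ 2"
    let ?P = "\<lambda>y. prim (of_rat r + \<i> * of_real y)"
    let ?Q = "\<lambda>y. prim (\<i> * of_real y)"
    let ?R = "\<lambda>y. prim (moebius_act (B ** S) (\<i> * of_real y))"
    have top: "filterlim (\<lambda>t. t / of_int D' ^ 2) at_top (at_top :: real filter)"
      using r(2) by real_asymp
    have 1: "((\<lambda>t. ?P (1 / t) - ?R (t / ?c)) \<longlongrightarrow> 0) at_top"
    proof (rule Lim_transform_eventually[OF filterlim_compose[OF prim_cusp_shift[OF SL2Z_mult[OF B S], of x] top]])
      show "\<forall>\<^sub>F t in at_top. prim (moebius_act (B ** S) (of_real x + \<i> * of_real (t / of_int D' ^ 2))) - ?R (t / ?c)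
         = ?P (1 / t) - ?R (t / ?c)"
        using eventually_gt_at_top[of 0] by eventually_elim (simp only: BSz)
    qed
    have 2: "((\<lambda>t. ?P t - ?Q t) \<longlongrightarrow> 0) at_top"
      using prim_cusp_shift[OF mat_1_SL2Z, of "of_rat r"] by (simp add: moebius_id complex_of_rat[of r])
    have 3: "((\<lambda>t. ?Q (1 / (t / ?c)) - ?Q (t / ?c)) \<longlongrightarrow> cusp_int 0) at_top"
      using filterlim_compose[OF cusp_int_limit[of 0] top] by simp
    have 4: "((\<lambda>t. ?Q (t / ?c) - ?Q t) \<longlongrightarrow> 0) at_top"
    proof -
      have "1 \<le> real_of_int D' ^ 2" using r(2) by simp
      from filterlim_compose[OF prim_tail[OF this] top] show ?thesis using r(2) by simp
    qed
    \<comment> \<open>A telescoping sum: with \<open>\<tau> = t / D' ^ 2\<close>, invariance of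
      \<open>prim\<close> up to \<open>per\<close> is applied at \<open>\<i> / \<tau>\<close>, which
      gives \<open>per = ?R \<tau> - ?Q (1 / \<tau>)\<close>.\<close>
    have "((\<lambda>t. (?P (1 / t) - ?R (t / ?c))
        + per + (?Q (1 / (t / ?c)) - ?Q (t / ?c))
        + (?Q (t / ?c) - ?Q t)
        - (?P t - ?Q t)) \<longlongrightarrow> 0 + per + cusp_int 0 + 0 - 0) at_top"
      by (intro tendsto_intros 1 2 3 4)
    then have "((\<lambda>t. ?P (1 / t) - ?P t) \<longlongrightarrow> 0 + per + cusp_int 0 + 0 - 0) at_top"
    proof (rule Lim_transform_eventually)
      show "\<forall>\<^sub>F t in at_top. (?P (1 / t) - ?R (t / ?c))
        + per + (?Q (1 / (t / ?c)) - ?Q (t / ?c))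
        + (?Q (t / ?c) - ?Q t)
        - (?P t - ?Q t)
        = ?P (1 / t) - ?P t"
        using eventually_gt_at_top[of 0]
      proof eventually_elim
        case (elim t)
        define \<tau> where "\<tau> = t / of_int D' ^ 2"
        have \<tau>: "\<tau> > 0" using elim r(2) by (simp add: \<tau>_def)
        then have u: "\<i> * of_real \<tau> \<in> uhp" by (simp add: uhp_iff)
        have "per = ?R \<tau> - ?Q (1 / \<tau>)"
          using const[OF moebius_uhp[OF S u]] unfolding moebius_mult[OF B S u] Sz[OF \<tau>] by simp
        then show ?case unfolding \<tau>_def[symmetric] by simp
      qed
    qed
    then have "cusp_int r = 0 + per + cusp_int 0 + 0 - 0"
      by (rule tendsto_unique[OF _ cusp_int_limit, rotated]) simp
    then show ?thesis by simp
  qed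
  ultimately show ?thesis by (simp add: r_def)
qed

end

section \<open>Gauss sums and special values\<close>

text \<open>If every nonzero residue were a square, squaring would be surjective and hence injective
  on the nonzero residues, but -1 and 1 have the same square.\<close>

lemma exists_nonresidue:
  fixes p :: nat
  assumes "prime p" "odd p"
  shows "\<exists>g::int. Legendre g p = -1"
proof (rule ccontr)
  assume no: "\<nexists>g::int. Legendre g p = -1"
  have p: "p > 2" using assms prime_ge_2_nat[of p] by (cases "p = 2") auto
  define S where "S = {1..<int p}"
  define sq where "sq x = (x ^ 2) mod int p" for x
  have pr: "prime (int p)" using assms by simp
  have nd: "\<not> int p dvd x" if "x \<in> S" for x
    using that zdvd_not_zless[of x "int p"] by (auto simp: S_def)
  have sqS: "sq x \<in> S" if "x \<in> S" for x
  proof -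
    have "\<not> int p dvd x ^ 2" using nd[OF that] pr prime_dvd_power_int by blast
    then have "x ^ 2 mod int p \<noteq> 0" by (simp add: dvd_eq_mod_eq_0)
    moreover have "0 \<le> x ^ 2 mod int p" "x ^ 2 mod int p < int p" using p by simp_all
    ultimately show ?thesis unfolding S_def sq_def by simp
  qed
  have "S \<subseteq> sq ` S"
  proof
    fix g assume g: "g \<in> S"
    then have "Legendre g p \<noteq> 0" using nd by (simp add: Legendre_eq_0_iff)
    then have "Legendre g p = 1" using no Legendre_range[of g p] by auto
    then obtain y where y: "[y ^ 2 = g] (mod int p)"
      by (auto simp: Legendre_def QuadRes_def split: if_splits)
    define x where "x = y mod int p"
    have "sq x = g mod int p" using y by (simp add: sq_def x_def cong_def power_mod)
    then have sx: "sq x = g" using g by (simp add: S_def)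
    have "x \<noteq> 0" using sx g by (auto simp: sq_def S_def)
    moreover have "0 \<le> x" "x < int p" using p by (simp_all add: x_def)
    ultimately have "x \<in> S" by (simp add: S_def)
    then show "g \<in> sq ` S" using sx by blast
  qed
  then have "sq ` S = S" using sqS by auto
  then have "inj_on sq S" by (intro eq_card_imp_inj_on) (auto simp: S_def)
  moreover have "sq (int p - 1) = sq 1"
  proof -
    have "(int p - 1) ^ 2 - 1 ^ 2 = int p * (int p - 2)" by (simp add: power2_eq_square algebra_simps)
    then show ?thesis unfolding sq_def by (metis dvd_triv_left mod_eq_dvd_iff)
  qed
  moreover have "int p - 1 \<in> S" "1 \<in> S" using p by (auto simp: S_def)
  ultimately have "int p - 1 = 1" by (metis inj_onD)
  then show False using p by simp
qed

text \<open>Primitivity is stated in the form in which Gauss sums use it. For \<open>x\<close> with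
  gcd \<open>g\<close> with \<open>D\<close>, the units fixing \<open>x\<close> are those congruent
  to 1 modulo \<open>D div g\<close>, and a character of conductor \<open>D\<close> is nontrivial on
  them.\<close>

locale real_primitive_character =
  fixes D :: nat and ch :: "int \<Rightarrow> int"
  assumes D_pos: "D > 0"
    and mult: "ch (x * y) = ch x * ch y"
    and cong: "[x = y] (mod int D) \<Longrightarrow> ch x = ch y"
    and range: "ch x \<in> {-1, 0, 1}"
    and nonzero_iff: "ch x \<noteq> 0 \<longleftrightarrow> coprime x (int D)"
    and primitive: "\<not> coprime x (int D) \<Longrightarrow> \<exists>u. ch u = -1 \<and> [u * x = x] (mod int D)"
begin

definition gauss_sum :: "int \<Rightarrow> complex" where
  "gauss_sum n = (\<Sum>k\<in>{0..<int D}. of_int (ch k) * unit_exp (of_int (k * n) / of_nat D))"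

lemma unit_exp_cong:
  assumes "[x = y] (mod int D)"
  shows "unit_exp (of_int x / of_nat D) = unit_exp (of_int y / of_nat D)"
proof -
  obtain k where "x = y + int D * k" using assms by (metis cong_iff_lin cong_sym)
  then have "real_of_int x / real D = of_int y / real D + of_int k"
    using D_pos by (simp add: field_simps)
  then show ?thesis by (simp add: unit_exp_add unit_exp_int)
qed

lemma gauss_sum_cong: "[x = y] (mod int D) \<Longrightarrow> gauss_sum x = gauss_sum y"
  unfolding gauss_sum_def
  by (intro sum.cong refl arg_cong2[of _ _ _ _ "(*)"] unit_exp_cong cong_mult cong_refl)

lemma ch_1: "ch 1 = 1"
  using mult[of 1 1] nonzero_iff[of 1] by simp

lemma gauss_sum_unit:
  assumes "coprime u (int D)"
  shows "gauss_sum n = of_int (ch u) * gauss_sum (u * n)"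
proof -
  define F where "F k = of_int (ch k) * unit_exp (of_int (k * n) / of_nat D)" for k
  have "(\<Sum>k\<in>{0..<int D}. F (u * k)) = (\<Sum>k\<in>{0..<int D}. F k)"
  proof (rule sum_residues_cong)
    show "F x = F y" if "[x = y] (mod int D)" for x y
      unfolding F_def using cong[OF that] unit_exp_cong[OF cong_mult[OF that cong_refl[of n]]] by simp
  qed (use D_pos inj_on_mult_mod[OF assms] in auto)
  then show ?thesis
    by (simp add: gauss_sum_def F_def mult sum_distrib_left mult_ac)
qed

text \<open>For \<open>n\<close> prime to \<open>D\<close> this is a change of variable. Otherwise
  the unit \<open>u\<close> fixes \<open>n\<close> and has \<open>ch u = -1\<close>, so the Gauss
  sum is its own negative.\<close>

lemma gauss_sum_separable: "gauss_sum n = of_int (ch n) * gauss_sum 1"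
proof (cases "coprime n (int D)")
  case True
  then have "ch n \<in> {-1, 1}" using range[of n] nonzero_iff[of n] by auto
  then have "ch n * ch n = 1" by auto
  moreover have "gauss_sum 1 = of_int (ch n) * gauss_sum n" using gauss_sum_unit[OF True, of 1] by simp
  ultimately show ?thesis by (metis mult.assoc mult_1 of_int_1 of_int_mult)
next
  case False
  then obtain u where u: "ch u = -1" "[u * n = n] (mod int D)" using primitive by blast
  then have "coprime u (int D)" using nonzero_iff[of u] by simp
  then have "gauss_sum n = - gauss_sum n"
    using gauss_sum_unit[of u n] gauss_sum_cong[OF u(2)] u(1) by simp
  moreover have "ch n = 0" using False nonzero_iff by blast
  ultimately show ?thesis by simp
qed

lemma sum_unit_exp_residues:
  "(\<Sum>n\<in>{0..<int D}. unit_exp (of_int (k * n) / of_nat D)) = (if int D dvd k then of_nat D else 0)"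
proof -
  have "(\<Sum>n\<in>{0..<int D}. unit_exp (of_int (k * n) / of_nat D)) = (\<Sum>b<D. unit_exp (of_nat b * of_int k / of_nat D))"
    by (rule sum.reindex_bij_witness[where i = int and j = nat]) (auto simp: mult_ac)
  then show ?thesis using sum_unit_exp[OF D_pos, of k] by simp
qed

text \<open>Parseval for the finite Fourier transform of the character.\<close>

lemma gauss_sum_square: "gauss_sum 1 ^ 2 = of_int (ch (-1)) * of_nat D"
proof -
  let ?I = "{0..<int D}"
  \<comment> \<open>The number of units modulo \<open>D\<close>; it appears on both sides and is
    cancelled at the end, hence the proof that it is nonzero.\<close>
  define \<phi> where "\<phi> = (\<Sum>k\<in>?I. (of_int (ch k) :: complex) ^ 2)"
  have ph: "\<phi> \<noteq> 0"
  proof -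
    define \<psi> where "\<psi> = (\<Sum>k\<in>?I. ch k ^ 2)"
    have "ch (1 mod int D) ^ 2 \<le> \<psi>"
      unfolding \<psi>_def by (rule member_le_sum) (use D_pos in auto)
    moreover have "ch (1 mod int D) = 1" using cong[of "1 mod int D" 1] ch_1 by simp
    ultimately have "\<psi> \<noteq> 0" by simp
    moreover have "\<phi> = of_int \<psi>" by (simp add: \<phi>_def \<psi>_def)
    ultimately show ?thesis by simp
  qed
  have "(\<Sum>n\<in>?I. gauss_sum n * gauss_sum (- n)) = of_nat D * \<phi>"
  proof -
    have "(\<Sum>n\<in>?I. gauss_sum n * gauss_sum (- n)) =
       (\<Sum>n\<in>?I. \<Sum>k\<in>?I. \<Sum>l\<in>?I. of_int (ch k * ch l) * unit_exp (of_int ((k - l) * n) / of_nat D))"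
      unfolding gauss_sum_def sum_product
      by (intro sum.cong refl)
        (simp add: unit_exp_add[symmetric] mult_ac algebra_simps diff_divide_distrib add_divide_distrib)
    also have "\<dots> = (\<Sum>k\<in>?I. \<Sum>l\<in>?I. \<Sum>n\<in>?I. of_int (ch k * ch l) * unit_exp (of_int ((k - l) * n) / of_nat D))"
      by (rule trans[OF sum.swap]) (intro sum.cong refl sum.swap)
    also have "\<dots> = (\<Sum>k\<in>?I. \<Sum>l\<in>?I. of_int (ch k * ch l) * (if int D dvd k - l then of_nat D else 0))"
      by (simp only: sum_distrib_left[symmetric] sum_unit_exp_residues)
    also have "\<dots> = (\<Sum>k\<in>?I. \<Sum>l\<in>?I. if l = k then of_nat D * of_int (ch k) ^ 2 else 0)"
    proof (intro sum.cong refl)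
      fix k l assume "k \<in> ?I" "l \<in> ?I"
      then have "int D dvd k - l \<longleftrightarrow> l = k"
        using mod_eq_dvd_iff[of k "int D" l] by auto
      then show "of_int (ch k * ch l) * (if int D dvd k - l then of_nat D else 0) =
          (if l = k then of_nat D * of_int (ch k) ^ 2 else (0::complex))"
        by (simp add: power2_eq_square)
    qed
    also have "\<dots> = of_nat D * \<phi>" by (simp add: \<phi>_def sum_distrib_left sum.delta)
    finally show ?thesis .
  qed
  moreover have "(\<Sum>n\<in>?I. gauss_sum n * gauss_sum (- n)) = of_int (ch (-1)) * gauss_sum 1 ^ 2 * \<phi>"
  proof -
    have "gauss_sum n * gauss_sum (- n) = of_int (ch (-1)) * gauss_sum 1 ^ 2 * of_int (ch n) ^ 2" for n
      unfolding gauss_sum_separable[of n] gauss_sum_separable[of "- n"]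
      using mult[of "-1" n] by (simp add: power2_eq_square)
    then show ?thesis by (simp add: \<phi>_def sum_distrib_left)
  qed
  ultimately have "of_int (ch (-1)) * gauss_sum 1 ^ 2 = of_nat D" using ph by simp
  moreover have "ch (-1) * ch (-1) = 1" using mult[of "-1" "-1"] ch_1 by simp
  then have "of_int (ch (-1)) * of_int (ch (-1)) = (1::complex)" by (metis of_int_1 of_int_mult)
  ultimately show ?thesis by (metis mult.assoc mult_1)
qed

lemma gauss_sum_nonzero: "gauss_sum 1 \<noteq> 0"
proof
  assume "gauss_sum 1 = 0"
  then have "of_int (ch (-1)) * (of_nat D :: complex) = 0" using gauss_sum_square by simp
  then have "ch (-1) = 0" using D_pos by simp
  then show False using mult[of "-1" "-1"] ch_1 by simp
qed

text \<open>The sum is the Gauss sum at 0, and \<open>ch 0 = 0\<close>. It removes additive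
  constants such as \<open>J(0)\<close> from primitive character sums.\<close>

lemma sum_ch_0: "D > 1 \<Longrightarrow> (\<Sum>k\<in>{0..<int D}. ch k) = 0"
proof -
  assume D: "D > 1"
  have "ch 0 = 0" using nonzero_iff[of 0] D by auto
  then have "gauss_sum 0 = 0" using gauss_sum_separable[of 0] by simp
  then have "complex_of_int (\<Sum>k\<in>{0..<int D}. ch k) = 0"
    using unit_exp_int[of 0] by (simp add: gauss_sum_def)
  then show ?thesis by (simp only: of_int_eq_0_iff)
qed

end

lemma ind_char_primitive:
  assumes "finite Q" "\<And>p. p \<in> Q \<Longrightarrow> prime p \<and> odd p"
  shows "real_primitive_character (4 * \<Prod>Q) (ind_char True Q Q)"
proof
  define D where "D = 4 * \<Prod>Q"
  have pos: "\<Prod>Q > 0" using assms by (auto simp: prod_pos prime_gt_0_nat)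
  then show "4 * \<Prod>Q > 0" by simp
  show "ind_char True Q Q (x * y) = ind_char True Q Q x * ind_char True Q Q y" for x y
    using ind_char_mult[OF assms(2)] by blast
  show "ind_char True Q Q x = ind_char True Q Q y" if "[x = y] (mod int (4 * \<Prod>Q))" for x y
    by (rule ind_char_cong[OF that assms(1)]) simp
  show "ind_char True Q Q x \<in> {-1, 0, 1}" for x by (rule ind_char_range)
  have cop: "coprime x (int (4 * \<Prod>Q)) \<longleftrightarrow> odd x \<and> (\<forall>p\<in>Q. \<not> int p dvd x)" for x
  proof -
    have "coprime x (int (\<Prod>Q)) \<longleftrightarrow> (\<forall>p\<in>Q. coprime x (int p))"
      using assms(1) by (induction Q rule: finite_induct) (auto simp: coprime_mult_right_iff)
    then have "coprime x (int (4 * \<Prod>Q)) \<longleftrightarrow> coprime x (2 ^ 2) \<and> (\<forall>p\<in>Q. coprime x (int p))"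
      by (simp add: coprime_mult_right_iff del: of_nat_prod)
    moreover have "coprime x (int p) \<longleftrightarrow> \<not> int p dvd x" if "p \<in> Q" for p
    proof -
      have "prime (int p)" using assms(2)[OF that] by simp
      then show ?thesis by (metis coprime_commute prime_imp_coprime_int coprime_absorb_left not_prime_unit)
    qed
    moreover have "coprime x (2 ^ 2) \<longleftrightarrow> odd x" by (simp only: coprime_power_right_iff) simp
    ultimately show ?thesis by blast
  qed
  show "ind_char True Q Q x \<noteq> 0 \<longleftrightarrow> coprime x (int (4 * \<Prod>Q))" for x
    using cop[of x] ind_char_eq_0_iff[OF assms(1) order_refl, of True x] by blast
  show "\<exists>u. ind_char True Q Q u = -1 \<and> [u * x = x] (mod int (4 * \<Prod>Q))" if "\<not> coprime x (int (4 * \<Prod>Q))" for x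
  proof -
    consider "even x" | p where "p \<in> Q" "int p dvd x" using \<open>\<not> coprime _ _\<close> cop[of x] by blast
    then show ?thesis
    proof cases
      case 1
      \<comment> \<open>As \<open>\<Prod>Q\<close> is odd, \<open>u\<close> is 3 modulo 4 and 1
        modulo every prime of \<open>Q\<close>, so only \<open>chi4\<close> sees it. For even
        \<open>x\<close> the difference \<open>u * x - x = 2 * \<Prod>Q * x\<close> is a multiple of
        the level.\<close>
      define u where "u = 1 + 2 * int (\<Prod>Q)"
      have "odd (\<Prod>Q)" using assms by (simp add: prod_int_eq[symmetric] even_prod_iff)
      then obtain j where "int (\<Prod>Q) = 2 * j + 1" by (metis even_of_nat oddE)
      then have "u mod 4 = 3" by (simp add: u_def)
      then have "chi4 u = -1" by (simp add: chi4_def)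
      moreover have "Legendre u (int p) = 1" if "p \<in> Q" for p
      proof -
        have "int p dvd int (\<Prod>Q)"
          using dvd_prodI[OF assms(1) that, of "\<lambda>x. x"] by (simp only: int_dvd_int_iff)
        then have "[u = 1] (mod int p)" by (simp add: u_def cong_iff_dvd_diff del: of_nat_prod)
        then show ?thesis using Legendre_cong[of u 1 "int p"] Legendre_1[of p] assms(2)[OF that] by simp
      qed
      ultimately have "ind_char True Q Q u = -1" by (simp add: ind_char_def char4_def)
      moreover have "[u * x = x] (mod int (4 * \<Prod>Q))"
      proof -
        obtain i where "x = 2 * i" using 1 by blast
        then have "u * x - x = int (4 * \<Prod>Q) * i" by (simp add: u_def algebra_simps)
        then show ?thesis by (simp add: cong_iff_dvd_diff)
      qed
      ultimately show ?thesis by blast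
    next
      case 2
      define R where "R = 4 * \<Prod>(Q - {p})"
      have p: "prime p" "odd p" using assms 2 by auto
      have DR: "4 * \<Prod>Q = p * R" using 2 assms(1) by (simp add: R_def prod.remove[of Q p])
      have "coprime p (\<Prod>(Q - {p}))"
        using p assms(2) by (intro prod_coprime_right) (metis Diff_iff primes_coprime singletonI)
      then have "coprime p R"
        using p coprime_power_right_iff[of p 2 2] by (simp add: R_def)
      then have cR: "coprime (int p) (int R)" by (simp only: coprime_int_iff)
      \<comment> \<open>The unit is a nonresidue modulo \<open>p\<close> and 1 modulo the rest of
        the level, so only the factor at \<open>p\<close> changes sign.\<close>
      obtain g :: int where g: "Legendre g p = -1" using exists_nonresidue[OF p] by blast
      obtain u where u: "[u = g] (mod int p)" "[u = 1] (mod int R)"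
        using binary_chinese_remainder_int[OF cR] by blast
      have "[u = 1] (mod 4)" by (rule cong_dvd_modulus[OF u(2)]) (simp add: R_def)
      then have "chi4 u = 1" using chi4_cong[of u 1] by (simp add: chi4_def)
      moreover have "Legendre u (int p') = 1" if "p' \<in> Q - {p}" for p'
      proof -
        have "int p' dvd int (\<Prod>(Q - {p}))"
          using dvd_prodI[OF finite_Diff[OF assms(1)] that, of "\<lambda>x. x"] by (simp only: int_dvd_int_iff)
        then have "int p' dvd int R" by (simp add: R_def del: of_nat_prod)
        then have "[u = 1] (mod int p')" by (rule cong_dvd_modulus[OF u(2)])
        then show ?thesis using Legendre_cong[of u 1 "int p'"] Legendre_1[of p'] assms(2) that by simp
      qed
      then have "(\<Prod>p'\<in>Q. Legendre u (int p')) = Legendre u (int p)"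
        using 2 assms(1) by (simp add: prod.remove[of Q p])
      moreover have "Legendre u (int p) = -1" using Legendre_cong[OF u(1)] g by simp
      ultimately have "ind_char True Q Q u = -1" by (simp add: ind_char_def char4_def)
      moreover have "[u * x = x] (mod int (4 * \<Prod>Q))"
      proof -
        have "int p dvd x" "int R dvd u - 1" using 2 u(2) by (simp_all add: cong_iff_dvd_diff)
        then have "int p * int R dvd x * (u - 1)" by (rule mult_dvd_mono)
        then show ?thesis unfolding DR by (simp add: cong_iff_dvd_diff algebra_simps)
      qed
      ultimately show ?thesis by blast
    qed
  qed
qed

lemma rapidly_decaying_add:
  assumes "rapidly_decaying g" "rapidly_decaying h"
  shows "rapidly_decaying (\<lambda>y. g y + h y)"
  unfolding rapidly_decaying_def
proof (intro conjI allI)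
  show "continuous_on {0<..} (\<lambda>y. g y + h y)"
    using assms by (auto simp: rapidly_decaying_def intro: continuous_on_add)
  fix n
  obtain C where C: "C \<ge> 0" "\<And>y. y > 0 \<Longrightarrow> norm (g y) \<le> C * y ^ n" "\<And>y. y > 0 \<Longrightarrow> norm (g y) * y ^ n \<le> C"
    using assms(1) unfolding rapidly_decaying_def by meson
  obtain D where D: "D \<ge> 0" "\<And>y. y > 0 \<Longrightarrow> norm (h y) \<le> D * y ^ n" "\<And>y. y > 0 \<Longrightarrow> norm (h y) * y ^ n \<le> D"
    using assms(2) unfolding rapidly_decaying_def by meson
  have "norm (g y + h y) \<le> (C + D) * y ^ n \<and> norm (g y + h y) * y ^ n \<le> C + D" if y: "y > 0" for y
  proof -
    have t: "norm (g y + h y) \<le> norm (g y) + norm (h y)" by (rule norm_triangle_ineq)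
    then have "norm (g y + h y) * y ^ n \<le> (norm (g y) + norm (h y)) * y ^ n"
      using y by (intro mult_right_mono) auto
    then show ?thesis using t C(2,3)[OF y] D(2,3)[OF y] by (simp add: distrib_right)
  qed
  then show "\<exists>C\<ge>0. \<forall>y>0. norm (g y + h y) \<le> C * y ^ n \<and> norm (g y + h y) * y ^ n \<le> C"
    using C(1) D(1) by (intro exI[of _ "C + D"]) auto
qed

lemma rapidly_decaying_cmult:
  assumes "rapidly_decaying h"
  shows "rapidly_decaying (\<lambda>y. c * h y)"
  unfolding rapidly_decaying_def
proof (intro conjI allI)
  show "continuous_on {0<..} (\<lambda>y. c * h y)"
    using assms by (auto simp: rapidly_decaying_def intro: continuous_on_mult)
  fix n
  obtain C where C: "C \<ge> 0" "\<And>y. y > 0 \<Longrightarrow> norm (h y) \<le> C * y ^ n" "\<And>y. y > 0 \<Longrightarrow> norm (h y) * y ^ n \<le> C"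
    using assms unfolding rapidly_decaying_def by meson
  have "norm (c * h y) \<le> (norm c * C) * y ^ n \<and> norm (c * h y) * y ^ n \<le> norm c * C" if y: "y > 0" for y
    using mult_left_mono[OF C(2)[OF y], of "norm c"] mult_left_mono[OF C(3)[OF y], of "norm c"]
    by (simp add: norm_mult mult.assoc)
  then show "\<exists>C\<ge>0. \<forall>y>0. norm (c * h y) \<le> C * y ^ n \<and> norm (c * h y) * y ^ n \<le> C"
    using C(1) by (intro exI[of _ "norm c * C"]) auto
qed

lemma rapidly_decaying_sum:
  assumes "finite A" "\<And>k. k \<in> A \<Longrightarrow> rapidly_decaying (h k)"
  shows "rapidly_decaying (\<lambda>y. \<Sum>k\<in>A. h k y)"
  using assms
proof (induction A rule: finite_induct)
  case empty
  have "rapidly_decaying (\<lambda>y. 0)"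
    by (auto simp: rapidly_decaying_def intro!: exI[of _ 0])
  then show ?case by simp
qed (simp add: rapidly_decaying_add)

context newform
begin

text \<open>By \<open>gauss_sum_separable\<close>, \<open>ch n\<close> is
  \<open>gauss_sum n / gauss_sum 1\<close> for every \<open>n\<close>, coprime to \<open>D\<close>
  or not. Hence the weighted average \<open>h\<close> of the vertical restrictions has coefficients
  \<open>ch n * a n\<close>, and its Mellin transform continues the twisted series.\<close>

lemma twisted_L_value_primitive:
  assumes "real_primitive_character D ch"
  shows "twisted_L a ch 1 =
    (\<Sum>k\<in>{0..<int D}. of_int (ch k) * cusp_int (of_int k / of_nat D)) / real_primitive_character.gauss_sum D ch 1"
proof -
  interpret real_primitive_character D ch by fact
  define \<tau> where "\<tau> = gauss_sum 1"
  have \<tau>: "\<tau> \<noteq> 0" using gauss_sum_nonzero by (simp add: \<tau>_def)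
  define h where "h y = (\<Sum>k\<in>{0..<int D}. (of_int (ch k) / \<tau>) * vert (of_int k / of_nat D) y)" for y
  define b where "b n = of_int (ch (int n)) * (of_rat (a n) :: complex)" for n
  have h: "rapidly_decaying h"
    unfolding h_def by (intro rapidly_decaying_sum rapidly_decaying_cmult vert_rapidly_decaying) auto
  obtain C where C: "C \<ge> 0" "\<And>n. norm (of_rat (a n) :: complex) \<le> C * real n ^ 2"
    using coeff_bound by blast
  have bb: "norm (b n) \<le> C * real n ^ 2" for n
  proof -
    have "norm (complex_of_int (ch (int n))) \<le> 1" using range[of "int n"] by auto
    then have "norm (b n) \<le> 1 * norm (of_rat (a n) :: complex)"
      unfolding b_def norm_mult by (rule mult_right_mono) auto
    then show ?thesis using C(2)[of n] by simp
  qed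
  have sums: "(\<lambda>n. b (Suc n) * of_real (exp (- (2 * pi * real (Suc n) * y)))) sums h y" if y: "y > 0" for y
  proof -
    let ?t = "\<lambda>n k. (of_int (ch k) / \<tau>) * (of_rat (a n) *
      (unit_exp (of_nat n * of_rat (of_int k / of_nat D)) * of_real (exp (- (2 * pi * real n * y)))))"
    have "(\<lambda>n. \<Sum>k\<in>{0..<int D}. ?t n k) sums h y"
      unfolding h_def by (intro sums_sum sums_mult vert_sums y)
    moreover have "(\<Sum>k\<in>{0..<int D}. ?t n k) = b n * of_real (exp (- (2 * pi * real n * y)))" for n
    proof -
      have "(\<Sum>k\<in>{0..<int D}. ?t n k) = of_rat (a n) * of_real (exp (- (2 * pi * real n * y))) / \<tau> * gauss_sum (int n)"
        unfolding gauss_sum_def sum_distrib_left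
        by (intro sum.cong refl) (simp add: of_rat_divide mult_ac)
      then show ?thesis
        unfolding gauss_sum_separable[of "int n"] \<tau>_def[symmetric] using \<tau> by (simp add: b_def)
    qed
    ultimately have "(\<lambda>n. b n * of_real (exp (- (2 * pi * real n * y)))) sums h y" by simp
    moreover have "b 0 = 0" by (simp add: b_def a_0)
    ultimately show ?thesis by (subst sums_Suc_iff) simp
  qed
  obtain F where F: "F holomorphic_on UNIV" "F 1 = 2 * of_real pi * integral {0<..} h"
    "\<And>s. Re s > 4 \<Longrightarrow> (\<lambda>n. b (Suc n) * of_nat (Suc n) powr (- s)) sums F s"
    using dirichlet_series_continuation[OF h bb C(1) sums] by blast
  have "twisted_L a ch = F"
    by (rule twisted_L_eqI[OF F(1), of 4]) (use F(3) in \<open>simp add: b_def\<close>)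
  moreover have "integral {0<..} h = (\<Sum>k\<in>{0..<int D}. (of_int (ch k) / \<tau>) * integral {0<..} (vert (of_int k / of_nat D)))"
    unfolding h_def using vert_integrable
    by (subst integral_sum) (auto intro!: integrable_on_mult_right simp: set_lebesgue_integral_eq_integral)
  ultimately show ?thesis
    unfolding \<tau>_def[symmetric] by (simp add: F(2) cusp_int_def sum_distrib_left sum_divide_distrib mult_ac)
qed

lemma twisted_L_value_trivial: "twisted_L a (quad_char 1) 1 = cusp_int 0"
proof -
  define b where "b n = (of_rat (a n) :: complex)" for n
  obtain C where C: "C \<ge> 0" "\<And>n. norm (of_rat (a n) :: complex) \<le> C * real n ^ 2"
    using coeff_bound by blast
  have sums: "(\<lambda>n. b (Suc n) * of_real (exp (- (2 * pi * real (Suc n) * y)))) sums vert 0 y" if y: "y > 0" for y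
  proof -
    have "(\<lambda>n. b n * of_real (exp (- (2 * pi * real n * y)))) sums vert 0 y"
      using vert_sums[OF y, of 0] unit_exp_int[of 0] by (simp add: b_def)
    moreover have "b 0 = 0" by (simp add: b_def a_0)
    ultimately show ?thesis by (subst sums_Suc_iff) simp
  qed
  obtain F where F: "F holomorphic_on UNIV" "F 1 = 2 * of_real pi * integral {0<..} (vert 0)"
    "\<And>s. Re s > 4 \<Longrightarrow> (\<lambda>n. b (Suc n) * of_nat (Suc n) powr (- s)) sums F s"
    using dirichlet_series_continuation[OF vert_rapidly_decaying _ C(1) sums] C(2) unfolding b_def by blast
  have "twisted_L a (quad_char 1) = F"
    by (rule twisted_L_eqI[OF F(1), of 4]) (use F(3) in \<open>simp add: b_def quad_char_def\<close>)
  then show ?thesis by (simp add: F(2) cusp_int_def)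
qed

end

section \<open>Two-adic valuations of the special values\<close>

lemma algebraic_square_rat:
  assumes "(x::complex) ^ 2 = of_rat z"
  shows "algebraic x"
proof (rule algebraicI')
  let ?p = "[:- of_rat z, 0, 1:] :: complex poly"
  show "Polynomial.coeff ?p i \<in> \<rat>" for i by (auto simp: coeff_pCons split: nat.splits)
  show "?p \<noteq> 0" by simp
  show "poly ?p x = 0" using assms by (simp add: power2_eq_square)
qed

lemma two_adic_valuation_rat_valuation:
  assumes "two_adic_valuation v"
  shows "rat_valuation (\<lambda>x. v (of_rat x))"
proof
  have alg: "algebraic (of_rat x :: complex)" for x by (rule rat_imp_algebraic) simp
  show "v (of_rat 0) = \<infinity>" "v (of_rat 2) = 1" using assms by (simp_all add: two_adic_valuation_def)
  show "\<bar>v (of_rat x)\<bar> \<noteq> \<infinity>" if "x \<noteq> 0" for x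
    using assms alg[of x] that by (simp add: two_adic_valuation_def)
  show "v (of_rat (x * y)) = v (of_rat x) + v (of_rat y)" for x y
    using assms alg[of x] alg[of y] by (simp add: two_adic_valuation_def of_rat_mult)
  show "min (v (of_rat x)) (v (of_rat y)) \<le> v (of_rat (x + y))" for x y
    using assms alg[of x] alg[of y] by (simp add: two_adic_valuation_def of_rat_add)
qed

text \<open>The Gauss sum is irrational, so the valuation is computed from the square:
  \<open>2 v(x) = 2 v(z) - v(4)\<close>, as \<open>n\<close> is odd. The value 0 is separate because
  infinite valuations do not cancel.\<close>

lemma two_adic_valuation_sqrt:
  assumes v: "two_adic_valuation v" and x: "(x::complex) ^ 2 = of_rat (\<epsilon> * z ^ 2 / (4 * of_int n))"
    and "\<epsilon> \<in> {-1, 1}" "odd n"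
  shows "v x = v (of_rat z) - 1"
proof -
  interpret rat_valuation "\<lambda>x. v (of_rat x)" by (rule two_adic_valuation_rat_valuation[OF v])
  have "n \<noteq> 0" using assms by auto
  have alg: "algebraic x" by (rule algebraic_square_rat[OF x])
  show ?thesis
  proof (cases "z = 0")
    case True
    then have "x = 0" using x by simp
    then show ?thesis using True v by (simp add: two_adic_valuation_def)
  next
    case False
    define t where "t = \<epsilon> * z ^ 2 / (4 * of_int n)"
    have e: "v (of_rat \<epsilon>) = 0" using assms(3) w_1 w_minus_1 by auto
    have "z ^ 2 * \<epsilon> = t * (2 * (2 * of_int n))" using \<open>n \<noteq> 0\<close> by (simp add: t_def)
    then have "v (of_rat (z * z * \<epsilon>)) = v (of_rat (t * (2 * (2 * of_int n))))" by (simp add: power2_eq_square)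
    then have 1: "v (of_rat z) + v (of_rat z) = v (of_rat t) + (1 + 1)"
      unfolding w_mult using e w2 w_odd[OF assms(4)] by simp
    have "x * x = of_rat t" using x by (simp add: t_def power2_eq_square)
    then have 2: "v x + v x = v (of_rat t)"
      using v alg by (metis two_adic_valuation_def)
    have "x \<noteq> 0" using x False \<open>n \<noteq> 0\<close> assms(3) by auto
    then have fx: "\<bar>v x\<bar> \<noteq> \<infinity>" using v alg by (simp add: two_adic_valuation_def)
    have fz: "\<bar>v (of_rat z)\<bar> \<noteq> \<infinity>" using w_fin[OF False] .
    show ?thesis using 1 2 fx fz
      by (cases "v x"; cases "v (of_rat z)"; cases "v (of_rat t)") (auto simp: one_ereal_def)
  qed
qed

lemma prod_prime_factors_squarefree:
  fixes d :: nat
  assumes "squarefree d" "d > 0"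
  shows "\<Prod>(prime_factors d) = d"
proof -
  have "d = (\<Prod>p\<in>prime_factors d. p ^ multiplicity p d)"
    using prime_factorization_nat[OF assms(2)] .
  also have "\<dots> = (\<Prod>p\<in>prime_factors d. p)"
  proof (intro prod.cong refl)
    fix p assume "p \<in> prime_factors d"
    then have "multiplicity p d = 1"
      using assms squarefree_factorial_semiring'[of d] by auto
    then show "p ^ multiplicity p d = p" by simp
  qed
  finally show ?thesis by simp
qed

lemma quad_char_ind_char:
  assumes "finite Q" "\<And>p. p \<in> Q \<Longrightarrow> prime p"
  shows "quad_char (4 * \<Prod>Q) = ind_char True Q Q"
proof -
  have "prime_factors (\<Prod>Q) = Q"
  proof -
    have "prod id Q \<noteq> 0" using assms by (auto dest: prime_gt_0_nat)
    then have nz: "\<Prod>Q \<noteq> 0" by simp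
    show ?thesis
      using assms prime_dvd_prod_iff[of Q _ "\<lambda>x. x"] nz
      by (auto simp: prime_factors_dvd) (metis primes_dvd_imp_eq)
  qed
  then show ?thesis by (simp add: fun_eq_iff quad_char_def ind_char_def char4_def)
qed

text \<open>The value 0 off the integers makes this an odd function.\<close>

definition int_part :: "real \<Rightarrow> int" where
  "int_part y = (if y \<in> \<int> then \<lfloor>y\<rfloor> else 0)"

lemma int_part_of_int [simp]: "int_part (of_int n) = n"
  by (simp add: int_part_def)

lemma int_part_uminus: "int_part (- y) = - int_part y"
  by (auto simp: int_part_def elim!: Ints_cases simp flip: of_int_minus)

locale newform_periods = newform +
  fixes \<Omega>p \<Omega>m :: real and v :: "complex \<Rightarrow> ereal"
  assumes periods_pos: "\<Omega>p > 0" "\<Omega>m > 0"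
    and nonrectangular: "period_lattice N f = nonrectangular_lattice \<Omega>p \<Omega>m"
    and valuation: "two_adic_valuation v"
    and N_odd: "odd N"
begin

sublocale rat_valuation "\<lambda>x. v (of_rat x)"
  by (rule two_adic_valuation_rat_valuation[OF valuation])

text \<open>\<open>re_part\<close> and \<open>im_part\<close> are \<open>s(r)\<close> and
  \<open>t(r)\<close> of the overview. The total function \<open>int_part\<close> keeps periodicity
  and parity in \<open>r\<close> valid at every rational, also where the lattice says
  nothing.\<close>

definition re_part :: "rat \<Rightarrow> int" where
  "re_part r = int_part (2 * (Re (cusp_int r) - Re (cusp_int 0)) / \<Omega>p)"

definition im_part :: "rat \<Rightarrow> int" where
  "im_part r = int_part (2 * Im (cusp_int r) / \<Omega>m)"

definition base :: real where
  "base = Re (cusp_int 0) / \<Omega>p"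

text \<open>The Manin--Drinfeld theorem, that \<^const>\<open>base\<close> is rational, is not needed: all relations
  are \<open>\<rat>\<close>-linear, so an irrational value may be replaced by 0.\<close>

definition rat_base :: rat where
  "rat_base = (if base \<in> \<rat> then SOME x. of_rat x = base else 0)"

lemma rat_base_eq: "base \<in> \<rat> \<Longrightarrow> of_rat rat_base = base"
  unfolding rat_base_def by (auto elim!: Rats_cases intro: someI_ex[of "\<lambda>x. of_rat x = base"])

definition even_part :: "rat \<Rightarrow> rat" where
  "even_part r = rat_base + of_int (re_part r) / 2"

definition odd_part :: "rat \<Rightarrow> rat" where
  "odd_part r = of_int (im_part r) / 2"

lemma cusp_int_0: "Im (cusp_int 0) = 0"
  using cusp_int_uminus[of 0] by (simp add: complex_eq_iff)

lemma parts_period: "re_part (r + 1) = re_part r" "im_part (r + 1) = im_part r"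
  by (simp_all add: re_part_def im_part_def cusp_int_period)

lemma parts_uminus: "re_part (- r) = re_part r" "im_part (- r) = - im_part r"
  by (simp_all add: re_part_def im_part_def cusp_int_uminus int_part_uminus[symmetric])

text \<open>A lattice vector with coordinates \<open>i\<close> and \<open>l\<close> has real part
  \<open>(2 * i + l) / 2\<close> periods and imaginary part \<open>l / 2\<close> periods, so both
  numerators are congruent to \<open>l\<close> modulo 2.\<close>

lemma parts:
  assumes "D > 0" "coprime D N"
  shows "Re (cusp_int (of_int k / of_nat D)) = \<Omega>p * (base + of_int (re_part (of_int k / of_nat D)) / 2)"
    and "Im (cusp_int (of_int k / of_nat D)) = \<Omega>m * (of_int (im_part (of_int k / of_nat D)) / 2)"
    and "even (re_part (of_int k / of_nat D) - im_part (of_int k / of_nat D))"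
proof -
  define r where "r = (of_int k / of_nat D :: rat)"
  have "cusp_int r - cusp_int 0 \<in> nonrectangular_lattice \<Omega>p \<Omega>m"
    using cusp_int_diff_period[OF assms(2,1)] by (simp add: nonrectangular r_def)
  then obtain i l :: int where il: "cusp_int r - cusp_int 0 =
      of_int i * of_real \<Omega>p + of_int l * ((of_real \<Omega>p + \<i> * of_real \<Omega>m) / 2)"
    by (auto simp: nonrectangular_lattice_def)
  have "Re (cusp_int r) - Re (cusp_int 0) = of_int i * \<Omega>p + of_int l * (\<Omega>p / 2)"
    using arg_cong[OF il, of Re] by simp
  then have re: "2 * (Re (cusp_int r) - Re (cusp_int 0)) / \<Omega>p = of_int (2 * i + l)"
    using periods_pos by (simp add: field_simps)
  have "Im (cusp_int r) = of_int l * (\<Omega>m / 2)"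
    using arg_cong[OF il, of Im] by (simp add: cusp_int_0)
  then have im: "2 * Im (cusp_int r) / \<Omega>m = of_int l"
    using periods_pos by (simp add: field_simps)
  have rp: "re_part r = 2 * i + l" unfolding re_part_def re int_part_of_int ..
  have ip: "im_part r = l" unfolding im_part_def im int_part_of_int ..
  show "Re (cusp_int (of_int k / of_nat D)) = \<Omega>p * (base + of_int (re_part (of_int k / of_nat D)) / 2)"
    unfolding r_def[symmetric] rp using re periods_pos by (simp add: base_def field_simps)
  show "Im (cusp_int (of_int k / of_nat D)) = \<Omega>m * (of_int (im_part (of_int k / of_nat D)) / 2)"
    unfolding r_def[symmetric] ip using im periods_pos by (simp add: field_simps)
  show "even (re_part (of_int k / of_nat D) - im_part (of_int k / of_nat D))"
    unfolding r_def[symmetric] rp ip by simp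
qed

text \<open>In the real part, \<open>base\<close> occurs \<open>a q\<close> times on the left of the
  Hecke relation and \<open>1 + q\<close> times on the right; everything else is rational. The
  imaginary part has no constant term.\<close>

lemma parts_hecke:
  fixes q M :: nat and k :: int
  assumes q: "prime q" "\<not> q dvd N" and M: "M > 0" "coprime M N"
  defines "r \<equiv> of_int k / of_nat M"
  shows "of_rat (a q - 1 - of_nat q) * base = of_rat ((of_int (re_part (of_nat q * r)) +
      (\<Sum>b<q. of_int (re_part ((r + of_nat b) / of_nat q))) - a q * of_int (re_part r)) / 2)"
    and "a q * odd_part r = odd_part (of_nat q * r) + (\<Sum>b<q. odd_part ((r + of_nat b) / of_nat q))"
proof -
  have q0: "q > 0" using q prime_gt_0_nat by blast
  have Mq: "M * q > 0" "coprime (M * q) N" using q M q0 by (auto simp: prime_imp_coprime)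
  have r2: "of_nat q * r = of_int (int q * k) / of_nat M" by (simp add: r_def)
  have r3: "(r + of_nat b) / of_nat q = of_int (k + int M * int b) / of_nat (M * q)" for b
    using M q0 by (simp add: r_def field_simps)
  note p1 = parts[OF M, of k, folded r_def]
  note p2 = parts[OF M, of "int q * k", folded r2]
  have p3: "Re (cusp_int ((r + of_nat b) / of_nat q)) = \<Omega>p * (base + of_int (re_part ((r + of_nat b) / of_nat q)) / 2)"
    "Im (cusp_int ((r + of_nat b) / of_nat q)) = \<Omega>m * (of_int (im_part ((r + of_nat b) / of_nat q)) / 2)" for b
    unfolding r3 by (rule parts[OF Mq])+
  have H: "complex_of_real (of_rat (a q)) * cusp_int r = cusp_int (of_nat q * r) + (\<Sum>b<q. cusp_int ((r + of_nat b) / of_nat q))"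
    using cusp_int_hecke[OF q] by (simp add: complex_of_rat[of "a q"])
  have "\<Omega>p * (of_rat (a q) * (base + of_int (re_part r) / 2)) =
     \<Omega>p * ((base + of_int (re_part (of_nat q * r)) / 2) + (\<Sum>b<q. base + of_int (re_part ((r + of_nat b) / of_nat q)) / 2))"
    using arg_cong[OF H, of Re] by (simp add: p1 p2 p3 sum_distrib_left distrib_left mult.left_commute)
  then have "of_rat (a q) * (base + of_int (re_part r) / 2) =
     (base + of_int (re_part (of_nat q * r)) / 2) + (of_nat q * base + (\<Sum>b<q. of_int (re_part ((r + of_nat b) / of_nat q))) / 2)"
    using periods_pos by (simp add: sum.distrib sum_divide_distrib)
  then show "of_rat (a q - 1 - of_nat q) * base = of_rat ((of_int (re_part (of_nat q * r)) +
      (\<Sum>b<q. of_int (re_part ((r + of_nat b) / of_nat q))) - a q * of_int (re_part r)) / 2)"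
    by (simp add: of_rat_diff of_rat_add of_rat_divide of_rat_mult of_rat_sum field_simps)
  have "\<Omega>m * (of_rat (a q) * (of_int (im_part r) / 2)) =
     \<Omega>m * (of_int (im_part (of_nat q * r)) / 2 + (\<Sum>b<q. of_int (im_part ((r + of_nat b) / of_nat q)) / 2))"
    using arg_cong[OF H, of Im] by (simp add: p1 p2 p3 sum_distrib_left distrib_left mult.left_commute)
  then have "of_rat (a q) * (of_int (im_part r) / 2) =
     of_int (im_part (of_nat q * r)) / 2 + (\<Sum>b<q. of_int (im_part ((r + of_nat b) / of_nat q)) / 2 :: real)"
    using periods_pos by simp
  then have "(of_rat (a q * odd_part r) :: real) = of_rat (odd_part (of_nat q * r) + (\<Sum>b<q. odd_part ((r + of_nat b) / of_nat q)))"
    by (simp add: odd_part_def of_rat_add of_rat_divide of_rat_mult of_rat_sum)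
  then show "a q * odd_part r = odd_part (of_nat q * r) + (\<Sum>b<q. odd_part ((r + of_nat b) / of_nat q))"
    by (simp only: of_rat_eq_iff)
qed

sublocale odd_part: hecke_function "\<lambda>x. v (of_rat x)" N a "-1" odd_part
proof
  show "odd_part (x + 1) = odd_part x" "odd_part (- x) = of_int (-1) * odd_part x" for x
    by (simp_all add: odd_part_def parts_period parts_uminus)
qed (use N_odd parts_hecke(2) in auto)

sublocale even_part: hecke_function "\<lambda>x. v (of_rat x)" N a 1 even_part
proof
  show "even_part (x + 1) = even_part x" "even_part (- x) = of_int 1 * even_part x" for x
    by (simp_all add: even_part_def parts_period parts_uminus)
  fix q M :: nat and k :: int
  assume *: "prime q" "\<not> q dvd N" "M > 0" "coprime M N"
  define r where "r = (of_int k / of_nat M :: rat)"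
  define A where "A = a q - 1 - of_nat q"
  define X where "X = (of_int (re_part (of_nat q * r)) +
      (\<Sum>b<q. of_int (re_part ((r + of_nat b) / of_nat q))) - a q * of_int (re_part r)) / 2"
  have AX: "of_rat A * base = of_rat X" using parts_hecke(1)[OF *] by (simp add: A_def X_def r_def)
  have "A * rat_base = X"
  proof (cases "base \<in> \<rat>")
    case True
    then have "(of_rat (A * rat_base) :: real) = of_rat X" using AX by (simp add: of_rat_mult rat_base_eq)
    then show ?thesis by (simp only: of_rat_eq_iff)
  next
    case False
    \<comment> \<open>A nonzero rational \<open>A\<close> would make \<open>base\<close> rational,
      since \<open>A * base\<close> equals the rational \<open>X\<close>.\<close>
    have "A = 0"
    proof (rule ccontr)
      assume "A \<noteq> 0"
      then have "base = of_rat (X / A)" using AX by (simp add: of_rat_divide field_simps)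
      then show False using False by simp
    qed
    then show ?thesis using AX by simp
  qed
  then show "a q * even_part (of_int k / of_nat M) = even_part (of_nat q * of_int k / of_nat M) +
      (\<Sum>b<q. even_part ((of_int k / of_nat M + of_nat b) / of_nat q))"
    unfolding r_def[symmetric]
    by (simp add: even_part_def A_def X_def r_def sum.distrib sum_divide_distrib[symmetric] field_simps)
qed (use N_odd in auto)

lemma char_sum_re_part:
  assumes "finite Q" "Q \<subseteq> odd_part.good_primes"
  shows "char_sum (ind_char True Q Q) (4 * \<Prod>Q) even_part =
    char_sum (ind_char True Q Q) (4 * \<Prod>Q) (\<lambda>x. of_int (re_part x) / 2)"
proof -
  have pr: "\<And>p. p \<in> Q \<Longrightarrow> prime p \<and> odd p" using assms by (auto simp: odd_part.good_primes_def)
  interpret real_primitive_character "4 * \<Prod>Q" "ind_char True Q Q"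
    by (rule ind_char_primitive[OF assms(1) pr])
  have "(\<Sum>k\<in>{0..<int (4 * \<Prod>Q)}. (of_int (ind_char True Q Q k) :: rat)) = 0"
    using sum_ch_0 D_pos by (simp only: of_int_sum[symmetric]) simp
  then have "(\<Sum>k\<in>{0..<int (4 * \<Prod>Q)}. of_int (ind_char True Q Q k) * rat_base) = 0"
    by (simp only: sum_distrib_right[symmetric])
  then show ?thesis
    unfolding char_sum_def even_part_def distrib_left sum.distrib by simp
qed

definition L_ratio :: "nat set \<Rightarrow> complex" where
  "L_ratio Q = central_ratio a \<Omega>p \<Omega>m (4 * \<Prod>Q)"

text \<open>\<open>A(\<chi>)\<close> of the overview: the parity of the character selects the part
  whose sum is not forced to vanish.\<close>

definition L_sum :: "nat set \<Rightarrow> rat" where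
  "L_sum Q = char_sum (ind_char True Q Q) (4 * \<Prod>Q) (if ind_char True Q Q (-1) = 1 then even_part else odd_part)"

lemma ind_char_minus_1_sign:
  assumes "finite Q" "Q \<subseteq> odd_part.good_primes"
  shows "ind_char True Q Q (-1) \<in> {-1, 1}"
proof -
  have "ind_char True Q Q (-1) \<noteq> 0"
    using assms by (auto simp: ind_char_eq_0_iff odd_part.good_primes_def dest: not_prime_unit)
  then show ?thesis using ind_char_range[of True Q Q "-1"] by auto
qed

text \<open>The part of the wrong parity drops out, so \<open>T\<close> is real or purely imaginary.
  In the odd case \<open>\<i> ^ 2\<close> cancels the sign \<open>ch (-1) = -1\<close> in the square
  of the Gauss sum.\<close>

lemma L_ratio_square:
  assumes "finite Q" "Q \<subseteq> odd_part.good_primes"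
  shows "\<exists>\<epsilon>\<in>{-1, 1}. L_ratio Q ^ 2 = of_rat (\<epsilon> * L_sum Q ^ 2 / (4 * of_int (int (\<Prod>Q))))"
proof -
  have pr: "\<And>p. p \<in> Q \<Longrightarrow> prime p \<and> odd p" using assms by (auto simp: odd_part.good_primes_def)
  define D where "D = 4 * \<Prod>Q"
  define ch where "ch = ind_char True Q Q"
  have rpc: "real_primitive_character D ch"
    unfolding D_def ch_def by (rule ind_char_primitive[OF assms(1) pr])
  interpret real_primitive_character D ch by (rule rpc)
  define \<tau> where "\<tau> = gauss_sum 1"
  define T where "T = (\<Sum>k\<in>{0..<int D}. of_int (ch k) * cusp_int (of_int k / of_nat D))"
  have D: "D > 0" "coprime D N" using odd_part.coprime_level[OF assms] by (simp_all add: D_def)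
  have D1: "D > 1" using D(1) by (simp add: D_def)
  have ReT: "Re T = \<Omega>p * of_rat (char_sum ch D even_part)"
  proof -
    have "(\<Sum>k\<in>{0..<int D}. real_of_int (ch k)) = 0"
      using sum_ch_0[OF D1] by (simp flip: of_int_sum)
    then have z: "(\<Sum>k\<in>{0..<int D}. real_of_int (ch k) * (\<Omega>p * base)) = 0"
      by (simp only: sum_distrib_right[symmetric])
    have "Re T = (\<Sum>k\<in>{0..<int D}. real_of_int (ch k) * (\<Omega>p * base)) +
        (\<Sum>k\<in>{0..<int D}. real_of_int (ch k) * (\<Omega>p * (of_int (re_part (of_int k / of_nat D)) / 2)))"
      by (simp add: T_def parts[OF D] distrib_left sum.distrib)
    then have "Re T = (\<Sum>k\<in>{0..<int D}. real_of_int (ch k) * (\<Omega>p * (of_int (re_part (of_int k / of_nat D)) / 2)))"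
      unfolding z by simp
    moreover have "char_sum ch D even_part = char_sum ch D (\<lambda>x. of_int (re_part x) / 2)"
      unfolding ch_def D_def by (rule char_sum_re_part[OF assms])
    ultimately show ?thesis
      by (simp add: char_sum_def of_rat_sum of_rat_mult of_rat_divide sum_distrib_left mult_ac)
  qed
  have ImT: "Im T = \<Omega>m * of_rat (char_sum ch D odd_part)"
    by (simp add: T_def parts[OF D] char_sum_def odd_part_def of_rat_sum of_rat_mult of_rat_divide sum_distrib_left mult_ac)
  have qc: "quad_char D = ch"
    unfolding D_def ch_def by (rule quad_char_ind_char[OF assms(1)]) (use pr in blast)
  have cr: "L_ratio Q = T / \<tau> / of_real (if ch (-1) = 1 then \<Omega>p else \<Omega>m)"
    unfolding L_ratio_def central_ratio_def D_def[symmetric] qc twisted_L_value_primitive[OF rpc]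
    by (simp add: T_def \<tau>_def)
  have \<tau>: "\<tau> ^ 2 = of_int (ch (-1)) * of_nat D" unfolding \<tau>_def by (rule gauss_sum_square)
  have sq: "(of_rat (4 * of_int (int (\<Prod>Q))) :: complex) = of_nat D"
    unfolding D_def
    by (simp only: of_rat_mult of_rat_numeral_eq of_rat_of_nat_eq of_int_of_nat_eq of_nat_mult of_nat_numeral)
  have "ch (-1) = 1 \<or> ch (-1) = -1" using ind_char_minus_1_sign[OF assms] by (auto simp: ch_def)
  then show ?thesis
  proof
    assume e: "ch (-1) = 1"
    have "char_sum ch D odd_part = 0"
      unfolding ch_def D_def
      by (rule odd_part.ind_char_sum_wrong_parity[OF assms order_refl]) (use e in \<open>simp add: ch_def\<close>)
    then have "T = of_real (\<Omega>p * of_rat (L_sum Q))"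
      using ReT ImT e by (simp add: complex_eq_iff L_sum_def ch_def D_def)
    then have "L_ratio Q = of_rat (L_sum Q) / \<tau>"
      using cr e periods_pos by (simp add: complex_of_rat[of "L_sum Q"])
    then have "L_ratio Q ^ 2 = of_rat (1 * L_sum Q ^ 2 / (4 * of_int (int (\<Prod>Q))))"
      unfolding of_rat_divide sq using \<tau> e by (simp add: power_divide of_rat_power)
    then show ?thesis by blast
  next
    assume e: "ch (-1) = -1"
    have "char_sum ch D even_part = 0"
      unfolding ch_def D_def
      by (rule even_part.ind_char_sum_wrong_parity)
        (use e assms in \<open>simp_all add: ch_def odd_part.good_primes_def even_part.good_primes_def\<close>)
    then have "T = \<i> * of_real (\<Omega>m * of_rat (L_sum Q))"
      using ReT ImT e by (simp add: complex_eq_iff L_sum_def ch_def D_def)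
    then have "L_ratio Q = \<i> * of_rat (L_sum Q) / \<tau>"
      using cr e periods_pos by (simp add: complex_of_rat[of "L_sum Q"])
    then have "L_ratio Q ^ 2 = of_rat (1 * L_sum Q ^ 2 / (4 * of_int (int (\<Prod>Q))))"
      unfolding of_rat_divide sq using \<tau> e by (simp add: power_divide power_mult_distrib of_rat_power)
    then show ?thesis by blast
  qed
qed

lemma v_L_ratio:
  assumes "finite Q" "Q \<subseteq> odd_part.good_primes"
  shows "v (L_ratio Q) = v (of_rat (L_sum Q)) - 1"
proof -
  obtain \<epsilon> :: rat where e: "\<epsilon> \<in> {-1, 1}" "L_ratio Q ^ 2 = of_rat (\<epsilon> * L_sum Q ^ 2 / (4 * of_int (int (\<Prod>Q))))"
    using L_ratio_square[OF assms] by blast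
  have "odd (\<Prod>Q)"
    using assms by (auto simp: even_prod_iff odd_part.good_primes_def)
  then have "odd (int (\<Prod>Q))" by (simp only: even_of_nat not_False_eq_True)
  from two_adic_valuation_sqrt[OF valuation e(2,1) this] show ?thesis .
qed

lemma v_L1: "v (central_ratio a \<Omega>p \<Omega>m 1) = v (of_real base)"
proof -
  have "cusp_int 0 = of_real (Re (cusp_int 0))" using cusp_int_0 by (simp add: complex_eq_iff)
  moreover have "quad_char 1 (-1) = 1" by (simp add: quad_char_def)
  ultimately show ?thesis using twisted_L_value_trivial
    by (simp add: central_ratio_def base_def)
qed

text \<open>For irrational \<open>base\<close> the substitute 0 has infinite valuation, which makes
  the right side 0, the largest value it can take.\<close>

lemma min_rat_base: "min 0 (v (of_real base)) \<le> min 0 (v (of_rat rat_base))"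
proof (cases "base \<in> \<rat>")
  case True
  then show ?thesis using rat_base_eq[OF True] by (simp add: complex_of_rat[of rat_base])
next
  case False
  then show ?thesis using w0 by (simp add: rat_base_def)
qed

lemma half_integral:
  assumes "M > 0" "coprime M N"
  shows "\<exists>z::int. even_part (of_int k / of_nat M) = rat_base + of_int z / 2"
    and "\<exists>z::int. odd_part (of_int k / of_nat M) = 0 + of_int z / 2"
  by (auto simp: even_part_def odd_part_def)

text \<open>For odd characters the constant \<open>c\<close> of \<open>w_char_sum_ge\<close> is 0,
  because \<open>J(0)\<close> is real; only even characters feel \<open>base\<close>.\<close>

lemma v_L_sum_ge:
  assumes "finite Q" "Q \<subseteq> odd_part.good_primes" "\<And>q. q \<in> Q \<Longrightarrow> v (of_rat (a q - 2)) \<ge> 1"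
  shows "v (of_rat (L_sum Q)) \<ge> ereal (real (card Q)) + min 0 (v (of_real base))"
    and "ind_char True Q Q (-1) = -1 \<Longrightarrow> v (of_rat (L_sum Q)) \<ge> ereal (real (card Q))"
proof -
  have odd: "v (of_rat (L_sum Q)) \<ge> ereal (real (card Q)) + min 0 (v (of_rat 0))"
    if "ind_char True Q Q (-1) = -1"
    unfolding L_sum_def that
    using odd_part.w_char_sum_ge[OF half_integral(2) assms] by simp
  then show "v (of_rat (L_sum Q)) \<ge> ereal (real (card Q))" if "ind_char True Q Q (-1) = -1"
    using that w0 by simp
  have "v (of_rat (L_sum Q)) \<ge> ereal (real (card Q)) + min 0 (v (of_rat rat_base))" if "ind_char True Q Q (-1) = 1"
    unfolding L_sum_def that
    using even_part.w_char_sum_ge[OF half_integral(1) assms(1) _ assms(3)] assms(2)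
    by (simp add: odd_part.good_primes_def even_part.good_primes_def)
  moreover have "ereal (real (card Q)) + min 0 (v (of_real base)) \<le> ereal (real (card Q)) + min 0 (v (of_rat rat_base))"
    by (rule add_left_mono[OF min_rat_base])
  moreover have "ereal (real (card Q)) + min 0 (v (of_real base)) \<le> ereal (real (card Q)) + min 0 (v (of_rat 0))"
    by (rule add_left_mono) (use w0 in simp)
  ultimately show "v (of_rat (L_sum Q)) \<ge> ereal (real (card Q)) + min 0 (v (of_real base))"
    using odd ind_char_minus_1_sign[OF assms(1,2)] order_trans by blast
qed

text \<open>Modulo 2 all quadratic characters of the same level agree, and the two parts of the
  lattice coordinates are congruent because the lattice is non-rectangular.\<close>

lemma L_sum_mod_2:
  assumes "finite Q" "Q \<subseteq> odd_part.good_primes"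
  shows "\<exists>(s :: nat \<Rightarrow> int) n. (\<forall>q\<in>Q. s q \<in> {-1, 1}) \<and>
    L_sum Q = (\<Prod>q\<in>Q. a q - 2 * of_int (s q)) * L_sum {} + of_int (2 * n)"
proof -
  have pr: "\<And>p. p \<in> Q \<Longrightarrow> prime p \<and> odd p" using assms by (auto simp: odd_part.good_primes_def)
  have L0: "L_sum {} = char_sum (ind_char True {} {}) (4 * \<Prod>{}) odd_part"
    by (simp add: L_sum_def ind_char_def char4_def chi4_minus_1)
  \<comment> \<open>The reference is the character of level \<open>4 * \<Prod>Q\<close> induced by
    \<open>chi4\<close>; its sum is \<open>L_sum {}\<close> times the Euler factors at the primes of
    \<open>Q\<close>.\<close>
  obtain s where s: "\<forall>q\<in>Q. s q \<in> {-1, 1::int}"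
    "char_sum (ind_char True {} Q) (4 * \<Prod>Q) odd_part = (\<Prod>q\<in>Q. a q - 2 * of_int (s q)) * L_sum {}"
    using odd_part.ind_char_sum_extend[of "{}" Q True] assms unfolding L0 by auto
  have lev: "4 * \<Prod>Q > 0" "coprime (4 * \<Prod>Q) N" using odd_part.coprime_level[OF assms] by auto
  have odd_part_eq: "odd_part = (\<lambda>x. of_int (im_part x) / 2)" by (simp add: fun_eq_iff odd_part_def)
  have m1: "ind_char True {} Q (-1) * (-1) = 1" using pr by (simp add: ind_char_minus_1)
  have "\<exists>n. L_sum Q = char_sum (ind_char True {} Q) (4 * \<Prod>Q) (\<lambda>x. of_int (im_part x) / 2) + of_int (2 * n)"
  proof (cases "ind_char True Q Q (-1) = 1")
    case True
    \<comment> \<open>An even character meets the odd reference character here, so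
      \<open>re_part\<close> is compared with \<open>im_part\<close> by
      \<open>parts(3)\<close>.\<close>
    have "\<exists>n. char_sum (ind_char True Q Q) (4 * \<Prod>Q) (\<lambda>x. of_int (re_part x) / 2) =
      char_sum (ind_char True {} Q) (4 * \<Prod>Q) (\<lambda>x. of_int (im_part x) / 2) + of_int (2 * n)"
      by (rule char_sum_parity[where ?e1.0 = 1 and ?e2.0 = "-1"])
        (use assms(1) pr True m1 parts(3)[OF lev] in \<open>auto simp: parts_period parts_uminus\<close>)
    then show ?thesis using True char_sum_re_part[OF assms] by (simp add: L_sum_def)
  next
    case False
    then have F: "ind_char True Q Q (-1) = -1" using ind_char_minus_1_sign[OF assms] by auto
    have "\<exists>n. char_sum (ind_char True Q Q) (4 * \<Prod>Q) (\<lambda>x. of_int (im_part x) / 2) =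
      char_sum (ind_char True {} Q) (4 * \<Prod>Q) (\<lambda>x. of_int (im_part x) / 2) + of_int (2 * n)"
      by (rule char_sum_parity[where ?e1.0 = "-1" and ?e2.0 = "-1"])
        (use assms(1) pr F m1 in \<open>auto simp: parts_period parts_uminus\<close>)
    then show ?thesis using False by (simp add: L_sum_def odd_part_eq)
  qed
  then obtain n where "L_sum Q = char_sum (ind_char True {} Q) (4 * \<Prod>Q) (\<lambda>x. of_int (im_part x) / 2) + of_int (2 * n)"
    by blast
  then have "L_sum Q = (\<Prod>q\<in>Q. a q - 2 * of_int (s q)) * L_sum {} + of_int (2 * n)"
    by (simp only: s(2)[unfolded odd_part_eq])
  then show ?thesis using s(1) by blast
qed

lemma v_L_sum_ge_min:
  assumes "finite Q" "Q \<subseteq> odd_part.good_primes" "\<And>q. q \<in> Q \<Longrightarrow> v (of_rat (a q - 2)) \<ge> 0"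
  shows "v (of_rat (L_sum Q)) \<ge> min 1 (v (of_rat (L_sum {})))"
proof -
  obtain s :: "nat \<Rightarrow> int" and n where sn: "\<forall>q\<in>Q. s q \<in> {-1, 1}"
    "L_sum Q = (\<Prod>q\<in>Q. a q - 2 * of_int (s q)) * L_sum {} + of_int (2 * n)"
    using L_sum_mod_2[OF assms(1,2)] by blast
  have "0 \<le> v (of_rat (a q - 2 * of_int (s q)))" if "q \<in> Q" for q
  proof -
    have eq: "a q - 2 * of_int (s q) = (a q - 2) + of_int (2 * (1 - s q))" by simp
    show ?thesis unfolding eq by (intro w_add_ge assms(3) that w_of_int)
  qed
  then have "0 \<le> v (of_rat (\<Prod>q\<in>Q. a q - 2 * of_int (s q)))" by (intro w_prod_nonneg assms(1))
  from w_mult_ge[OF this order_refl, of "L_sum {}"]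
  have 1: "min 1 (v (of_rat (L_sum {}))) \<le> v (of_rat ((\<Prod>q\<in>Q. a q - 2 * of_int (s q)) * L_sum {}))"
    by (intro min.coboundedI2) simp
  have 2: "min 1 (v (of_rat (L_sum {}))) \<le> v (of_rat (of_int (2 * n)))"
    by (rule min.coboundedI1) (rule w_even, simp)
  show ?thesis unfolding sn(2) by (rule w_add_ge[OF 1 2])
qed

lemma v_L_sum_eq_0:
  assumes "finite Q" "Q \<subseteq> odd_part.good_primes" "\<And>q. q \<in> Q \<Longrightarrow> v (of_rat (a q - 2)) = 0"
    and "v (of_rat (L_sum {})) = 0"
  shows "v (of_rat (L_sum Q)) = 0"
proof -
  obtain s :: "nat \<Rightarrow> int" and n where sn: "\<forall>q\<in>Q. s q \<in> {-1, 1}"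
    "L_sum Q = (\<Prod>q\<in>Q. a q - 2 * of_int (s q)) * L_sum {} + of_int (2 * n)"
    using L_sum_mod_2[OF assms(1,2)] by blast
  have "v (of_rat (a q - 2 * of_int (s q))) = 0" if "q \<in> Q" for q
  proof -
    have eq: "a q - 2 * of_int (s q) = (a q - 2) + of_int (2 * (1 - s q))" by simp
    show ?thesis unfolding eq by (intro w_unit_add assms(3) that w_even) simp
  qed
  then have "v (of_rat (\<Prod>q\<in>Q. a q - 2 * of_int (s q))) = 0" by (intro w_prod_0 assms(1))
  then have "v (of_rat ((\<Prod>q\<in>Q. a q - 2 * of_int (s q)) * L_sum {})) = 0"
    unfolding w_mult using assms(4) by simp
  then show ?thesis unfolding sn(2) by (rule w_unit_add) (rule w_even, simp)
qed

text \<open>The Hecke relation at 0 gives \<open>(a q - 1 - q) * base\<close> as half an integer,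
  and \<open>a q - 1 - q = (a q - 2) + (1 - q)\<close> is a 2-adic unit because \<open>q\<close> is
  odd. In the equality case this keeps the entry with \<open>L1\<close> from undercutting the
  minimum.\<close>

lemma v_L1_ge:
  assumes "q \<in> odd_part.good_primes" "v (of_rat (a q - 2)) = 0"
  shows "v (of_real base) \<ge> -1"
proof -
  have q: "prime q" "\<not> q dvd N" "odd q" using assms by (auto simp: odd_part.good_primes_def)
  define A where "A = a q - 1 - of_nat q"
  define z where "z = (\<Sum>b<q. re_part (of_nat b / of_nat q))"
  have "re_part 0 = 0" by (simp add: re_part_def int_part_def)
  then have eq: "of_rat A * base = of_rat (of_int z / 2)"
    using parts_hecke(1)[OF q(1,2), of 1 0] by (simp add: A_def z_def)
  have "A = (a q - 2) + of_int (1 - int q)" by (simp add: A_def)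
  then have vA: "v (of_rat A) = 0"
    using w_unit_add[OF assms(2) w_even[of "1 - int q"]] q(3) by simp
  then have "A \<noteq> 0" using w0 by auto
  then have "base = of_rat (of_int z / 2 / A)" using eq by (simp add: of_rat_divide of_rat_mult field_simps)
  then have b: "complex_of_real base = of_rat (of_int z / 2 / A)" by (simp add: complex_of_rat[symmetric])
  have "of_int z = of_int z / 2 / A * A * (2::rat)" using \<open>A \<noteq> 0\<close> by simp
  then have "v (of_rat (of_int z)) = v (of_rat (of_int z / 2 / A)) + 0 + 1"
    by (metis w_mult vA w2)
  then have "0 \<le> v (of_real base) + 1" unfolding b using w_of_int[of z] by simp
  then show ?thesis by (cases "v (of_real base)") (auto simp: one_ereal_def)
qed

end

section \<open>The two cases of \<open>vmin\<close> and the final bounds\<close>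

lemma vmin_cases:
  assumes "m > 1" and S: "prime_factors m \<subseteq> S_all v N a 0 \<union> S_all v N a 1 \<union> S_all v N a 2"
  shows "vmin v a m = 0 \<or> (vmin v a m \<noteq> 0 \<and> (\<forall>q\<in>prime_factors m. v (of_rat (a q - 2)) \<ge> 1))"
    and "\<And>q. q \<in> prime_factors m \<Longrightarrow> v (of_rat (a q - 2)) \<ge> 0"
proof -
  let ?h = "\<lambda>q. v (of_rat (a q - 2))"
  have val: "?h q \<in> {0, 1, 2}" if "q \<in> prime_factors m" for q
    using S that by (auto simp: S_all_def S_signed_def zero_ereal_def one_ereal_def)
  then show "\<And>q. q \<in> prime_factors m \<Longrightarrow> ?h q \<ge> 0" by fastforce
  have "prime_factors m \<noteq> {}" using assms(1) prime_factor_nat[of m] by (auto simp: prime_factors_dvd)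
  then have "vmin v a m \<in> ?h ` prime_factors m"
    unfolding vmin_def by (intro Min_in) auto
  then obtain q where "q \<in> prime_factors m" "vmin v a m = ?h q" by blast
  then have vm: "vmin v a m \<in> {0, 1, 2}" using val[of q] by simp
  show "vmin v a m = 0 \<or> (vmin v a m \<noteq> 0 \<and> (\<forall>q\<in>prime_factors m. ?h q \<ge> 1))"
  proof (cases "vmin v a m = 0")
    case False
    have "?h q \<ge> 1" if q: "q \<in> prime_factors m" for q
    proof (rule ccontr)
      assume "\<not> ?h q \<ge> 1"
      then have "?h q = 0" using val[OF q] by auto
      moreover have "vmin v a m \<le> ?h q" unfolding vmin_def using q by (intro Min_le) auto
      ultimately show False using vm False by auto
    qed
    then show ?thesis using False by blast
  qed simp
qed

theorem theorem4p4:
  fixes N m :: nat and f X Y :: "complex \<Rightarrow> complex" and a :: "nat \<Rightarrow> rat"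
    and E :: "int weierstrass" and \<Omega>p \<Omega>m :: real and v :: "complex \<Rightarrow> ereal"
  assumes newform: "rational_newform N f a"
    and minimal: "global_minimal E"
    and optimal: "optimal_parametrization N f (over_Q E) X Y"
    and manin_constant: "pullback_differential (over_Q E) X Y 1 f"
    and periods_pos: "\<Omega>p > 0" "\<Omega>m > 0"
    and nonrectangular: "period_lattice N f = nonrectangular_lattice \<Omega>p \<Omega>m"
    and valuation: "two_adic_valuation v"
    and N_odd: "odd N"
    and m: "m > 1" "odd m" "squarefree m" "coprime m N"
  defines "r \<equiv> ereal (real (card (prime_factors m)))"
    and "L4 \<equiv> v (central_ratio a \<Omega>p \<Omega>m 4)"
    and "L1 \<equiv> v (central_ratio a \<Omega>p \<Omega>m 1)"
    and "LM \<equiv> v (central_ratio a \<Omega>p \<Omega>m (4 * m))"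
  shows
    "(prime_factors m \<subseteq> S_all v N a 0 \<union> S_all v N a 1 \<union> S_all v N a 2 \<longrightarrow>
        LM \<ge> wmin v a m * r +
             Min {- 1 + kronecker (vmin v a m) 0,
                  - 1 + kronecker (vmin v a m) 0 + L1,
                  L4 + kronecker (vmin v a m) 2} \<and>
        (L4 = - 1 \<and> prime_factors m \<subseteq> S_all v N a 0 \<longrightarrow>
           LM = wmin v a m * r +
             Min {- 1 + kronecker (vmin v a m) 0,
                  - 1 + kronecker (vmin v a m) 0 + L1,
                  L4 + kronecker (vmin v a m) 2})) \<and>
     (prime_factors m \<subseteq> S_plus v N a 0 \<union> S_plus v N a 1 \<union> S_plus v N a 2 \<longrightarrow>
        LM \<ge> wmin v a m * r +
             Min {- 1 + kronecker (vmin v a m) 0,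
                  L4 + kronecker (vmin v a m) 2} \<and>
        (L4 = - 1 \<and> prime_factors m \<subseteq> S_plus v N a 0 \<longrightarrow>
           LM = wmin v a m * r +
             Min {- 1 + kronecker (vmin v a m) 0,
                  L4 + kronecker (vmin v a m) 2}))"
proof -
  interpret newform_periods N f a \<Omega>p \<Omega>m v
    by unfold_locales (fact newform periods_pos nonrectangular valuation N_odd)+
  define Q where "Q = prime_factors m"
  define V where "V = vmin v a m"
  let ?m1 = "Min {- 1 + kronecker V 0, - 1 + kronecker V 0 + L1, L4 + kronecker V 2}" and ?m2 = "Min {- 1 + kronecker V 0, L4 + kronecker V 2}"
  let ?S = "prime_factors m \<subseteq> S_all v N a 0 \<union> S_all v N a 1 \<union> S_all v N a 2"
  have Q: "finite Q" "Q \<noteq> {}" "Q \<subseteq> odd_part.good_primes"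
  proof -
    show "finite Q" by (simp add: Q_def)
    show "Q \<noteq> {}" using m(1) prime_factor_nat[of m] by (auto simp: Q_def prime_factors_dvd)
    have "odd q" "\<not> q dvd N" if "prime q" "q dvd m" for q
    proof -
      show "odd q" using m(2) that(2) dvd_trans by blast
      show "\<not> q dvd N" using m(4) that by (metis coprime_common_divisor_nat not_prime_1)
    qed
    then show "Q \<subseteq> odd_part.good_primes" by (auto simp: Q_def odd_part.good_primes_def prime_factors_dvd)
  qed
  have prodQ: "\<Prod>Q = m" unfolding Q_def using m by (intro prod_prime_factors_squarefree) auto
  have LM: "LM = v (of_rat (L_sum Q)) - 1"
    using v_L_ratio[OF Q(1,3)] by (simp add: LM_def L_ratio_def prodQ)
  have L4: "L4 = v (of_rat (L_sum {})) - 1"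
    using v_L_ratio[of "{}"] by (simp add: L4_def L_ratio_def)
  have L1: "L1 = v (of_real base)" unfolding L1_def by (rule v_L1)
  have r: "r = ereal (real (card Q))" by (simp add: r_def Q_def)
  have L4_0: "v (of_rat (L_sum {})) = 0" if "L4 = -1"
    using that unfolding L4 by (cases "v (of_rat (L_sum {}))") (auto simp: one_ereal_def zero_ereal_def)
  have cancel: "- 1 + 1 = (0::ereal)" by (simp add: one_ereal_def)
  have Splus: "S_plus v N a i \<subseteq> S_all v N a i" for i by (auto simp: S_all_def)
  \<comment> \<open>The bound 1 of the congruence modulo 2 turns into 0 when both valuations are
    lowered by 1.\<close>
  have case0: "LM \<ge> min 0 L4"
    if "?S"
  proof -
    have "min 1 (v (of_rat (L_sum {}))) \<le> v (of_rat (L_sum Q))"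
      by (rule v_L_sum_ge_min[OF Q(1,3)]) (use vmin_cases(2)[OF m(1) that] in \<open>simp add: Q_def\<close>)
    then show ?thesis unfolding LM L4
      by (cases "v (of_rat (L_sum {}))"; cases "v (of_rat (L_sum Q))") (auto simp: one_ereal_def zero_ereal_def min_def split: if_splits)
  qed
  have eq0: "LM = -1" "V = 0" "L1 \<ge> -1" if S0: "prime_factors m \<subseteq> S_all v N a 0" and "L4 = -1"
  proof -
    have h: "v (of_rat (a q - 2)) = 0" if "q \<in> Q" for q
      using S0 that by (auto simp: Q_def S_all_def S_signed_def zero_ereal_def)
    have "v (of_rat (L_sum Q)) = 0"
      by (rule v_L_sum_eq_0[OF Q(1,3)]) (use h L4_0[OF \<open>L4 = -1\<close>] in simp_all)
    then show "LM = -1" unfolding LM by simp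
    have "(\<lambda>q. v (of_rat (a q - 2))) ` prime_factors m = {0}" using h Q(2) by (auto simp: Q_def)
    then show "V = 0" by (simp add: V_def vmin_def)
    obtain q where "q \<in> Q" using Q(2) by blast
    then show "L1 \<ge> -1" unfolding L1 using h Q(3) v_L1_ge[of q] by blast
  qed
  have part1: "LM \<ge> wmin v a m * r + ?m1"
    if S: "?S"
    using vmin_cases(1)[OF m(1) S]
  proof
    assume V0: "vmin v a m = 0"
    have w: "wmin v a m * r = 0" using V0 by (simp add: wmin_def)
    \<comment> \<open>With \<open>V = 0\<close> the first entry is \<open>-1 + 1 = 0\<close> and the
      third is \<open>L4\<close>.\<close>
    have "?m1 \<le> min 0 L4"
      using V0 by (simp add: V_def kronecker_def cancel min.coboundedI2)
    from order_trans[OF this case0[OF S]] show ?thesis unfolding w add_0 .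
  next
    assume V1: "vmin v a m \<noteq> 0 \<and> (\<forall>q\<in>prime_factors m. v (of_rat (a q - 2)) \<ge> 1)"
    have "v (of_rat (L_sum Q)) \<ge> r + min 0 L1"
      unfolding r L1 by (rule v_L_sum_ge(1)[OF Q(1,3)]) (use V1 in \<open>simp add: Q_def\<close>)
    then have "LM \<ge> r + min (-1) (-1 + L1)"
      unfolding LM r
      by (cases "v (of_rat (L_sum Q))"; cases L1) (auto simp: one_ereal_def zero_ereal_def min_def split: if_splits)
    \<comment> \<open>With \<open>V \<noteq> 0\<close> the first two entries are \<open>-1\<close>
      and \<open>-1 + L1\<close>; a third entry can only lower the minimum.\<close>
    moreover have "r + ?m1 \<le> r + min (-1) (-1 + L1)"
      using V1 by (intro add_left_mono) (simp add: V_def kronecker_def min.coboundedI2 min.coboundedI1)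
    moreover have w: "wmin v a m * r = r" using V1 by (simp add: wmin_def)
    ultimately show ?thesis unfolding w by (meson order_trans)
  qed
  have part2: "LM \<ge> wmin v a m * r + ?m2"
    if S': "prime_factors m \<subseteq> S_plus v N a 0 \<union> S_plus v N a 1 \<union> S_plus v N a 2"
  proof -
    have S: "?S"
      using S' Splus by blast
    from vmin_cases(1)[OF m(1) S] show ?thesis
    proof
      assume V0: "vmin v a m = 0"
      then show ?thesis using case0[OF S] by (simp add: V_def kronecker_def wmin_def cancel)
    next
      assume V1: "vmin v a m \<noteq> 0 \<and> (\<forall>q\<in>prime_factors m. v (of_rat (a q - 2)) \<ge> 1)"
      \<comment> \<open>Membership in the positive sets makes the sign of the twisting character
        that of \<open>chi4\<close>, so it is odd and the bound without \<open>base\<close>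
        applies.\<close>
      have "Legendre (-1) (int q) = 1" if "q \<in> Q" for q
      proof -
        have q: "prime q" "odd q" "quad_char q (-1) = 1"
          using S' that by (auto simp: Q_def S_signed_def)
        then have "\<not> 4 dvd q" using dvd_trans[of 2 4 q] by auto
        then show ?thesis using q by (simp add: quad_char_def prime_prime_factors)
      qed
      then have "ind_char True Q Q (-1) = -1"
        using Q(3) by (subst ind_char_minus_1) (auto simp: odd_part.good_primes_def)
      then have "v (of_rat (L_sum Q)) \<ge> r"
        unfolding r by (intro v_L_sum_ge(2)[OF Q(1,3)]) (use V1 in \<open>simp_all add: Q_def\<close>)
      then have "LM \<ge> r + (-1)"
        unfolding LM r
        by (cases "v (of_rat (L_sum Q))") (auto simp: one_ereal_def)
      moreover have "r + ?m2 \<le> r + (-1)"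
        using V1 by (intro add_left_mono) (simp add: V_def kronecker_def)
      moreover have w: "wmin v a m * r = r" using V1 by (simp add: wmin_def)
      ultimately show ?thesis unfolding w by (meson order_trans)
    qed
  qed
  \<comment> \<open>Here \<open>V = 0\<close> and \<open>wmin\<close> is 0; the entries are
    \<open>0\<close>, \<open>L1 \<ge> -1\<close> and \<open>L4 = -1\<close>, so both minima are
    \<open>-1\<close>.\<close>
  have eq1: "LM = wmin v a m * r + ?m1"
    "LM = wmin v a m * r + ?m2"
    if "L4 = -1" "prime_factors m \<subseteq> S_all v N a 0"
    using eq0[OF that(2,1)] that(1)
    by (auto simp: V_def wmin_def kronecker_def cancel min_def)
  show ?thesis
    unfolding V_def[symmetric] using part1 part2 eq1 Splus[of 0] by blast
qed

end
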